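(* For $n\ge 4$, there is a short exact sequence $$1\longrightarrow PT_n/PT_n'\longrightarrow T_n/PT_n'\stackrel{\pi}{\longrightarrow} S_n\longrightarrow 1$$ such that $T_n/PT_n'$ is a crystallographic group of dimension $2^{n-3}(n^2-5n+8)-1$. Furthermore, $T_n/PT_n'$ is not a Bieberbach group.
   Context: The twin group is $T_n=\langle s_1,\dots,s_{n-1}\mid s_k^2=1 \text{ for all } k,\ s_is_j=s_js_i \text{ for } |i-j|\ge 2\rangle$. The pure twin group $PT_n$ is the kernel of the surjection $T_n\to S_n$ sending $s_i$ to the transposition $\tau_i=(i,i+1)$; $PT_n'$ is the commutator subgroup of $PT_n$ (normal in $T_n$), and $\pi$ is the map induced by $T_n\to S_n$. A crystallographic group of dimension $d$ is a group isomorphic to a discrete uniform (i.e. cocompact) subgroup of $\mathbb{R}^d\rtimes \mathrm{O}(d,\mathbb{R})$. Equivalently, it is a group $G$ for which there are a finite group $H$ and a short exact sequence $0\to\mathbb{Z}^d\to G\stackrel{\eta}{\to} H\to1$ such that the representation $\Theta:H\to\mathrm{Aut}(\mathbb{Z}^d)$, $\Theta(h)(x)=zxz^{-1}$ (where $z\in G$ satisfies $\eta(z)=h$), is faithful. A Bieberbach group is a torsion free crystallographic group. *)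

theory Defs
  imports
    "HOL-Analysis.Analysis"
    "HOL-Algebra.Sym_Groups"
    "HOL-Combinatorics.Transposition"
    "Jordan_Normal_Form.Matrix"
begin

section \<open>Groups given by generators and relations\<close>

text \<open>The letter \<open>(x, True)\<close> stands for \<open>x\<close> and \<open>(x, False)\<close> for \<open>x\<^sup>-\<^sup>1\<close>.
  A pair \<open>(u, v)\<close> in the set of relations stands for the relation \<open>u = v\<close>.\<close>

type_synonym 'a gword = "('a \<times> bool) list"

definition gwords :: "'a set \<Rightarrow> 'a gword set" where
  "gwords X = lists (X \<times> UNIV)"

inductive_set pres_rel :: "'a set \<Rightarrow> ('a gword \<times> 'a gword) set \<Rightarrow> ('a gword \<times> 'a gword) set"
  for X R where
  refl: "u \<in> gwords X \<Longrightarrow> (u, u) \<in> pres_rel X R"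
| sym: "(u, v) \<in> pres_rel X R \<Longrightarrow> (v, u) \<in> pres_rel X R"
| trans: "(u, v) \<in> pres_rel X R \<Longrightarrow> (v, w) \<in> pres_rel X R \<Longrightarrow> (u, w) \<in> pres_rel X R"
| append: "(u, v) \<in> pres_rel X R \<Longrightarrow> (u', v') \<in> pres_rel X R \<Longrightarrow> (u @ u', v @ v') \<in> pres_rel X R"
| cancel: "x \<in> X \<Longrightarrow> ([(x, b), (x, \<not> b)], []) \<in> pres_rel X R"
| relation: "(u, v) \<in> R \<Longrightarrow> u \<in> gwords X \<Longrightarrow> v \<in> gwords X \<Longrightarrow> (u, v) \<in> pres_rel X R"

definition presented_group ::
  "'a set \<Rightarrow> ('a gword \<times> 'a gword) set \<Rightarrow> 'a gword set monoid" where
  "presented_group X R =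
     \<lparr>carrier = gwords X // pres_rel X R,
      mult = (\<lambda>A B. \<Union>u\<in>A. \<Union>v\<in>B. pres_rel X R `` {u @ v}),
      one = pres_rel X R `` {[]}\<rparr>"

definition word_eval :: "('b, 'm) monoid_scheme \<Rightarrow> ('a \<Rightarrow> 'b) \<Rightarrow> 'a gword \<Rightarrow> 'b" where
  "word_eval G f w =
     foldr (\<lambda>(x, b) y. (if b then f x else inv\<^bsub>G\<^esub> (f x)) \<otimes>\<^bsub>G\<^esub> y) w \<one>\<^bsub>G\<^esub>"

text \<open>The homomorphism from a presented group to \<open>G\<close> that sends each generator \<open>x\<close> to \<open>f x\<close>;
  meaningful when \<open>f\<close> respects the relations.\<close>

definition presented_hom ::
  "('b, 'm) monoid_scheme \<Rightarrow> ('a \<Rightarrow> 'b) \<Rightarrow> 'a gword set \<Rightarrow> 'b" where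
  "presented_hom G f A = the_elem (word_eval G f ` A)"


section \<open>Twin groups\<close>

definition twin_relations :: "nat \<Rightarrow> (nat gword \<times> nat gword) set" where
  "twin_relations n =
     {([(k, True), (k, True)], []) | k. k \<in> {1..n - 1}} \<union>
     {([(i, True), (j, True)], [(j, True), (i, True)]) | i j.
        i \<in> {1..n - 1} \<and> j \<in> {1..n - 1} \<and> \<bar>int i - int j\<bar> \<ge> 2}"

definition twin_group :: "nat \<Rightarrow> nat gword set monoid" where
  "twin_group n = presented_group {1..n - 1} (twin_relations n)"

definition twin_perm :: "nat \<Rightarrow> nat gword set \<Rightarrow> nat \<Rightarrow> nat" where
  "twin_perm n = presented_hom (sym_group n) (\<lambda>i. Transposition.transpose i (i + 1))"

definition pure_twin :: "nat \<Rightarrow> nat gword set set" where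
  "pure_twin n = kernel (twin_group n) (sym_group n) (twin_perm n)"

definition pure_twin_group :: "nat \<Rightarrow> nat gword set monoid" where
  "pure_twin_group n = (twin_group n)\<lparr>carrier := pure_twin n\<rparr>"

definition pure_twin_commutator :: "nat \<Rightarrow> nat gword set set" where
  "pure_twin_commutator n = derived (pure_twin_group n) (carrier (pure_twin_group n))"

text \<open>The map induced by \<open>twin_perm n\<close> on cosets of the commutator subgroup. No definition is needed
  for the map induced by the inclusion of the pure twin group: a coset of the commutator subgroup
  in the pure twin group is, as a set, the same coset in the twin group.\<close>

definition twin_quotient_perm :: "nat \<Rightarrow> nat gword set set \<Rightarrow> nat \<Rightarrow> nat" where
  "twin_quotient_perm n A = the_elem (twin_perm n ` A)"


section \<open>Short exact sequences\<close>

text \<open>The library's notion of a short exact sequence requires all groups to have elements of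
  the same type.\<close>

definition short_exact ::
  "('a, 'm) monoid_scheme \<Rightarrow> ('a \<Rightarrow> 'b) \<Rightarrow> ('b, 'n) monoid_scheme \<Rightarrow> ('b \<Rightarrow> 'c) \<Rightarrow>
   ('c, 'k) monoid_scheme \<Rightarrow> bool" where
  "short_exact A f B g C \<longleftrightarrow>
     group A \<and> group B \<and> group C \<and> f \<in> hom A B \<and> g \<in> hom B C \<and>
     kernel A B f = {\<one>\<^bsub>A\<^esub>} \<and>
     f ` carrier A = kernel B C g \<and>
     g ` carrier B = carrier C"


section \<open>Crystallographic groups\<close>

text \<open>The semidirect product of \<open>\<real>\<^sup>d\<close> and \<open>O(d, \<real>)\<close>, with \<open>(v, A)\<close> acting on \<open>\<real>\<^sup>d\<close>
  as \<open>x \<mapsto> v + A x\<close>.\<close>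

definition orthogonal_mats :: "nat \<Rightarrow> real mat set" where
  "orthogonal_mats d = {A \<in> carrier_mat d d. transpose_mat A * A = 1\<^sub>m d}"

definition euclidean_motions :: "nat \<Rightarrow> (real Matrix.vec \<times> real mat) monoid" where
  "euclidean_motions d =
     \<lparr>carrier = carrier_vec d \<times> orthogonal_mats d,
      mult = (\<lambda>(v, A) (w, B). (v + A *\<^sub>v w, A * B)),
      one = (0\<^sub>v d, 1\<^sub>m d)\<rparr>"

text \<open>The usual topology, that is, the one given by the \<open>d + d\<^sup>2\<close> real coordinates.\<close>

definition motion_coords ::
  "nat \<Rightarrow> real Matrix.vec \<times> real mat \<Rightarrow> (nat \<Rightarrow> real) \<times> (nat \<times> nat \<Rightarrow> real)" where
  "motion_coords d = (\<lambda>(v, A).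
     (restrict (\<lambda>i. vec_index v i) {..<d},
      restrict (\<lambda>p. index_mat A p) ({..<d} \<times> {..<d})))"

definition motion_topology :: "nat \<Rightarrow> (real Matrix.vec \<times> real mat) topology" where
  "motion_topology d =
     pullback_topology (carrier (euclidean_motions d)) (motion_coords d)
       (prod_topology (product_topology (\<lambda>_. euclideanreal) {..<d})
          (product_topology (\<lambda>_. euclideanreal) ({..<d} \<times> {..<d})))"

definition quotient_topology :: "'a topology \<Rightarrow> ('a \<Rightarrow> 'b) \<Rightarrow> 'b topology" where
  "quotient_topology X q =
     topology (\<lambda>U. U \<subseteq> q ` topspace X \<and> openin X {x \<in> topspace X. q x \<in> U})"

lemma openin_quotient_topology:
  "openin (quotient_topology X q) U \<longleftrightarrow>
     U \<subseteq> q ` topspace X \<and> openin X {x \<in> topspace X. q x \<in> U}"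
proof -
  have "istopology (\<lambda>U. U \<subseteq> q ` topspace X \<and> openin X {x \<in> topspace X. q x \<in> U})"
    unfolding istopology_def
  proof (intro conjI allI impI)
    fix S T
    assume a: "S \<subseteq> q ` topspace X \<and> openin X {x \<in> topspace X. q x \<in> S}"
      and b: "T \<subseteq> q ` topspace X \<and> openin X {x \<in> topspace X. q x \<in> T}"
    show "S \<inter> T \<subseteq> q ` topspace X" using a by blast
    have "{x \<in> topspace X. q x \<in> S \<inter> T} =
        {x \<in> topspace X. q x \<in> S} \<inter> {x \<in> topspace X. q x \<in> T}" by blast
    then show "openin X {x \<in> topspace X. q x \<in> S \<inter> T}"
      using a b by (simp add: openin_Int)
  next
    fix K
    assume a: "\<forall>S\<in>K. S \<subseteq> q ` topspace X \<and> openin X {x \<in> topspace X. q x \<in> S}"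
    show "\<Union>K \<subseteq> q ` topspace X" using a by blast
    have "{x \<in> topspace X. q x \<in> \<Union>K} = (\<Union>S\<in>K. {x \<in> topspace X. q x \<in> S})" by blast
    then show "openin X {x \<in> topspace X. q x \<in> \<Union>K}"
      using a by (simp add: openin_clauses(3))
  qed
  then show ?thesis unfolding quotient_topology_def by simp
qed

definition discrete_in :: "'a topology \<Rightarrow> 'a set \<Rightarrow> bool" where
  "discrete_in X S \<longleftrightarrow> subtopology X S = discrete_topology S"

definition uniform_subgroup :: "nat \<Rightarrow> (real Matrix.vec \<times> real mat) set \<Rightarrow> bool" where
  "uniform_subgroup d \<Gamma> \<longleftrightarrow>
     compact_space
       (quotient_topology (motion_topology d) (\<lambda>g. g <#\<^bsub>euclidean_motions d\<^esub> \<Gamma>))"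

definition crystallographic_group :: "nat \<Rightarrow> ('a, 'm) monoid_scheme \<Rightarrow> bool" where
  "crystallographic_group d G \<longleftrightarrow> group G \<and>
     (\<exists>\<Gamma>. subgroup \<Gamma> (euclidean_motions d) \<and> discrete_in (motion_topology d) \<Gamma> \<and>
          uniform_subgroup d \<Gamma> \<and> G \<cong> (euclidean_motions d)\<lparr>carrier := \<Gamma>\<rparr>)"

definition torsion_free_group :: "('a, 'm) monoid_scheme \<Rightarrow> bool" where
  "torsion_free_group G \<longleftrightarrow>
     (\<forall>x\<in>carrier G. \<forall>k::nat. 0 < k \<longrightarrow> x [^]\<^bsub>G\<^esub> k = \<one>\<^bsub>G\<^esub> \<longrightarrow> x = \<one>\<^bsub>G\<^esub>)"

definition bieberbach_group :: "('a, 'm) monoid_scheme \<Rightarrow> bool" where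
  "bieberbach_group G \<longleftrightarrow> (\<exists>d. crystallographic_group d G) \<and> torsion_free_group G"

end

theory Submission
  imports Defs "Jordan_Normal_Form.Determinant"
begin

text \<open>
  Write \<open>G\<close> for the twin group, \<open>P\<close> for the pure twin group and \<open>P'\<close> for its commutator subgroup.
  An element of \<open>G\<close> is a sequence of exchanges of neighbouring labels in an arrangement of \<open>1, \<dots>, n\<close>.
  The key is a homomorphism from \<open>G\<close> to a semidirect product of integer vectors with the symmetric
  group. It records, for every exchange, which two labels cross and which set of labels stands to
  the left of them. This is well defined because distant exchanges do not alter that information.
  On \<open>P\<close> it is additive, so it kills \<open>P'\<close>.

  The symmetric group arises from \<open>G\<close> by adding the braid relations. Hence \<open>P\<close> is generated by
  hexagons, that is, by conjugates of \<open>(s (i + 1) s i)\<^sup>3\<close>. Modulo \<open>P'\<close> a hexagon depends, up to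
  orientation, only on the set \<open>A\<close> of labels to its left and the set \<open>T\<close> of the three labels involved.
  Rewriting words to the usual normal forms of permutations, in which the labels \<open>2, \<dots>, n\<close> are
  moved into place one after another, only uses hexagons whose last label is larger than everything
  before it. So the hexagons with \<open>max A < max T\<close> generate \<open>P\<close> modulo \<open>P'\<close>
  (\<open>pure_subset_if_hexagons\<close>). The crossing vectors of these hexagons are triangular with respect to
  suitable coordinates, ordered by the size of \<open>A\<close>, and therefore independent
  (\<open>hexvec_independent\<close>). It follows that these hexagons are a basis of \<open>P / P'\<close> and that the crossing vector
  is injective on \<open>P / P'\<close>. Counting the pairs \<open>(A, T)\<close> by their largest label gives the dimension
  (\<open>card_hex_labels\<close>).

  The semidirect product acts on a real vector space by integral translations and permutations of
  coordinates. Projecting orthogonally to the span of the lattice \<open>P / P'\<close> gives an action of \<open>G / P'\<close> on a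
  Euclidean space of the right dimension. It is discrete because the lattice is integral and only finitely
  many linear parts occur, and cocompact because the lattice spans (locale \<open>lattice_action\<close>). For
  \<open>n \<ge> 4\<close> the symmetric group acts faithfully on this lattice, since a permutation that fixes
  the crossing vectors of all hexagons with one given label on their left must fix that label
  (\<open>perm_fixing_crossings\<close>). Finally, the generators of \<open>G\<close> have order two also in
  \<open>G / P'\<close>, so this group has torsion.
\<close>

section \<open>Presented groups\<close>

lemma pres_rel_subset: "(u, v) \<in> pres_rel X R \<Longrightarrow> u \<in> gwords X \<and> v \<in> gwords X"
  by (induction rule: pres_rel.induct) (auto simp: gwords_def)

lemma equiv_pres_rel: "equiv (gwords X) (pres_rel X R)"
proof (rule equivI)
  show "pres_rel X R \<subseteq> gwords X \<times> gwords X"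
    using pres_rel_subset by auto
  show "refl_on (gwords X) (pres_rel X R)"
    unfolding refl_on_def using pres_rel_subset by (blast intro: pres_rel.refl)
  show "sym (pres_rel X R)"
    unfolding sym_def by (blast intro: pres_rel.sym)
  show "trans (pres_rel X R)"
    unfolding trans_def by (blast intro: pres_rel.trans)
qed

abbreviation word_class :: "'a set \<Rightarrow> ('a gword \<times> 'a gword) set \<Rightarrow> 'a gword \<Rightarrow> 'a gword set" where
  "word_class X R u \<equiv> pres_rel X R `` {u}"

lemma gwords_append: "u \<in> gwords X \<Longrightarrow> v \<in> gwords X \<Longrightarrow> u @ v \<in> gwords X"
  by (auto simp: gwords_def)

lemma mult_word_class:
  assumes "u \<in> gwords X" "v \<in> gwords X"
  shows "word_class X R u \<otimes>\<^bsub>presented_group X R\<^esub> word_class X R v = word_class X R (u @ v)"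
proof -
  have step: "word_class X R (u' @ v') = word_class X R (u @ v)"
    if "(u, u') \<in> pres_rel X R" "(v, v') \<in> pres_rel X R" for u' v'
    using equiv_class_eq[OF equiv_pres_rel pres_rel.append[OF that]] by simp
  have "(u, u) \<in> pres_rel X R" "(v, v) \<in> pres_rel X R"
    using assms by (auto intro: pres_rel.refl)
  then show ?thesis
    unfolding presented_group_def monoid.select_convs
    by (intro equalityI subsetI) (use step in \<open>blast+\<close>)
qed

definition inv_word :: "'a gword \<Rightarrow> 'a gword" where
  "inv_word u = rev (map (\<lambda>(x, b). (x, \<not> b)) u)"

lemma inv_word_gwords: "u \<in> gwords X \<Longrightarrow> inv_word u \<in> gwords X"
  by (auto simp: gwords_def inv_word_def)

lemma inv_word_cancel:
  assumes "u \<in> gwords X"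
  shows "(inv_word u @ u, []) \<in> pres_rel X R"
  using assms
proof (induction u)
  case Nil
  show ?case by (auto simp: inv_word_def gwords_def intro: pres_rel.refl)
next
  case (Cons a u)
  obtain x b where a: "a = (x, b)" by (cases a)
  have u: "u \<in> gwords X" and x: "x \<in> X" using Cons.prems a by (auto simp: gwords_def)
  have "([(x, \<not> b), (x, \<not> \<not> b)], []) \<in> pres_rel X R"
    by (rule pres_rel.cancel[OF x])
  from pres_rel.append[OF this pres_rel.refl[OF u]]
  have "([(x, \<not> b), (x, b)] @ u, u) \<in> pres_rel X R" by simp
  from pres_rel.append[OF pres_rel.refl[OF inv_word_gwords[OF u]] this]
  have "(inv_word (a # u) @ a # u, inv_word u @ u) \<in> pres_rel X R"
    by (simp add: inv_word_def a)
  then show ?case using Cons.IH[OF u] by (rule pres_rel.trans)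
qed

lemma group_presented_group: "group (presented_group X R)"
proof (rule groupI)
  let ?G = "presented_group X R"
  have car: "carrier ?G = gwords X // pres_rel X R" by (simp add: presented_group_def)
  have one: "\<one>\<^bsub>?G\<^esub> = word_class X R []" by (simp add: presented_group_def)
  have nil: "[] \<in> gwords X" by (auto simp: gwords_def)
  show "\<one>\<^bsub>?G\<^esub> \<in> carrier ?G" unfolding car one using nil by (rule quotientI)
  fix a assume "a \<in> carrier ?G"
  then obtain u where u: "u \<in> gwords X" "a = word_class X R u"
    unfolding car by (rule quotientE)
  show "\<one>\<^bsub>?G\<^esub> \<otimes>\<^bsub>?G\<^esub> a = a"
    unfolding one u(2) using mult_word_class[OF nil u(1)] by simp
  have "word_class X R (inv_word u) \<otimes>\<^bsub>?G\<^esub> a = \<one>\<^bsub>?G\<^esub>"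
    unfolding u(2) one mult_word_class[OF inv_word_gwords[OF u(1)] u(1)]
    by (rule equiv_class_eq[OF equiv_pres_rel inv_word_cancel[OF u(1)]])
  moreover have "word_class X R (inv_word u) \<in> carrier ?G"
    unfolding car using inv_word_gwords[OF u(1)] by (rule quotientI)
  ultimately show "\<exists>y\<in>carrier ?G. y \<otimes>\<^bsub>?G\<^esub> a = \<one>\<^bsub>?G\<^esub>" by blast
  fix b assume "b \<in> carrier ?G"
  then obtain v where v: "v \<in> gwords X" "b = word_class X R v"
    unfolding car by (rule quotientE)
  show "a \<otimes>\<^bsub>?G\<^esub> b \<in> carrier ?G"
    unfolding u(2) v(2) mult_word_class[OF u(1) v(1)] car
    using gwords_append[OF u(1) v(1)] by (rule quotientI)
  fix c assume "c \<in> carrier ?G"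
  then obtain w where w: "w \<in> gwords X" "c = word_class X R w"
    unfolding car by (rule quotientE)
  show "a \<otimes>\<^bsub>?G\<^esub> b \<otimes>\<^bsub>?G\<^esub> c = a \<otimes>\<^bsub>?G\<^esub> (b \<otimes>\<^bsub>?G\<^esub> c)"
    unfolding u(2) v(2) w(2) by (simp add: mult_word_class gwords_append u(1) v(1) w(1))
qed

lemma presented_group_cases:
  assumes "g \<in> carrier (presented_group X R)"
  obtains u where "u \<in> gwords X" "g = word_class X R u"
  using assms unfolding presented_group_def by (auto elim: quotientE)

lemma word_class_in_carrier: "u \<in> gwords X \<Longrightarrow> word_class X R u \<in> carrier (presented_group X R)"
  by (simp add: presented_group_def quotientI)

lemma word_class_Cons:
  assumes "x \<in> X" "u \<in> gwords X"
  shows "word_class X R ((x, b) # u) =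
    (if b then word_class X R [(x, True)] else inv\<^bsub>presented_group X R\<^esub> (word_class X R [(x, True)]))
      \<otimes>\<^bsub>presented_group X R\<^esub> word_class X R u"
proof -
  interpret group "presented_group X R" by (rule group_presented_group)
  have sing: "[(x, c)] \<in> gwords X" for c using assms by (auto simp: gwords_def)
  have "([(x, False), (x, True)], []) \<in> pres_rel X R"
    using pres_rel.cancel[OF assms(1), of False] by simp
  then have "word_class X R [(x, False)] \<otimes>\<^bsub>presented_group X R\<^esub> word_class X R [(x, True)] = \<one>\<^bsub>presented_group X R\<^esub>"
    using mult_word_class[OF sing sing, of R False True] equiv_class_eq[OF equiv_pres_rel]
    by (simp add: presented_group_def)
  then have "inv\<^bsub>presented_group X R\<^esub> (word_class X R [(x, True)]) = word_class X R [(x, False)]"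
    using word_class_in_carrier[OF sing] by (metis inv_equality)
  then have "word_class X R [(x, b)] =
    (if b then word_class X R [(x, True)] else inv\<^bsub>presented_group X R\<^esub> (word_class X R [(x, True)]))"
    by (cases b) auto
  then show ?thesis using mult_word_class[OF sing assms(2), of R b] by simp
qed

lemma presented_group_induct [consumes 1, case_names one gen inv]:
  assumes g: "g \<in> carrier (presented_group X R)"
    and one: "P \<one>\<^bsub>presented_group X R\<^esub>"
    and gen: "\<And>x g. x \<in> X \<Longrightarrow> g \<in> carrier (presented_group X R) \<Longrightarrow> P g \<Longrightarrow>
      P (word_class X R [(x, True)] \<otimes>\<^bsub>presented_group X R\<^esub> g)"
    and inv: "\<And>x g. x \<in> X \<Longrightarrow> g \<in> carrier (presented_group X R) \<Longrightarrow> P g \<Longrightarrow>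
      P (inv\<^bsub>presented_group X R\<^esub> (word_class X R [(x, True)]) \<otimes>\<^bsub>presented_group X R\<^esub> g)"
  shows "P g"
proof -
  obtain u where u: "u \<in> gwords X" "g = word_class X R u"
    using g by (rule presented_group_cases)
  have "P (word_class X R u)" using u(1)
  proof (induction u)
    case Nil
    then show ?case using one by (simp add: presented_group_def)
  next
    case (Cons a u)
    obtain x b where a: "a = (x, b)" by (cases a)
    have u: "u \<in> gwords X" and x: "x \<in> X" using Cons.prems a by (auto simp: gwords_def)
    show ?case unfolding a word_class_Cons[OF x u]
      using Cons.IH[OF u] word_class_in_carrier[OF u] gen inv x by simp
  qed
  then show ?thesis using u by simp
qed

context group
begin

lemma word_eval_closed:
  assumes "f \<in> X \<rightarrow> carrier G" "u \<in> gwords X"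
  shows "word_eval G f u \<in> carrier G"
  using assms(2) by (induction u) (use assms(1) in \<open>auto simp: word_eval_def gwords_def Pi_iff\<close>)

lemma word_eval_append:
  assumes f: "f \<in> X \<rightarrow> carrier G" and "u \<in> gwords X" and v: "v \<in> gwords X"
  shows "word_eval G f (u @ v) = word_eval G f u \<otimes> word_eval G f v"
  using assms(2)
proof (induction u)
  case Nil
  then show ?case using word_eval_closed[OF f v] by (simp add: word_eval_def)
next
  case (Cons a u)
  obtain x b where a: "a = (x, b)" by (cases a)
  have u: "u \<in> gwords X" and x: "x \<in> X" using Cons.prems a by (auto simp: gwords_def)
  have "word_eval G f (u @ v) = word_eval G f u \<otimes> word_eval G f v" using Cons.IH u by simp
  moreover have "f x \<in> carrier G" using f x by blast
  ultimately show ?case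
    using word_eval_closed[OF f v] word_eval_closed[OF f u]
    by (simp add: a word_eval_def m_assoc)
qed

lemma word_eval_pres_rel:
  assumes f: "f \<in> X \<rightarrow> carrier G"
    and R: "\<forall>(u, v) \<in> R. word_eval G f u = word_eval G f v"
    and "(u, v) \<in> pres_rel X R"
  shows "word_eval G f u = word_eval G f v"
  using assms(3)
proof (induction rule: pres_rel.induct)
  case (append u v u' v')
  have "u \<in> gwords X" "v \<in> gwords X" "u' \<in> gwords X" "v' \<in> gwords X"
    using pres_rel_subset append.hyps by blast+
  then show ?case using append.IH word_eval_append[OF f] by simp
next
  case (cancel x b)
  have "f x \<in> carrier G" using f cancel by blast
  then show ?case by (cases b) (simp_all add: word_eval_def)
next
  case (relation u v)
  then show ?case using R by blast
qed simp_all

text \<open>The universal property: a map on the generators that respects the relations takes the same value on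
  equivalent words, so it extends to a homomorphism.\<close>

lemma presented_hom_word_class:
  assumes f: "f \<in> X \<rightarrow> carrier G"
    and R: "\<forall>(u, v) \<in> R. word_eval G f u = word_eval G f v"
    and u: "u \<in> gwords X"
  shows "presented_hom G f (word_class X R u) = word_eval G f u"
proof -
  have "word_eval G f v = word_eval G f u" if "v \<in> word_class X R u" for v
    using word_eval_pres_rel[OF f R, of u v] that by simp
  moreover have "u \<in> word_class X R u" using pres_rel.refl[OF u] by simp
  ultimately have "word_eval G f ` word_class X R u = {word_eval G f u}"
    by blast
  then show ?thesis by (simp add: presented_hom_def)
qed

lemma presented_hom_hom:
  assumes f: "f \<in> X \<rightarrow> carrier G"
    and R: "\<forall>(u, v) \<in> R. word_eval G f u = word_eval G f v"
  shows "presented_hom G f \<in> hom (presented_group X R) G"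
proof (rule homI)
  fix a assume "a \<in> carrier (presented_group X R)"
  then obtain u where u: "u \<in> gwords X" "a = word_class X R u"
    by (rule presented_group_cases)
  show "presented_hom G f a \<in> carrier G"
    unfolding u(2) presented_hom_word_class[OF f R u(1)] using word_eval_closed[OF f u(1)] .
next
  fix a b
  assume "a \<in> carrier (presented_group X R)" "b \<in> carrier (presented_group X R)"
  then obtain u v where u: "u \<in> gwords X" "a = word_class X R u"
    and v: "v \<in> gwords X" "b = word_class X R v"
    by (metis presented_group_cases)
  show "presented_hom G f (a \<otimes>\<^bsub>presented_group X R\<^esub> b) = presented_hom G f a \<otimes> presented_hom G f b"
    unfolding u(2) v(2) mult_word_class[OF u(1) v(1)]
      presented_hom_word_class[OF f R u(1)] presented_hom_word_class[OF f R v(1)]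
      presented_hom_word_class[OF f R gwords_append[OF u(1) v(1)]]
    by (rule word_eval_append[OF f u(1) v(1)])
qed

lemma presented_hom_gen:
  assumes f: "f \<in> X \<rightarrow> carrier G"
    and R: "\<forall>(u, v) \<in> R. word_eval G f u = word_eval G f v"
    and x: "x \<in> X"
  shows "presented_hom G f (word_class X R [(x, True)]) = f x"
proof -
  have "[(x, True)] \<in> gwords X" "f x \<in> carrier G" using x f by (auto simp: gwords_def)
  then show ?thesis
    using presented_hom_word_class[OF f R] by (simp add: word_eval_def)
qed

end

section \<open>Permutations as products of adjacent transpositions\<close>

lemma permutes_id_if_no_descent:
  fixes n :: nat
  assumes p: "p permutes {1..n}" and asc: "\<And>j. 1 \<le> j \<Longrightarrow> j < n \<Longrightarrow> p j \<le> p (Suc j)"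
  shows "p = id"
proof (rule permutes_natset_ge[OF p])
  have "1 \<le> i \<longrightarrow> i \<le> n \<longrightarrow> i \<le> p i" for i
  proof (induction i)
    case (Suc i)
    show ?case
    proof (cases "i = 0")
      case True
      then show ?thesis using permutes_in_image[OF p, of 1] by auto
    next
      case False
      have "p i \<noteq> p (Suc i)" using permutes_inj[OF p] by (metis injD n_not_Suc_n)
      then show ?thesis using Suc False asc[of i] by auto
    qed
  qed simp
  then show "\<forall>i\<in>{1..n}. i \<le> p i" by simp
qed

text \<open>Undoing a descent of \<open>p\<close> never uses a transposition across a cut, because a descent at
  position \<open>j\<close> means that the first \<open>j\<close> positions are not mapped to themselves.\<close>

lemma apply_adj_transps_avoiding_cuts:
  fixes n :: nat
  assumes "p permutes {1..n}" and "\<And>m. m \<in> J \<Longrightarrow> p ` {1..m} \<subseteq> {1..m}"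
  shows "\<exists>xs. set xs \<subseteq> {1..<n} - J \<and> p = apply_adj_transps xs"
  using assms
  \<comment> \<open>Exchanging the values at a descent moves the larger value to the larger position, which
    decreases this weighted sum.\<close>
proof (induction "\<Sum>i\<in>{1..n}. i * (n - p i)" arbitrary: p rule: less_induct)
  case less
  note p = less.prems(1) and cuts = less.prems(2)
  show ?case
  proof (cases "\<exists>j. 1 \<le> j \<and> j < n \<and> p (Suc j) < p j")
    case False
    then have "p = id" by (intro permutes_id_if_no_descent[OF p]) force
    then have "set [] \<subseteq> {1..<n} - J \<and> p = apply_adj_transps []" by simp
    then show ?thesis by blast
  next
    case True
    then obtain j where j: "1 \<le> j" "j < n" "p (Suc j) < p j" by blast
    define t where "t = Transposition.transpose j (Suc j)"
    define q where "q = p \<circ> t"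
    have t: "t permutes {1..n}" unfolding t_def using j by (intro permutes_swap_id) auto
    have q: "q permutes {1..n}" unfolding q_def by (rule permutes_compose[OF t p])
    have jJ: "j \<notin> J"
    proof
      assume jJ: "j \<in> J"
      have fin: "card (p ` {1..j}) = card {1..j}"
        by (rule card_image[OF inj_on_subset[OF permutes_inj_on[OF p]]]) auto
      have "p ` {1..j} = {1..j}"
        by (rule card_subset_eq[OF _ cuts[OF jJ] fin]) simp
      moreover have "p j \<in> p ` {1..j}" using j(1) by (intro imageI) simp
      moreover have "1 \<le> p (Suc j)" using permutes_in_image[OF p, of "Suc j"] j by simp
      ultimately have "p (Suc j) \<in> p ` {1..j}" using j by auto
      then show False using inj_image_mem_iff[OF permutes_inj[OF p]] by simp
    qed
    have qcuts: "q ` {1..m} \<subseteq> {1..m}" if "m \<in> J" for m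
    proof -
      have "m \<noteq> j" using jJ that by auto
      then have "t ` {1..m} \<subseteq> {1..m}"
        using j by (auto simp: t_def Transposition.transpose_def)
      then show ?thesis using cuts[OF that] unfolding q_def image_comp[symmetric] by blast
    qed
    define S where "S = {1..n} - {j, Suc j}"
    have S: "{1..n} = insert j (insert (Suc j) S)" "finite S" "j \<notin> S" "Suc j \<notin> S"
      using j by (auto simp: S_def)
    have rest: "(\<Sum>i\<in>S. i * (n - q i)) = (\<Sum>i\<in>S. i * (n - p i))"
      by (rule sum.cong) (auto simp: S_def q_def t_def Transposition.transpose_def)
    have pj: "p j \<le> n" "p (Suc j) \<le> n" using permutes_in_image[OF p, of j] permutes_in_image[OF p, of "Suc j"] j by simp_all
    define a b where "a = n - p j" and "b = n - p (Suc j)"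
    have ab: "a < b" using j(3) pj by (simp add: a_def b_def)
    have qj: "n - q j = b" "n - q (Suc j) = a" by (simp_all add: q_def t_def a_def b_def)
    have sum_split: "(\<Sum>i\<in>{1..n}. i * f i) = j * f j + (Suc j * f (Suc j) + (\<Sum>i\<in>S. i * f i))"
      for f :: "nat \<Rightarrow> nat"
      using S(2-4) by (simp only: S(1)) (simp add: sum.insert_if)
    have "(\<Sum>i\<in>{1..n}. i * (n - q i)) < (\<Sum>i\<in>{1..n}. i * (n - p i))"
      unfolding sum_split[of "\<lambda>i. n - q i"] sum_split[of "\<lambda>i. n - p i"] rest qj
      using ab by (simp add: a_def[symmetric] b_def[symmetric])
    then have "\<exists>xs. set xs \<subseteq> {1..<n} - J \<and> q = apply_adj_transps xs"
      by (rule less.hyps[of q]) (fact q, fact qcuts)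
    then obtain xs where xs: "set xs \<subseteq> {1..<n} - J" "q = apply_adj_transps xs"
      by (elim exE conjE)
    have tt: "t \<circ> t = id" unfolding t_def by simp
    have "p = q \<circ> t" unfolding q_def comp_assoc tt by (rule comp_id[symmetric])
    also have "\<dots> = apply_adj_transps (xs @ [j])" unfolding xs(2) t_def by simp
    finally have "p = apply_adj_transps (xs @ [j])" .
    moreover have "set (xs @ [j]) \<subseteq> {1..<n} - J" using xs j jJ by auto
    ultimately show ?thesis by (intro exI[of _ "xs @ [j]"] conjI)
  qed
qed

lemma permutes_of_list:
  fixes n :: nat
  assumes "distinct xs" "set xs = {1..n}"
  obtains p where "p permutes {1..n}" "\<And>i. i < n \<Longrightarrow> p (Suc i) = xs ! i"
proof -
  have len: "length xs = n" using assms distinct_card[of xs] by simp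
  define p where "p = (\<lambda>i. if i \<in> {1..n} then xs ! (i - 1) else i)"
  have "bij_betw p {1..n} {1..n}"
  proof -
    have "bij_betw (\<lambda>i. i - 1) {1..n} {..<n}"
      by (intro bij_betw_byWitness[where f' = Suc]) auto
    moreover have "bij_betw ((!) xs) {..<n} {1..n}"
      by (rule bij_betw_nth[OF assms(1)]) (simp_all add: len assms(2))
    ultimately have "bij_betw ((!) xs \<circ> (\<lambda>i. i - 1)) {1..n} {1..n}" by (rule bij_betw_trans)
    moreover have "bij_betw p {1..n} {1..n} \<longleftrightarrow> bij_betw ((!) xs \<circ> (\<lambda>i. i - 1)) {1..n} {1..n}"
      by (rule bij_betw_cong) (simp add: p_def)
    ultimately show ?thesis by blast
  qed
  then have "p permutes {1..n}" by (rule bij_imp_permutes) (auto simp: p_def)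
  then show ?thesis by (rule that[of p]) (simp add: p_def)
qed

section \<open>Generators of the kernel of a lift of the adjacent transpositions\<close>

text \<open>The possible pairs of the set \<open>A\<close> of labels to the left of a hexagon and the set \<open>T\<close> of the three
  labels that it permutes, restricted to the hexagons whose largest label exceeds all of \<open>A\<close>.
  These are the basic hexagons: they will generate the abelianized kernel freely.\<close>

definition hex_labels :: "nat \<Rightarrow> (nat set \<times> nat set) set" where
  "hex_labels n = {(A, T). A \<subseteq> {1..n} \<and> T \<subseteq> {1..n} \<and> A \<inter> T = {} \<and> card T = 3 \<and> (\<forall>a\<in>A. a < Max T)}"

text \<open>A group generated by involutions \<open>s i\<close> over the adjacent transpositions, which commute at distance at
  least two. An
  element \<open>g\<close> is read as a way to rearrange labels, with \<open>perm g j\<close> the label that ends up at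
  position \<open>j\<close>; right multiplication by \<open>s i\<close> exchanges the labels at the positions \<open>i\<close> and \<open>i + 1\<close>.\<close>

locale adjacent_lift = group G for G (structure) +
  fixes n :: nat and s :: "nat \<Rightarrow> 'a" and perm :: "'a \<Rightarrow> nat \<Rightarrow> nat"
  assumes s_closed: "i \<in> {1..<n} \<Longrightarrow> s i \<in> carrier G"
    and s_square: "i \<in> {1..<n} \<Longrightarrow> s i \<otimes> s i = \<one>"
    and s_commute: "i \<in> {1..<n} \<Longrightarrow> j \<in> {1..<n} \<Longrightarrow> i + 2 \<le> j \<Longrightarrow> s i \<otimes> s j = s j \<otimes> s i"
    and perm_hom: "perm \<in> hom G (sym_group n)"
    and perm_s: "i \<in> {1..<n} \<Longrightarrow> perm (s i) = Transposition.transpose i (Suc i)"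
    and s_generate: "g \<in> carrier G \<Longrightarrow>
      \<exists>xs. set xs \<subseteq> {1..<n} \<and> g = foldr (\<lambda>i y. s i \<otimes> y) xs \<one>"
begin

definition sword :: "nat list \<Rightarrow> 'a" where
  "sword xs = foldr (\<lambda>i y. s i \<otimes> y) xs \<one>"

lemma sword_Nil [simp]: "sword [] = \<one>"
  and sword_Cons: "sword (i # xs) = s i \<otimes> sword xs"
  by (simp_all add: sword_def)

lemma sword_closed [simp, intro]: "set xs \<subseteq> {1..<n} \<Longrightarrow> sword xs \<in> carrier G"
  by (induction xs) (simp_all add: sword_Cons s_closed)

lemma sword_append:
  "set xs \<subseteq> {1..<n} \<Longrightarrow> set ys \<subseteq> {1..<n} \<Longrightarrow> sword (xs @ ys) = sword xs \<otimes> sword ys"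
  by (induction xs) (simp_all add: sword_Cons s_closed m_assoc)

lemma sword_single: "i \<in> {1..<n} \<Longrightarrow> sword [i] = s i"
  by (simp add: sword_Cons s_closed)

lemma sword_surj: "g \<in> carrier G \<Longrightarrow> \<exists>xs. set xs \<subseteq> {1..<n} \<and> g = sword xs"
  using s_generate by (simp add: sword_def)

lemma sword_cancel:
  assumes "set xs \<subseteq> {1..<n}" "i \<in> {1..<n}" "set ys \<subseteq> {1..<n}"
  shows "sword (xs @ i # i # ys) = sword (xs @ ys)"
proof -
  have "sword (i # i # ys) = sword ys"
    using assms by (simp add: sword_Cons s_closed m_assoc[symmetric] s_square)
  then show ?thesis using assms by (simp add: sword_append)
qed

lemma s_commute_far:
  assumes "i \<in> {1..<n}" "j \<in> {1..<n}" "i + 2 \<le> j \<or> j + 2 \<le> i"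
  shows "s i \<otimes> s j = s j \<otimes> s i"
  using assms s_commute by metis

lemma sword_commute:
  assumes "i \<in> {1..<n}" "set xs \<subseteq> {1..<n}" "\<And>j. j \<in> set xs \<Longrightarrow> i + 2 \<le> j \<or> j + 2 \<le> i"
  shows "s i \<otimes> sword xs = sword xs \<otimes> s i"
  using assms(2,3)
proof (induction xs)
  case Nil
  then show ?case using assms(1) by (simp add: s_closed)
next
  case (Cons j xs)
  have j: "j \<in> {1..<n}" and xs: "set xs \<subseteq> {1..<n}" using Cons.prems by auto
  have "s i \<otimes> sword (j # xs) = (s i \<otimes> s j) \<otimes> sword xs"
    using j xs assms(1) by (simp add: sword_Cons s_closed m_assoc)
  also have "\<dots> = s j \<otimes> (s i \<otimes> sword xs)"
    using j xs assms(1) s_commute_far[of i j] Cons.prems by (simp add: s_closed m_assoc)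
  also have "\<dots> = sword (j # xs) \<otimes> s i"
    using j xs assms(1) Cons by (simp add: sword_Cons s_closed m_assoc)
  finally show ?case .
qed

lemma perm_permutes: "g \<in> carrier G \<Longrightarrow> perm g permutes {1..n}"
  using hom_in_carrier[OF perm_hom, of g] by (simp add: sym_group_carrier)

lemma perm_mult: "g \<in> carrier G \<Longrightarrow> h \<in> carrier G \<Longrightarrow> perm (g \<otimes> h) = perm g \<circ> perm h"
  using hom_mult[OF perm_hom] by (simp add: sym_group_mult)

sublocale perm: group_hom G "sym_group n" perm
  using perm_hom sym_group_is_group is_group by (simp add: group_hom_def group_hom_axioms_def)

lemma perm_one: "perm \<one> = id"
  using perm.hom_one by (simp add: sym_group_one)

lemma perm_sword: "set xs \<subseteq> {1..<n} \<Longrightarrow> perm (sword xs) = apply_adj_transps xs"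
  by (induction xs) (simp_all add: sword_Cons s_closed perm_one perm_mult perm_s sym_group_mult sym_group_one)

abbreviation "pure \<equiv> kernel G (sym_group n) perm"

lemma pure_iff: "g \<in> pure \<longleftrightarrow> g \<in> carrier G \<and> perm g = id"
  by (simp add: kernel_def sym_group_one)

lemma subgroup_pure: "subgroup pure G"
  by (rule perm.subgroup_kernel)

lemma perm_surj:
  assumes "p permutes {1..n}" shows "\<exists>g\<in>carrier G. perm g = p"
proof -
  obtain xs where xs: "set xs \<subseteq> {1..<n} - {}" "p = apply_adj_transps xs"
    using apply_adj_transps_avoiding_cuts[OF assms, of "{}"] by auto
  then show ?thesis using perm_sword[of xs] sword_closed[of xs] by auto
qed

lemma perm_inv_comp: "g \<in> carrier G \<Longrightarrow> perm g \<circ> perm (inv g) = id"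
  using perm_mult[of g "inv g"] perm_one by simp

text \<open>Hexagons measure the failure of the braid relation: starting from the
  arrangement \<open>perm g\<close>, the labels at the positions \<open>i\<close>, \<open>i + 1\<close>, \<open>i + 2\<close> run once through
  all their six orders, along the boundary of a hexagonal face of the permutohedron.\<close>

definition hexagon :: "'a \<Rightarrow> nat \<Rightarrow> 'a" where
  "hexagon g i = g \<otimes> sword [Suc i, i, Suc i, i, Suc i, i] \<otimes> inv g"

lemma hexagon_word_closed:
  assumes "1 \<le> i" "i + 2 \<le> n"
  shows "sword [Suc i, i, Suc i, i, Suc i, i] \<in> pure"
proof -
  have "set [Suc i, i, Suc i, i, Suc i, i] \<subseteq> {1..<n}" using assms by auto
  moreover have "apply_adj_transps [Suc i, i, Suc i, i, Suc i, i] = id"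
    by (simp add: fun_eq_iff Transposition.transpose_def)
  ultimately show ?thesis unfolding pure_iff using perm_sword by simp
qed

lemma normal_pure: "pure \<lhd> G"
  by (rule perm.normal_kernel)

lemma hexagon_pure:
  assumes "1 \<le> i" "i + 2 \<le> n" "g \<in> carrier G"
  shows "hexagon g i \<in> pure"
  unfolding hexagon_def using normal.inv_op_closed2[OF normal_pure assms(3) hexagon_word_closed[OF assms(1,2)]] .

text \<open>A generator at distance from the three positions commutes with the hexagon word; one
  inside the hexagon shifts its starting vertex by one edge, which reverses the word.\<close>

lemma hexagon_mult_s:
  assumes i: "1 \<le> i" "i + 2 \<le> n" and g: "g \<in> carrier G"
    and j: "j \<in> {1..<n}" "j \<noteq> i - 1" "j \<noteq> i + 2"
  shows "hexagon (g \<otimes> s j) i \<in> {hexagon g i, inv (hexagon g i)}"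
proof -
  let ?w = "[Suc i, i, Suc i, i, Suc i, i]"
  have w: "set ?w \<subseteq> {1..<n}" and w': "set (rev ?w) \<subseteq> {1..<n}" using i by auto
  have sj: "s j \<in> carrier G" using j s_closed by blast
  have inv_sj: "inv (s j) = s j" using s_square[OF j(1)] sj by (simp add: inv_equality)
  have step: "hexagon (g \<otimes> s j) i = g \<otimes> (s j \<otimes> sword ?w \<otimes> s j) \<otimes> inv g"
    unfolding hexagon_def using g sj sword_closed[OF w] by (simp add: inv_mult_group inv_sj m_assoc)
  have inv_w: "inv (sword ?w) = sword (rev ?w)"
  proof (rule inv_equality)
    have "sword (rev ?w) \<otimes> sword ?w = sword (rev ?w @ ?w)" using sword_append[OF w' w] by simp
    also have "\<dots> = \<one>"
      using sword_cancel[of "[i, Suc i, i, Suc i, i]" "Suc i" "[i, Suc i, i, Suc i, i]"]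
        sword_cancel[of "[i, Suc i, i, Suc i]" i "[Suc i, i, Suc i, i]"]
        sword_cancel[of "[i, Suc i, i]" "Suc i" "[i, Suc i, i]"]
        sword_cancel[of "[i, Suc i]" i "[Suc i, i]"]
        sword_cancel[of "[i]" "Suc i" "[i]"]
        sword_cancel[of "[]" i "[]"] i by simp
    finally show "sword (rev ?w) \<otimes> sword ?w = \<one>" .
  qed (use w w' in auto)
  have inv_hex: "inv (hexagon g i) = g \<otimes> sword (rev ?w) \<otimes> inv g"
    unfolding hexagon_def inv_w[symmetric] using g sword_closed[OF w]
    by (simp add: inv_mult_group m_assoc)
  consider "i + 3 \<le> j \<or> j + 2 \<le> i" | "j = i" | "j = Suc i" using j by linarith
  then show ?thesis
  proof cases
    case 1
    have "s j \<otimes> sword ?w = sword ?w \<otimes> s j"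
      by (rule sword_commute[OF j(1) w]) (use 1 in auto)
    then have "s j \<otimes> sword ?w \<otimes> s j = sword ?w \<otimes> (s j \<otimes> s j)"
      using sj sword_closed[OF w] by (simp add: m_assoc)
    then have "s j \<otimes> sword ?w \<otimes> s j = sword ?w"
      using s_square[OF j(1)] sword_closed[OF w] by simp
    then show ?thesis unfolding step by (simp add: hexagon_def)
  next
    case 2
    have "s j \<otimes> sword ?w \<otimes> s j = sword ([i] @ ?w @ [i])"
      using i w sword_append[of ?w "[i]"] j sword_closed[OF w] unfolding 2
      by (simp add: sword_Cons s_closed m_assoc)
    also have "\<dots> = sword (rev ?w)"
      using sword_cancel[of "[i, Suc i, i, Suc i, i, Suc i]" i "[]"] i by simp
    finally show ?thesis unfolding step inv_hex by simp
  next
    case 3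
    have "s j \<otimes> sword ?w \<otimes> s j = sword ([Suc i] @ ?w @ [Suc i])"
      using i w sword_append[of ?w "[Suc i]"] j sword_closed[OF w] unfolding 3
      by (simp add: sword_Cons s_closed m_assoc)
    also have "\<dots> = sword (rev ?w)"
      using sword_cancel[of "[]" "Suc i" "[i, Suc i, i, Suc i, i, Suc i]"] i by simp
    finally show ?thesis unfolding step inv_hex by simp
  qed
qed

context
  fixes K
  assumes K: "subgroup K G" and K_derived: "derived G pure \<subseteq> K" and K_pure: "K \<subseteq> pure"
begin

text \<open>Conjugating a hexagon by a pure element changes it by a commutator of pure elements.\<close>

lemma hexagon_pure_mult:
  assumes i: "1 \<le> i" "i + 2 \<le> n" and g: "g \<in> carrier G" and a: "a \<in> pure"
    and h: "hexagon g i \<in> K"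
  shows "hexagon (a \<otimes> g) i \<in> K"
proof -
  let ?h = "hexagon g i"
  have ac: "a \<in> carrier G" using a pure_iff by blast
  have hp: "?h \<in> pure" and hc: "?h \<in> carrier G" using hexagon_pure[OF i g] pure_iff by auto
  have w: "sword [Suc i, i, Suc i, i, Suc i, i] \<in> carrier G"
    using hexagon_word_closed[OF i] pure_iff by blast
  have "a \<otimes> ?h \<otimes> inv a \<otimes> inv ?h \<in> derived G pure"
    unfolding derived_def by (rule generate.incl) (use a hp in blast)
  then have "a \<otimes> ?h \<otimes> inv a \<otimes> inv ?h \<otimes> ?h \<in> K"
    using K_derived h subgroup.m_closed[OF K] by blast
  moreover have "a \<otimes> ?h \<otimes> inv a \<otimes> inv ?h \<otimes> ?h = a \<otimes> ?h \<otimes> inv a"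
    using ac hc by (simp add: m_assoc)
  moreover have "hexagon (a \<otimes> g) i = a \<otimes> ?h \<otimes> inv a"
    unfolding hexagon_def using ac g w by (simp add: inv_mult_group m_assoc)
  ultimately show ?thesis by simp
qed

lemma hexagon_mult_sword:
  assumes i: "1 \<le> i" "i + 2 \<le> n" and g: "g \<in> carrier G"
    and h: "hexagon g i \<in> K" and xs: "set xs \<subseteq> {1..<n} - {i - 1, i + 2}"
  shows "hexagon (g \<otimes> sword xs) i \<in> K"
  using xs
proof (induction xs rule: rev_induct)
  case Nil
  then show ?case using h g by simp
next
  case (snoc j xs)
  have xs: "set xs \<subseteq> {1..<n}" and j: "j \<in> {1..<n}" "j \<noteq> i - 1" "j \<noteq> i + 2" using snoc.prems by auto
  have "g \<otimes> sword (xs @ [j]) = (g \<otimes> sword xs) \<otimes> s j"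
    using xs j g by (simp add: sword_append sword_Cons s_closed m_assoc)
  moreover have "hexagon ((g \<otimes> sword xs) \<otimes> s j) i \<in> {hexagon (g \<otimes> sword xs) i, inv (hexagon (g \<otimes> sword xs) i)}"
    by (rule hexagon_mult_s[OF i _ j]) (use g xs in auto)
  moreover have "hexagon (g \<otimes> sword xs) i \<in> K" using snoc by auto
  ultimately show ?case using subgroup.m_inv_closed[OF K] by auto
qed

text \<open>Modulo commutators of pure elements, a hexagon only remembers which labels lie to the left of
  it and which three labels it permutes: rearranging the labels inside these blocks
  multiplies the base point by generators that commute with the hexagon or reverse it.\<close>

lemma hexagon_same_labels:
  assumes i: "1 \<le> i" "i + 2 \<le> n" and g: "g \<in> carrier G" "g' \<in> carrier G"
    and h: "hexagon g i \<in> K"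
    and left: "perm g' ` {1..<i} = perm g ` {1..<i}"
    and mid: "perm g' ` {i..i + 2} = perm g ` {i..i + 2}"
  shows "hexagon g' i \<in> K"
proof -
  \<comment> \<open>The permutation \<open>r\<close> preserves the three blocks of positions, so it factors into transpositions
    that cross neither of the two block boundaries.\<close>
  define r where "r = Hilbert_Choice.inv (perm g) \<circ> perm g'"
  have pg: "perm g permutes {1..n}" "perm g' permutes {1..n}" using g perm_permutes by auto
  have r: "r permutes {1..n}" unfolding r_def by (rule permutes_compose[OF pg(2) permutes_inv[OF pg(1)]])
  have r_image: "r ` M = M" if "perm g' ` M = perm g ` M" for M
    unfolding r_def image_comp[symmetric] that
    using permutes_inj[OF pg(1)] by (simp add: image_comp)
  have 1: "{1..i - 1} = {1..<i}" and 2: "{1..i + 2} = {1..<i} \<union> {i..i + 2}" using i by auto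
  have "r ` {1..m} \<subseteq> {1..m}" if "m \<in> {i - 1, i + 2}" for m
  proof -
    have "r ` {1..<i} = {1..<i}" "r ` {i..i + 2} = {i..i + 2}" by (rule r_image; fact)+
    then show ?thesis using that unfolding insert_iff empty_iff
      by (elim disjE) (simp_all only: 1 2 image_Un order_refl)
  qed
  from apply_adj_transps_avoiding_cuts[OF r this]
  obtain xs where xs: "set xs \<subseteq> {1..<n} - {i - 1, i + 2}" "r = apply_adj_transps xs" by metis
  have xs': "set xs \<subseteq> {1..<n}" using xs by auto
  have u: "g \<otimes> sword xs \<in> carrier G" using g xs' by simp
  have "perm (g \<otimes> sword xs) = perm g \<circ> r"
    unfolding perm_mult[OF g(1) sword_closed[OF xs']] perm_sword[OF xs'] xs(2) ..
  also have "\<dots> = perm g'"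
    unfolding r_def comp_assoc[symmetric] permutes_inv_o(1)[OF pg(1)] by simp
  finally have "perm (g \<otimes> sword xs) = perm g'" .
  then have "perm (g' \<otimes> inv (g \<otimes> sword xs)) = id"
    using perm_inv_comp[OF u] perm_mult[OF g(2) inv_closed[OF u]] by (simp only:)
  then have a: "g' \<otimes> inv (g \<otimes> sword xs) \<in> pure" using g u by (simp add: pure_iff)
  have "hexagon (g' \<otimes> inv (g \<otimes> sword xs) \<otimes> (g \<otimes> sword xs)) i \<in> K"
    by (rule hexagon_pure_mult[OF i u a hexagon_mult_sword[OF i g(1) h xs(1)]])
  then show ?thesis using u g by (simp add: m_assoc)
qed

context
  assumes hex_K: "\<And>g i. g \<in> carrier G \<Longrightarrow> 1 \<le> i \<Longrightarrow> i + 2 \<le> n \<Longrightarrow>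
    (\<And>a. a \<in> {1..<i + 2} \<Longrightarrow> perm g a < perm g (i + 2)) \<Longrightarrow> hexagon g i \<in> K"
begin

text \<open>The elements \<open>\<kappa> \<sigma>\<close> with \<open>\<kappa> \<in> K\<close> and \<open>\<sigma>\<close> a normal form for a permutation of
  \<open>{1..k}\<close>: first a normal form for \<open>{1..k - 1}\<close>, then the label \<open>k\<close> is moved to the left.\<close>

primrec normal_forms :: "nat \<Rightarrow> 'a set" where
  "normal_forms 0 = K"
| "normal_forms (Suc k) = {x \<otimes> sword (rev [j..<Suc k]) | x j. x \<in> normal_forms k \<and> 1 \<le> j \<and> j \<le> Suc k}"

declare normal_forms.simps(2) [simp del]

lemma normal_forms_SucI:
  "y \<in> normal_forms k \<Longrightarrow> 1 \<le> j \<Longrightarrow> j \<le> Suc k \<Longrightarrow> y \<otimes> sword (rev [j..<Suc k]) \<in> normal_forms (Suc k)"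
  unfolding normal_forms.simps(2) by blast

lemma normal_forms_SucE:
  assumes "x \<in> normal_forms (Suc k)"
  obtains y j where "x = y \<otimes> sword (rev [j..<Suc k])" "y \<in> normal_forms k" "1 \<le> j" "j \<le> Suc k"
  using assms unfolding normal_forms.simps(2) by blast

lemma rev_upt_closed: "1 \<le> j \<Longrightarrow> Suc k \<le> n \<Longrightarrow> sword (rev [j..<Suc k]) \<in> carrier G"
  by (rule sword_closed) auto

lemma normal_forms_carrier: "k \<le> n \<Longrightarrow> x \<in> normal_forms k \<Longrightarrow> x \<in> carrier G"
proof (induction k arbitrary: x)
  case 0
  then show ?case using subgroup.subset[OF K] by auto
next
  case (Suc k)
  show ?case
    by (rule normal_forms_SucE[OF Suc.prems(2)])
      (use Suc.IH Suc.prems(1) rev_upt_closed in \<open>simp del: upt_Suc\<close>)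
qed

lemma perm_rev_upt:
  assumes "1 \<le> j" "j \<le> Suc k" "Suc k \<le> n"
  shows "perm (sword (rev [j..<Suc k])) permutes {1..Suc k}"
    and "perm (sword (rev [j..<Suc k])) j = Suc k"
    and "\<And>a. a < j \<Longrightarrow> perm (sword (rev [j..<Suc k])) a = a"
proof -
  have j: "set (rev [j..<Suc k]) \<subseteq> {1..<n}" using assms by auto
  show "perm (sword (rev [j..<Suc k])) permutes {1..Suc k}"
    unfolding perm_sword[OF j] by (rule permutes_apply_adj_transps) (use assms in auto)
  have "apply_adj_transps (rev [j..<m]) j = m \<and> (\<forall>a<j. apply_adj_transps (rev [j..<m]) a = a)" if "j \<le> m" for m
    using that
  proof (induction m rule: dec_induct)
    case (step m)
    then show ?case by (auto simp: Transposition.transpose_def)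
  qed simp
  from this[OF assms(2)]
  show "perm (sword (rev [j..<Suc k])) j = Suc k"
    and "\<And>a. a < j \<Longrightarrow> perm (sword (rev [j..<Suc k])) a = a"
    unfolding perm_sword[OF j] by auto
qed

lemma perm_normal_forms: "k \<le> n \<Longrightarrow> x \<in> normal_forms k \<Longrightarrow> perm x permutes {1..k}"
proof (induction k arbitrary: x)
  case 0
  then have "perm x = id" using K_pure pure_iff by auto
  then show ?case by (simp only: permutes_id)
next
  case (Suc k)
  obtain y j where y: "x = y \<otimes> sword (rev [j..<Suc k])" "y \<in> normal_forms k" "1 \<le> j" "j \<le> Suc k"
    using Suc.prems(2) by (rule normal_forms_SucE)
  have yc: "y \<in> carrier G" using normal_forms_carrier[OF _ y(2)] Suc.prems(1) by simp
  have w: "sword (rev [j..<Suc k]) \<in> carrier G" using rev_upt_closed y(3) Suc.prems(1) by blast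
  have "perm x = perm y \<circ> perm (sword (rev [j..<Suc k]))" unfolding y(1) by (rule perm_mult[OF yc w])
  moreover have "perm y permutes {1..Suc k}"
    by (rule permutes_subset[OF Suc.IH]) (use y Suc.prems in auto)
  ultimately show ?case using permutes_compose[OF perm_rev_upt(1)[OF y(3,4) Suc.prems(1)]] by metis
qed

lemma normal_forms_K_mult: "k \<le> n \<Longrightarrow> a \<in> K \<Longrightarrow> x \<in> normal_forms k \<Longrightarrow> a \<otimes> x \<in> normal_forms k"
proof (induction k arbitrary: x)
  case 0
  then show ?case using subgroup.m_closed[OF K] by simp
next
  case (Suc k)
  obtain y j where y: "x = y \<otimes> sword (rev [j..<Suc k])" "y \<in> normal_forms k" "1 \<le> j" "j \<le> Suc k"
    using Suc.prems(3) by (rule normal_forms_SucE)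
  have yc: "y \<in> carrier G" using normal_forms_carrier[OF _ y(2)] Suc.prems(1) by simp
  have w: "sword (rev [j..<Suc k]) \<in> carrier G" using rev_upt_closed y(3) Suc.prems(1) by blast
  have "a \<in> carrier G" using Suc.prems(2) K subgroup.mem_carrier by metis
  then have "a \<otimes> x = (a \<otimes> y) \<otimes> sword (rev [j..<Suc k])"
    unfolding y(1) by (rule m_assoc[OF _ yc w, symmetric])
  moreover have "a \<otimes> y \<in> normal_forms k" using Suc.IH[OF _ Suc.prems(2) y(2)] Suc.prems(1) by simp
  ultimately show ?case using normal_forms_SucI[OF _ y(3,4)] by simp
qed

text \<open>Multiplying a normal form by a generator gives a normal form again, up to an
  element of \<open>K\<close>. Only one case is not immediate: when the generator \<open>s i\<close> meets the descending
  word \<open>k, \<dots>, j\<close> at an index \<open>i > j\<close>, the braid move \<open>s i s (i-1) s i \<rightarrow> s (i-1) s i s (i-1)\<close> is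
  needed, and the hexagon it costs has the label \<open>k + 1\<close> in its last position, with only smaller
  labels before it.\<close>

lemma normal_forms_mult_s:
  "k \<le> n \<Longrightarrow> x \<in> normal_forms k \<Longrightarrow> i \<in> {1..<k} \<Longrightarrow> x \<otimes> s i \<in> normal_forms k"
proof (induction k arbitrary: x i)
  case 0
  then show ?case by simp
next
  case (Suc k)
  obtain y j where y: "x = y \<otimes> sword (rev [j..<Suc k])" "y \<in> normal_forms k" "1 \<le> j" "j \<le> Suc k"
    using Suc.prems(2) by (rule normal_forms_SucE)
  have yc: "y \<in> carrier G" using normal_forms_carrier[OF _ y(2)] Suc.prems(1) by simp
  have i: "i \<in> {1..<n}" "i \<le> k" using Suc.prems by auto
  have si: "s i \<in> carrier G" using s_closed[OF i(1)] .
  have in_range: "set (rev [a..<Suc k]) \<subseteq> {1..<n}" if "1 \<le> a" for a using that Suc.prems by auto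
  have k: "Suc k \<le> n" "k \<le> n" using Suc.prems by auto
  have split: "sword (rev [a..<Suc k]) = sword (rev [b..<Suc k]) \<otimes> sword (rev [a..<b])"
    if "1 \<le> a" "a \<le> b" "b \<le> Suc k" for a b
  proof -
    have "[a..<Suc k] = [a..<b] @ [b..<Suc k]"
      using upt_add_eq_append[of a b "Suc k - b"] that by simp
    moreover have "set (rev [a..<b]) \<subseteq> {1..<n}" using that k by auto
    ultimately show ?thesis
      using sword_append[OF in_range[of b]] that by simp
  qed
  have down: "sword (rev [a..<Suc a]) = s a" if "a \<in> {1..<n}" for a
    using that by (simp add: sword_Cons s_closed)
  consider "i = j" | "Suc i = j" | "Suc i < j" | "j < i" by linarith
  then show ?case
  proof cases
    case 1
    have "sword (rev [j..<Suc k]) = sword (rev [Suc j..<Suc k]) \<otimes> s j"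
      using split[of j "Suc j"] down[of j] 1 i y by simp
    then have "x \<otimes> s i = y \<otimes> sword (rev [Suc j..<Suc k]) \<otimes> (s i \<otimes> s i)"
      using y(1) 1 yc si in_range[of "Suc j"] by (simp add: m_assoc)
    then have "x \<otimes> s i = y \<otimes> sword (rev [Suc j..<Suc k])"
      using s_square[OF i(1)] yc in_range[of "Suc j"] by simp
    then show ?thesis using normal_forms_SucI[OF y(2), of "Suc j"] 1 i by simp
  next
    case 2
    have "sword (rev [i..<Suc k]) = sword (rev [j..<Suc k]) \<otimes> s i"
      using split[of i j] down[of i] 2 i y by auto
    then have "x \<otimes> s i = y \<otimes> sword (rev [i..<Suc k])"
      using y(1) yc si in_range[of j] y(3) by (simp add: m_assoc)
    then show ?thesis using normal_forms_SucI[OF y(2), of i] i by simp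
  next
    case 3
    have "s i \<otimes> sword (rev [j..<Suc k]) = sword (rev [j..<Suc k]) \<otimes> s i"
      by (rule sword_commute[OF i(1) in_range[OF y(3)]]) (use 3 in auto)
    then have "x \<otimes> s i = (y \<otimes> s i) \<otimes> sword (rev [j..<Suc k])"
      using y(1) yc si in_range[OF y(3)] by (simp add: m_assoc)
    moreover have "y \<otimes> s i \<in> normal_forms k"
      by (rule Suc.IH[OF k(2) y(2)]) (use 3 y i in auto)
    ultimately show ?thesis using normal_forms_SucI[OF _ y(3,4)] by simp
  next
    case 4
    \<comment> \<open>The descending word splits as \<open>U\<close>, \<open>s i\<close>, \<open>s m\<close>, \<open>V\<close>; the new \<open>s i\<close> passes \<open>V\<close>, the braid
      move turns it into an \<open>s m\<close> on the other side, and this passes \<open>U\<close> and is absorbed by \<open>y\<close>.\<close>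
    define m where "m = i - 1"
    have m: "i = Suc m" "1 \<le> m" "m + 2 \<le> n" "m \<in> {1..<n}" "j \<le> m" using 4 y(3) i by (auto simp: m_def)
    define U where "U = sword (rev [Suc i..<Suc k])"
    define V where "V = sword (rev [j..<m])"
    have Vr: "set (rev [j..<m]) \<subseteq> {1..<n}" using y(3) m by auto
    have Uc: "U \<in> carrier G" and Vc: "V \<in> carrier G" unfolding U_def V_def
      using in_range[of "Suc i"] Vr by auto
    have sm: "s m \<in> carrier G" using s_closed[OF m(4)] .
    have c1: "s i \<otimes> V = V \<otimes> s i"
      unfolding V_def by (rule sword_commute[OF i(1) Vr]) (use m in auto)
    have c2: "s m \<otimes> U = U \<otimes> s m"
      unfolding U_def by (rule sword_commute[OF m(4) in_range]) (use m in auto)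
    have "rev [j..<Suc i] = [i, m] @ rev [j..<m]" using m by simp
    then have "sword (rev [j..<Suc i]) = s i \<otimes> (s m \<otimes> V)" by (simp add: sword_Cons V_def)
    then have whole: "sword (rev [j..<Suc k]) = U \<otimes> (s i \<otimes> (s m \<otimes> V))"
      using split[of j "Suc i"] y(3) 4 i by (simp add: U_def)
    have yU: "y \<otimes> U \<in> carrier G" using yc Uc by simp
    have hexK: "hexagon (y \<otimes> U) m \<in> K"
    proof (rule hex_K[OF yU m(2,3)])
      fix a assume a: "a \<in> {1..<m + 2}"
      have p: "perm (y \<otimes> U) = perm y \<circ> perm U" using perm_mult[OF yc Uc] .
      have "perm U a = a" "perm U (Suc i) = Suc k"
        unfolding U_def using perm_rev_upt(3)[of "Suc i" k a] perm_rev_upt(2)[of "Suc i" k] i k a m by simp_all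
      moreover have "perm y permutes {1..k}" using perm_normal_forms[OF k(2) y(2)] .
      then have "perm y a \<in> {1..k}" "perm y (Suc k) = Suc k"
        using permutes_in_image[of "perm y" "{1..k}" a] permutes_not_in[of "perm y" "{1..k}" "Suc k"] a m i by auto
      ultimately show "perm (y \<otimes> U) a < perm (y \<otimes> U) (m + 2)" using p m by simp
    qed
    let ?w = "[Suc m, m, Suc m, m, Suc m, m]"
    have w: "set ?w \<subseteq> {1..<n}" using m by auto
    have braid: "s i \<otimes> (s m \<otimes> s i) = sword ?w \<otimes> (s m \<otimes> (s i \<otimes> s m))"
    proof -
      have "sword ?w \<otimes> (s m \<otimes> (s i \<otimes> s m)) = sword (?w @ [m, Suc m, m])"
        using sword_append[OF w, of "[m, Suc m, m]"] m i by (simp add: sword_Cons s_closed)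
      also have "\<dots> = sword [Suc m, m, Suc m]"
        using sword_cancel[of "[Suc m, m, Suc m, m, Suc m]" m "[Suc m, m]"]
          sword_cancel[of "[Suc m, m, Suc m, m]" "Suc m" "[m]"]
          sword_cancel[of "[Suc m, m, Suc m]" m "[]"] m i by simp
      finally show ?thesis using m i by (simp add: sword_Cons s_closed)
    qed
    have cancel: "inv a \<otimes> (a \<otimes> b) = b" if "a \<in> carrier G" "b \<in> carrier G" for a b
      using that by (simp add: m_assoc[symmetric])
    have "x \<otimes> s i = y \<otimes> U \<otimes> (s i \<otimes> (s m \<otimes> (V \<otimes> s i)))"
      unfolding y(1) whole using yc Uc Vc si sm by (simp add: m_assoc)
    also have "\<dots> = y \<otimes> U \<otimes> ((s i \<otimes> (s m \<otimes> s i)) \<otimes> V)"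
      unfolding c1[symmetric] using yc Uc Vc si sm by (simp add: m_assoc)
    also have "\<dots> = hexagon (y \<otimes> U) m \<otimes> (y \<otimes> (U \<otimes> s m) \<otimes> (s i \<otimes> (s m \<otimes> V)))"
      unfolding braid hexagon_def using yc Uc Vc si sm sword_closed[OF w]
      by (simp add: m_assoc inv_mult_group cancel)
    also have "\<dots> = hexagon (y \<otimes> U) m \<otimes> ((y \<otimes> s m) \<otimes> sword (rev [j..<Suc k]))"
      unfolding c2[symmetric] whole using yc Uc Vc si sm by (simp add: m_assoc)
    finally have eq: "x \<otimes> s i = hexagon (y \<otimes> U) m \<otimes> ((y \<otimes> s m) \<otimes> sword (rev [j..<Suc k]))" .
    have "y \<otimes> s m \<in> normal_forms k"
      by (rule Suc.IH[OF k(2) y(2)]) (use m i in auto)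
    then have "(y \<otimes> s m) \<otimes> sword (rev [j..<Suc k]) \<in> normal_forms (Suc k)"
      using normal_forms_SucI[OF _ y(3,4)] by simp
    then show ?thesis unfolding eq using normal_forms_K_mult[OF k(1) hexK] by simp
  qed
qed

lemma normal_forms_n: "normal_forms n = carrier G"
proof
  show "normal_forms n \<subseteq> carrier G" using normal_forms_carrier[of n] by blast
  have one: "\<one> \<in> normal_forms k" if "k \<le> n" for k using that
  proof (induction k)
    case 0
    then show ?case using subgroup.one_closed[OF K] by simp
  next
    case (Suc k)
    then have "\<one> \<in> normal_forms k" by simp
    then have "\<one> \<otimes> sword (rev [Suc k..<Suc k]) \<in> normal_forms (Suc k)"
      by (rule normal_forms_SucI) auto
    then show ?case by simp
  qed
  have "sword xs \<in> normal_forms n" if "set xs \<subseteq> {1..<n}" for xs using that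
  proof (induction xs rule: rev_induct)
    case Nil
    then show ?case using one by simp
  next
    case (snoc i xs)
    then show ?case using normal_forms_mult_s[of n "sword xs" i]
      by (simp add: sword_append sword_single)
  qed
  then show "carrier G \<subseteq> normal_forms n" using sword_surj by blast
qed

text \<open>The last word in a normal form for \<open>{1..Suc k}\<close> puts the label \<open>Suc k\<close> at its position \<open>j\<close>, so the
  identity forces \<open>j = Suc k\<close> at every stage.\<close>

lemma normal_forms_pure: "k \<le> n \<Longrightarrow> x \<in> normal_forms k \<Longrightarrow> x \<in> pure \<Longrightarrow> x \<in> K"
proof (induction k arbitrary: x)
  case (Suc k)
  obtain y j where y: "x = y \<otimes> sword (rev [j..<Suc k])" "y \<in> normal_forms k" "1 \<le> j" "j \<le> Suc k"
    using Suc.prems(2) by (rule normal_forms_SucE)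
  have yc: "y \<in> carrier G" using normal_forms_carrier[OF _ y(2)] Suc.prems(1) by simp
  have w: "sword (rev [j..<Suc k]) \<in> carrier G" using rev_upt_closed y(3) Suc.prems(1) by blast
  have "perm y permutes {1..k}" using perm_normal_forms[of k] y Suc.prems by simp
  then have "perm y (Suc k) = Suc k" by (rule permutes_not_in) simp
  then have "perm x j = Suc k" unfolding y(1) perm_mult[OF yc w]
    using perm_rev_upt(2)[OF y(3,4) Suc.prems(1)] by simp
  then have "j = Suc k" using Suc.prems(3) by (simp add: pure_iff)
  then have "x = y" using y yc by simp
  then show ?case using Suc y by simp
qed simp

lemma pure_subset_if_large_hexagons: "pure \<subseteq> K"
  using normal_forms_pure[of n] normal_forms_n pure_iff by blast

end

text \<open>One hexagon for each pair of label sets is enough, because any two hexagons with the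
  same labels agree up to orientation modulo commutators of pure elements.\<close>

theorem pure_subset_if_hexagons:
  assumes "\<And>A T. (A, T) \<in> hex_labels n \<Longrightarrow>
    \<exists>g i. g \<in> carrier G \<and> 1 \<le> i \<and> i + 2 \<le> n \<and> perm g ` {1..<i} = A \<and> perm g ` {i..i + 2} = T
      \<and> hexagon g i \<in> K"
  shows "pure \<subseteq> K"
proof (rule pure_subset_if_large_hexagons)
  fix g i assume g: "g \<in> carrier G" and i: "1 \<le> i" "i + 2 \<le> n"
    and big: "\<And>a. a \<in> {1..<i + 2} \<Longrightarrow> perm g a < perm g (i + 2)"
  define A T where "A = perm g ` {1..<i}" and "T = perm g ` {i..i + 2}"
  have pg: "perm g permutes {1..n}" using perm_permutes[OF g] .
  have inj: "inj_on (perm g) X" for X by (rule inj_on_subset[OF permutes_inj[OF pg] subset_UNIV])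
  have sub: "perm g ` X \<subseteq> {1..n}" if "X \<subseteq> {1..n}" for X
    using permutes_image[OF pg] that by blast
  have "perm g (i + 2) \<in> T" unfolding T_def by (intro imageI) simp
  then have le: "perm g (i + 2) \<le> Max T" by (intro Max_ge) (simp_all add: T_def)
  have "\<forall>a\<in>A. a < Max T"
  proof
    fix a assume "a \<in> A"
    then obtain b where "b \<in> {1..<i}" "a = perm g b" unfolding A_def by (rule imageE)
    then show "a < Max T" using big[of b] le by simp
  qed
  moreover have "card T = 3" unfolding T_def using card_image[OF inj, of "{i..i + 2}"] by simp
  moreover have "A \<inter> T = perm g ` ({1..<i} \<inter> {i..i + 2})"
    unfolding A_def T_def by (rule image_Int[OF permutes_inj[OF pg], symmetric])
  then have "A \<inter> T = {}" by auto
  moreover have "A \<subseteq> {1..n}" unfolding A_def by (rule sub) (use i in auto)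
  moreover have "T \<subseteq> {1..n}" unfolding T_def by (rule sub) (use i in auto)
  ultimately have "(A, T) \<in> hex_labels n" by (simp add: hex_labels_def)
  from assms[OF this] obtain g' i' where g': "g' \<in> carrier G" "1 \<le> i'" "i' + 2 \<le> n"
    "perm g' ` {1..<i'} = A" "perm g' ` {i'..i' + 2} = T" "hexagon g' i' \<in> K" by blast
  have "inj_on (perm g') {1..<i'}"
    by (rule inj_on_subset[OF permutes_inj[OF perm_permutes[OF g'(1)]] subset_UNIV])
  then have "card A = i' - 1" unfolding g'(4)[symmetric] by (simp add: card_image)
  moreover have "card A = i - 1" unfolding A_def by (simp add: card_image[OF inj])
  ultimately have i': "i' = i" using i g'(2) by simp
  show "hexagon g i \<in> K"
  proof (rule hexagon_same_labels[OF i g'(1) g])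
    show "hexagon g' i \<in> K" using g'(6) unfolding i' .
    show "perm g ` {1..<i} = perm g' ` {1..<i}" using g'(4)[symmetric] unfolding i' A_def .
    show "perm g ` {i..i + 2} = perm g' ` {i..i + 2}" using g'(5)[symmetric] unfolding i' T_def .
  qed
qed

end

end

section \<open>The number of hexagon labels\<close>

lemma finite_hex_labels: "finite (hex_labels n)"
  by (rule finite_subset[of _ "Pow {1..n} \<times> Pow {1..n}"]) (auto simp: hex_labels_def)

lemma hex_labels_Suc:
  "hex_labels (Suc n) = hex_labels n \<union>
     (\<lambda>(U, A). (A, insert (Suc n) U)) ` (SIGMA U:{U. U \<subseteq> {1..n} \<and> card U = 2}. Pow ({1..n} - U))"
  (is "_ = _ \<union> ?f ` ?S")
proof (intro equalityI subsetI)
  fix p assume p: "p \<in> hex_labels (Suc n)"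
  obtain A T where pe: "p = (A, T)" by (cases p)
  have AT: "A \<subseteq> {1..Suc n}" "T \<subseteq> {1..Suc n}" "A \<inter> T = {}" "card T = 3" "\<forall>a\<in>A. a < Max T"
    using p by (auto simp: pe hex_labels_def)
  have finT: "finite T" using AT(4) by (simp add: card_ge_0_finite)
  have "Max T \<in> T" using finT AT(4) by (intro Max_in) auto
  then have "Max T \<le> Suc n" using AT(2) by auto
  then have nA: "Suc n \<notin> A" using AT(5) by force
  then have A: "A \<subseteq> {1..n}" using AT(1) by (auto simp: subset_iff le_Suc_eq)
  show "p \<in> hex_labels n \<union> ?f ` ?S"
  proof (cases "Suc n \<in> T")
    case True
    have "card (T - {Suc n}) = 2" using True AT(4) by simp
    moreover have "T - {Suc n} \<subseteq> {1..n}" using AT(2) by (auto simp: subset_iff le_Suc_eq)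
    ultimately have "(T - {Suc n}, A) \<in> ?S" using A AT(3) by auto
    moreover have "p = ?f (T - {Suc n}, A)" using True by (simp add: pe insert_absorb)
    ultimately show ?thesis by blast
  next
    case False
    then have "T \<subseteq> {1..n}" using AT(2) by (auto simp: subset_iff le_Suc_eq)
    then show ?thesis using A AT by (auto simp: pe hex_labels_def)
  qed
next
  fix p assume "p \<in> hex_labels n \<union> ?f ` ?S"
  then show "p \<in> hex_labels (Suc n)"
  proof
    assume "p \<in> hex_labels n"
    then show ?thesis by (auto simp: hex_labels_def)
  next
    assume "p \<in> ?f ` ?S"
    then obtain U A where p: "p = (A, insert (Suc n) U)" and U: "U \<subseteq> {1..n}" "card U = 2" "A \<subseteq> {1..n} - U"
      by auto
    have finU: "finite U" using U(1) by (rule finite_subset) simp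
    have nU: "Suc n \<notin> U" using U(1) by auto
    have "Suc n \<le> Max (insert (Suc n) U)" using finU by simp
    then have "\<forall>a\<in>A. a < Max (insert (Suc n) U)" using U(3) by force
    moreover have "card (insert (Suc n) U) = 3" using finU nU U(2) by simp
    ultimately show ?thesis using U by (auto simp: p hex_labels_def)
  qed
qed

text \<open>A pair that involves the new largest label must have it in \<open>T\<close>; then the other two
  labels of \<open>T\<close> are arbitrary, and so is the left set among the remaining \<open>n - 2\<close> labels.\<close>

lemma card_hex_labels_Suc:
  "card (hex_labels (Suc n)) = card (hex_labels n) + (n choose 2) * 2 ^ (n - 2)"
proof -
  let ?S = "SIGMA U:{U. U \<subseteq> {1..n} \<and> card U = 2}. Pow ({1..n} - U)"
  let ?f = "\<lambda>(U, A). (A, insert (Suc n) U)"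
  have finS: "finite {U. U \<subseteq> {1..n} \<and> card U = 2}" by (rule finite_subset[of _ "Pow {1..n}"]) auto
  have "card (Pow ({1..n} - U)) = 2 ^ (n - 2)" if "U \<subseteq> {1..n}" "card U = 2" for U
    using that by (simp add: card_Pow card_Diff_subset finite_subset)
  then have "card ?S = (\<Sum>U\<in>{U. U \<subseteq> {1..n} \<and> card U = 2}. 2 ^ (n - 2))"
    using finS by (subst card_SigmaI) auto
  then have card_S: "card ?S = (n choose 2) * 2 ^ (n - 2)"
    using n_subsets[of "{1..n}" 2] by simp
  have inj: "inj_on ?f ?S"
  proof (rule inj_onI)
    fix p q assume pq: "p \<in> ?S" "q \<in> ?S" "?f p = ?f q"
    obtain U A V B where e: "p = (U, A)" "q = (V, B)" by (cases p, cases q)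
    have "Suc n \<notin> U" "Suc n \<notin> V" using pq(1,2) e by auto
    then show "p = q" using pq(3) e by (simp add: insert_ident)
  qed
  have disj: "hex_labels n \<inter> ?f ` ?S = {}" by (auto simp: hex_labels_def)
  have "finite (?f ` ?S)" using hex_labels_Suc[of n] finite_hex_labels[of "Suc n"] by simp
  then have "card (hex_labels (Suc n)) = card (hex_labels n) + card (?f ` ?S)"
    unfolding hex_labels_Suc by (rule card_Un_disjoint[OF finite_hex_labels _ disj])
  then show ?thesis using card_image[OF inj] card_S by simp
qed

lemma card_hex_labels:
  assumes "n \<ge> 3"
  shows "int (card (hex_labels n)) = 2 ^ (n - 3) * ((int n)\<^sup>2 - 5 * int n + 8) - 1"
  using assms
proof (induction n rule: nat_induct_at_least)
  case base
  have "hex_labels 2 = {}"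
  proof (rule equals0I)
    fix p assume "p \<in> hex_labels 2"
    then obtain T where "T \<subseteq> {1..2::nat}" "card T = 3" unfolding hex_labels_def by blast
    then show False using card_mono[of "{1..2::nat}" T] by simp
  qed
  then have "card (hex_labels 3) = 1" using card_hex_labels_Suc[of 2] by (simp add: numeral_3_eq_3 numeral_2_eq_2)
  then show ?case by simp
next
  case (Suc n)
  obtain m where n: "n = m + 3" using Suc.hyps by (metis add.commute le_Suc_ex)
  have "even (n * (n - 1))" by (cases "even n") auto
  then have "2 * (n choose 2) = n * (n - 1)" unfolding choose_two by (rule dvd_mult_div_cancel)
  then have "int (2 * (n choose 2)) = int (n * (n - 1))" by (simp only:)
  then have "2 * int (n choose 2) = int n * (int n - 1)" by (simp add: n algebra_simps)
  then have "int ((n choose 2) * 2 ^ (n - 2)) = 2 ^ (n - 3) * (int n * (int n - 1))"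
    by (simp add: n power_Suc mult.commute mult.left_commute)
  then have "int (card (hex_labels (Suc n))) =
      2 ^ m * ((int n)\<^sup>2 - 5 * int n + 8) - 1 + 2 ^ m * (int n * (int n - 1))"
    unfolding card_hex_labels_Suc using Suc.IH by (simp add: n)
  also have "\<dots> = 2 ^ (Suc n - 3) * ((int (Suc n))\<^sup>2 - 5 * int (Suc n) + 8) - 1"
    by (simp add: n power2_eq_square algebra_simps)
  finally show ?case .
qed

section \<open>Crossing vectors of hexagons\<close>

text \<open>A coordinate \<open>(a, b, L)\<close> counts the crossings of \<open>a\<close> (coming from the left) with its right
  neighbour \<open>b\<close> that happen while exactly the labels in \<open>L\<close> are to the left of both; crossing back
  counts negatively, so a crossing appears with opposite signs at \<open>(a, b, L)\<close> and \<open>(b, a, L)\<close>.\<close>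

definition crossing :: "nat \<Rightarrow> nat \<Rightarrow> nat set \<Rightarrow> nat \<times> nat \<times> nat set \<Rightarrow> int" where
  "crossing a b L x = (if x = (a, b, L) then 1 else 0) - (if x = (b, a, L) then 1 else 0)"

definition relabel :: "(nat \<Rightarrow> nat) \<Rightarrow> nat \<times> nat \<times> nat set \<Rightarrow> nat \<times> nat \<times> nat set" where
  "relabel p = (\<lambda>(a, b, L). (p a, p b, p ` L))"

definition crossing_coords :: "nat \<Rightarrow> (nat \<times> nat \<times> nat set) set" where
  "crossing_coords n = {1..n} \<times> {1..n} \<times> Pow {1..n}"

lemma finite_crossing_coords: "finite (crossing_coords n)"
  by (simp add: crossing_coords_def)

lemma crossing_swap: "crossing b a L x = - crossing a b L x"
  by (simp add: crossing_def)

lemma relabel_comp: "relabel (p \<circ> q) x = relabel p (relabel q x)"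
  by (cases x) (simp add: relabel_def image_comp)

lemma relabel_id [simp]: "relabel id x = x"
  by (cases x) (simp add: relabel_def)

lemma relabel_inverse:
  assumes "p permutes S"
  shows "relabel (inv' p) (relabel p x) = x" "relabel p (relabel (inv' p) x) = x"
  using relabel_comp[of "inv' p" p x] relabel_comp[of p "inv' p" x] permutes_inv_o[OF assms] by simp_all

lemma relabel_coords:
  assumes "p permutes {1..n}" "x \<in> crossing_coords n"
  shows "relabel p x \<in> crossing_coords n"
proof -
  obtain a b L where x: "x = (a, b, L)" by (cases x)
  have "p ` L \<subseteq> p ` {1..n}" using assms(2) by (intro image_mono) (simp add: x crossing_coords_def)
  then show ?thesis
    using assms permutes_in_image[OF assms(1), of a] permutes_in_image[OF assms(1), of b]
    by (simp add: x crossing_coords_def relabel_def permutes_image)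
qed

lemma bij_betw_relabel:
  assumes "p permutes {1..n}"
  shows "bij_betw (relabel p) (crossing_coords n) (crossing_coords n)"
  by (rule bij_betw_byWitness[where f' = "relabel (inv' p)"])
    (use relabel_inverse[OF assms] relabel_coords[OF assms] relabel_coords[OF permutes_inv[OF assms]] in auto)

lemma crossing_relabel:
  assumes "p permutes S"
  shows "crossing a b L (relabel (inv' p) x) = crossing (p a) (p b) (p ` L) x"
proof -
  have "relabel (inv' p) x = (a, b, L) \<longleftrightarrow> x = relabel p (a, b, L)" for a b L
    using relabel_inverse[OF assms] by metis
  then show ?thesis by (simp add: crossing_def relabel_def)
qed

text \<open>The crossings along a hexagon that starts with the labels \<open>x\<close>, \<open>y\<close>, \<open>z\<close> in this order to the
  right of \<open>A\<close>. Each pair crosses twice, in opposite directions, once with the third label to its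
  left and once with the third label to its right.\<close>

definition hexvec :: "nat \<Rightarrow> nat \<Rightarrow> nat \<Rightarrow> nat set \<Rightarrow> nat \<times> nat \<times> nat set \<Rightarrow> int" where
  "hexvec x y z A c =
     crossing y z (insert x A) c + crossing x z A c + crossing x y (insert z A) c
     - crossing y z A c - crossing x z (insert y A) c - crossing x y A c"

lemma hexvec_relabel:
  assumes "p permutes S"
  shows "hexvec x y z A (relabel (inv' p) c) = hexvec (p x) (p y) (p z) (p ` A) c"
  by (simp add: hexvec_def crossing_relabel[OF assms])

lemma hexvec_nonzero_cases:
  assumes "hexvec x y z A c \<noteq> 0"
  shows "c \<in> {(y, z, insert x A), (z, y, insert x A), (x, z, A), (z, x, A),
      (x, y, insert z A), (y, x, insert z A), (y, z, A), (z, y, A), (x, z, insert y A), (z, x, insert y A),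
      (x, y, A), (y, x, A)}"
  by (rule ccontr) (use assms in \<open>simp add: hexvec_def crossing_def\<close>)

lemma hexvec_nonzeroD:
  assumes "hexvec x y z A (p, q, L) \<noteq> 0"
  shows "L = A \<or> (\<exists>r. {x, y, z} = {p, q, r} \<and> L = insert r A)"
proof -
  have "L = A \<or> {x, y, z} = {p, q, x} \<and> L = insert x A
      \<or> {x, y, z} = {p, q, y} \<and> L = insert y A \<or> {x, y, z} = {p, q, z} \<and> L = insert z A"
    using hexvec_nonzero_cases[OF assms] unfolding insert_iff empty_iff prod.inject
    by (elim disjE) (simp_all add: insert_commute)
  then show ?thesis by blast
qed

lemma hexvec_nonzero:
  assumes "{x, y, z} = {p, q, r}" and d: "distinct [x, y, z]" and "distinct [p, q, r]"
    and A: "x \<notin> A" "y \<notin> A" "z \<notin> A"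
  shows "hexvec x y z A (p, q, insert r A) \<noteq> 0"
proof -
  have ne: "insert x A \<noteq> A" "insert y A \<noteq> A" "insert z A \<noteq> A"
    using A by auto
  have "x \<noteq> y" "x \<noteq> z" "y \<noteq> z" using d by auto
  then have neq: "x \<noteq> y" "x \<noteq> z" "y \<noteq> z" "y \<noteq> x" "z \<noteq> x" "z \<noteq> y" by auto
  have "p = x \<or> p = y \<or> p = z" "q = x \<or> q = y \<or> q = z" "r = x \<or> r = y \<or> r = z" "p \<noteq> q" "p \<noteq> r" "q \<noteq> r"
    using assms(1,3) by auto
  then have "(p, q, r) = (x, y, z) \<or> (p, q, r) = (x, z, y) \<or> (p, q, r) = (y, x, z) \<or>
      (p, q, r) = (y, z, x) \<or> (p, q, r) = (z, x, y) \<or> (p, q, r) = (z, y, x)"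
    by (elim disjE) simp_all
  then show ?thesis
    by (elim disjE) (simp_all add: hexvec_def crossing_def ne neq)
qed

text \<open>The coordinate at which the hexagon vector of \<open>(A, T)\<close>, with \<open>T = {p, q, m}\<close> and \<open>m\<close> the
  largest label, is detected: the two smaller labels cross to the right of \<open>m\<close>. Any other
  basic hexagon visible there has more labels on its left.\<close>

lemma hexvec_triangular:
  assumes AT: "(A, T) \<in> hex_labels n" and AT': "(A', T') \<in> hex_labels n"
    and T: "T = {p, q, Max T}" and T': "T' = {x, y, z}"
    and nz: "hexvec x y z A' (p, q, insert (Max T) A) \<noteq> 0"
  shows "(A', T') = (A, T) \<or> card A < card A'"
proof -
  have A: "A \<subseteq> {1..n}" "A \<inter> T = {}" "\<forall>a\<in>A. a < Max T" "finite T" "finite A" and cT: "card T = 3"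
    using AT finite_subset[of A "{1..n}"] finite_subset[of T "{1..n}"] by (auto simp: hex_labels_def)
  have A': "A' \<inter> T' = {}" "\<forall>a\<in>A'. a < Max T'" "finite T'" and c': "card T' = 3"
    using AT' finite_subset[of T' "{1..n}"] by (auto simp: hex_labels_def)
  have mT: "Max T \<in> T" using A(4) cT by (intro Max_in) auto
  then have mA: "Max T \<notin> A" using A(2) by blast
  have "insert (Max T) A = A' \<or> (\<exists>r. {x, y, z} = {p, q, r} \<and> insert (Max T) A = insert r A')"
    by (rule hexvec_nonzeroD[OF nz])
  then show ?thesis
  proof
    assume "insert (Max T) A = A'"
    then have "card A' = Suc (card A)" using mA A(5) by auto
    then show ?thesis by simp
  next
    assume "\<exists>r. {x, y, z} = {p, q, r} \<and> insert (Max T) A = insert r A'"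
    then obtain r where r: "T' = {p, q, r}" "insert (Max T) A = insert r A'" using T' by blast
    have rA': "r \<notin> A'" using A'(1) r(1) by blast
    show ?thesis
    proof (cases "r = Max T")
      case True
      then have "A' = A" using r(2) rA' mA by (metis insert_ident)
      then show ?thesis using r(1) T True by simp
    next
      case False
      then have "r \<in> A" "Max T \<in> A'" using r(2) by auto
      then have lt: "Max T < Max T'" "r < Max T" using A(3) A'(2) by auto
      have "Max T' \<in> T'" using A'(3) c' by (intro Max_in) auto
      moreover have "p \<le> Max T" "q \<le> Max T" using A(4) T by (metis Max_ge insertCI)+
      ultimately show ?thesis using lt r(1) by auto
    qed
  qed
qed

text \<open>Downward induction on the number of labels on the left: at the detecting coordinate of a pair only
  its own hexagon vector survives, since those with a larger left set already have coefficient zero.\<close>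

lemma hexvec_independent:
  fixes hx :: "nat set \<times> nat set \<Rightarrow> nat \<times> nat \<times> nat set \<Rightarrow> int" and c :: "nat set \<times> nat set \<Rightarrow> real"
  assumes hx: "\<And>A T. (A, T) \<in> hex_labels n \<Longrightarrow> \<exists>x y z. T = {x, y, z} \<and> hx (A, T) = hexvec x y z A"
    and zero: "\<And>x. x \<in> crossing_coords n \<Longrightarrow> (\<Sum>i\<in>hex_labels n. c i * real_of_int (hx i x)) = 0"
    and mem: "(A, T) \<in> hex_labels n"
  shows "c (A, T) = 0"
  using mem
proof (induction "n - card A" arbitrary: A T rule: less_induct)
  case less
  note AT = less.prems
  have A: "A \<subseteq> {1..n}" "T \<subseteq> {1..n}" "A \<inter> T = {}" "finite T" and cT: "card T = 3"
    using AT finite_subset[of T "{1..n}"] by (auto simp: hex_labels_def)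
  define m where "m = Max T"
  have mT: "m \<in> T" unfolding m_def using A(4) cT by (intro Max_in) auto
  have "card (T - {m}) = 2" using cT mT by simp
  then obtain p q where pq: "T - {m} = {p, q}" "p \<noteq> q" by (auto simp: card_2_iff)
  have T: "T = {p, q, m}" using pq mT by auto
  have pqm: "distinct [p, q, m]" using pq by auto
  let ?k = "(p, q, insert m A)"
  have k: "?k \<in> crossing_coords n" using A T mT by (auto simp: crossing_coords_def)
  have other: "c i * real_of_int (hx i ?k) = 0" if i: "i \<in> hex_labels n - {(A, T)}" for i
  proof (rule ccontr)
    assume nz: "c i * real_of_int (hx i ?k) \<noteq> 0"
    obtain A' T' where ie: "i = (A', T')" by (cases i)
    obtain x y z where xyz: "T' = {x, y, z}" "hx i = hexvec x y z A'" using hx[of A' T'] i ie by auto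
    have AT': "(A', T') \<in> hex_labels n" using i ie by simp
    have "hexvec x y z A' (p, q, insert (Max T) A) \<noteq> 0" using nz xyz(2) by (simp add: m_def)
    then have "(A', T') = (A, T) \<or> card A < card A'"
      by (rule hexvec_triangular[OF AT AT' T[unfolded m_def] xyz(1)])
    then have lt: "card A < card A'" using i ie by auto
    have "A' \<subseteq> {1..n}" using AT' by (simp add: hex_labels_def)
    then have "card A' \<le> n" using card_mono[of "{1..n}" A'] by simp
    then have "n - card A' < n - card A" using lt by simp
    then have "c (A', T') = 0" using AT' by (rule less.hyps)
    then show False using nz ie by simp
  qed
  obtain x y z where xyz: "T = {x, y, z}" "hx (A, T) = hexvec x y z A" using hx[OF AT] by blast
  have dist: "distinct [x, y, z]" using cT unfolding xyz by (auto simp: card_insert_if split: if_splits)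
  have "hx (A, T) ?k \<noteq> 0"
    unfolding xyz(2) by (rule hexvec_nonzero[OF _ dist pqm]) (use xyz(1) T A(3) in auto)
  moreover have "c (A, T) * real_of_int (hx (A, T) ?k) = 0"
  proof -
    have "(\<Sum>i\<in>hex_labels n - {(A, T)}. c i * real_of_int (hx i ?k)) = 0"
      using other by (intro sum.neutral) blast
    then show ?thesis
      using zero[OF k] sum.remove[OF finite_hex_labels AT, of "\<lambda>i. c i * real_of_int (hx i ?k)"] by simp
  qed
  ultimately show ?case by simp
qed

section \<open>Discrete and uniform groups of Euclidean motions\<close>

lemma orthogonal_matsD:
  assumes "A \<in> orthogonal_mats d"
  shows "A \<in> carrier_mat d d" "transpose_mat A * A = 1\<^sub>m d" "A * transpose_mat A = 1\<^sub>m d"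
proof -
  show A: "A \<in> carrier_mat d d" "transpose_mat A * A = 1\<^sub>m d"
    using assms by (auto simp: orthogonal_mats_def)
  show "A * transpose_mat A = 1\<^sub>m d"
    by (rule mat_mult_left_right_inverse[OF _ A(1) A(2)]) (use A in simp)
qed

lemma orthogonal_mats_mult:
  assumes "A \<in> orthogonal_mats d" "B \<in> orthogonal_mats d"
  shows "A * B \<in> orthogonal_mats d"
proof -
  note A = orthogonal_matsD[OF assms(1)] and B = orthogonal_matsD[OF assms(2)]
  have "transpose_mat (A * B) * (A * B) = transpose_mat B * transpose_mat A * (A * B)"
    using A B by (simp add: transpose_mult)
  also have "\<dots> = transpose_mat B * (transpose_mat A * (A * B))"
    using A B by (intro assoc_mult_mat[of _ d d _ d _ d]) auto
  also have "transpose_mat A * (A * B) = transpose_mat A * A * B"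
    using A B by (intro assoc_mult_mat[of _ d d _ d _ d, symmetric]) auto
  finally show ?thesis using A B by (simp add: orthogonal_mats_def)
qed

lemma group_euclidean_motions: "group (euclidean_motions d)"
proof (rule groupI)
  let ?E = "euclidean_motions d"
  show "\<one>\<^bsub>?E\<^esub> \<in> carrier ?E"
    by (simp add: euclidean_motions_def orthogonal_mats_def)
  fix p assume p: "p \<in> carrier ?E"
  obtain v A where pe: "p = (v, A)" by (cases p)
  have v: "v \<in> carrier_vec d" and AO: "A \<in> orthogonal_mats d" using p by (auto simp: pe euclidean_motions_def)
  note A = orthogonal_matsD[OF AO]
  show "\<one>\<^bsub>?E\<^esub> \<otimes>\<^bsub>?E\<^esub> p = p" using v A by (simp add: pe euclidean_motions_def)
  show "\<exists>q\<in>carrier ?E. q \<otimes>\<^bsub>?E\<^esub> p = \<one>\<^bsub>?E\<^esub>"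
  proof
    let ?q = "(- (transpose_mat A *\<^sub>v v), transpose_mat A)"
    show "?q \<in> carrier ?E" using v A by (simp add: euclidean_motions_def orthogonal_mats_def)
    have "- (transpose_mat A *\<^sub>v v) + transpose_mat A *\<^sub>v v = 0\<^sub>v d"
      by (rule uminus_l_inv_vec) (use v A in auto)
    then show "?q \<otimes>\<^bsub>?E\<^esub> p = \<one>\<^bsub>?E\<^esub>" using A by (simp add: pe euclidean_motions_def)
  qed
  fix q assume q: "q \<in> carrier ?E"
  obtain w B where qe: "q = (w, B)" by (cases q)
  have w: "w \<in> carrier_vec d" and BO: "B \<in> orthogonal_mats d" using q by (auto simp: qe euclidean_motions_def)
  note B = orthogonal_matsD[OF BO]
  show "p \<otimes>\<^bsub>?E\<^esub> q \<in> carrier ?E"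
    using v w A B orthogonal_mats_mult[OF AO BO] by (simp add: pe qe euclidean_motions_def)
  fix r assume r: "r \<in> carrier ?E"
  obtain u C where re: "r = (u, C)" by (cases r)
  have u: "u \<in> carrier_vec d" and CO: "C \<in> orthogonal_mats d" using r by (auto simp: re euclidean_motions_def)
  note C = orthogonal_matsD[OF CO]
  have "A *\<^sub>v (w + B *\<^sub>v u) = A *\<^sub>v w + (A * B) *\<^sub>v u"
    using A B w u by (simp add: mult_add_distrib_mat_vec[of _ d d] assoc_mult_mat_vec[of _ d d _ d])
  moreover have "v + A *\<^sub>v w + (A * B) *\<^sub>v u = v + (A *\<^sub>v w + (A * B) *\<^sub>v u)"
    using A B v w u by (intro assoc_add_vec[of _ d]) auto
  moreover have "A * B * C = A * (B * C)" using A B C by (intro assoc_mult_mat[of _ d d _ d _ d]) auto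
  ultimately show "p \<otimes>\<^bsub>?E\<^esub> q \<otimes>\<^bsub>?E\<^esub> r = p \<otimes>\<^bsub>?E\<^esub> (q \<otimes>\<^bsub>?E\<^esub> r)"
    by (simp add: pe qe re euclidean_motions_def)
qed

abbreviation coord_topology :: "nat \<Rightarrow> ((nat \<Rightarrow> real) \<times> (nat \<times> nat \<Rightarrow> real)) topology" where
  "coord_topology d \<equiv> prod_topology (product_topology (\<lambda>_. euclideanreal) {..<d})
          (product_topology (\<lambda>_. euclideanreal) ({..<d} \<times> {..<d}))"

lemma topspace_motion_topology: "topspace (motion_topology d) = carrier (euclidean_motions d)"
  by (auto simp: motion_topology_def topspace_pullback_topology motion_coords_def split: prod.splits)

lemma discrete_in_motion_topology:
  assumes sub: "\<Gamma> \<subseteq> carrier (euclidean_motions d)" and pos: "\<delta> > 0"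
    and sep: "\<And>p q. p \<in> \<Gamma> \<Longrightarrow> q \<in> \<Gamma> \<Longrightarrow>
      (\<And>k. k < d \<Longrightarrow> \<bar>vec_index (fst p) k - vec_index (fst q) k\<bar> < \<delta>) \<Longrightarrow>
      (\<And>k l. k < d \<Longrightarrow> l < d \<Longrightarrow> \<bar>snd p $$ (k, l) - snd q $$ (k, l)\<bar> < \<delta>) \<Longrightarrow> p = q"
  shows "discrete_in (motion_topology d) \<Gamma>"
proof -
  have "openin (subtopology (motion_topology d) \<Gamma>) {q}" if q: "q \<in> \<Gamma>" for q
  proof -
    define U1 where "U1 = PiE {..<d} (\<lambda>k. ball (vec_index (fst q) k) \<delta>)"
    define U2 where "U2 = PiE ({..<d} \<times> {..<d}) (\<lambda>i. ball (snd q $$ i) \<delta>)"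
    define U where "U = motion_coords d -` (U1 \<times> U2) \<inter> carrier (euclidean_motions d)"
    have "openin (coord_topology d) (U1 \<times> U2)"
      unfolding openin_prod_Times_iff U1_def U2_def by (simp add: openin_PiE)
    then have "openin (motion_topology d) U"
      unfolding motion_topology_def openin_pullback_topology U_def by blast
    moreover have "\<Gamma> \<inter> U = {q}"
    proof
      show "{q} \<subseteq> \<Gamma> \<inter> U"
        using q sub pos by (auto simp: U_def U1_def U2_def motion_coords_def split: prod.splits)
      show "\<Gamma> \<inter> U \<subseteq> {q}"
      proof
        fix p assume p: "p \<in> \<Gamma> \<inter> U"
        then have "fst (motion_coords d p) \<in> U1" "snd (motion_coords d p) \<in> U2" by (auto simp: U_def)
        then have "\<bar>vec_index (fst p) k - vec_index (fst q) k\<bar> < \<delta>"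
          and "\<bar>snd p $$ (k, l) - snd q $$ (k, l)\<bar> < \<delta>" if "k < d" "l < d" for k l
          using that unfolding U1_def U2_def
          by (auto simp: motion_coords_def dist_real_def PiE_iff abs_minus_commute split: prod.splits)
        then have "p = q" using p q by (intro sep) auto
        then show "p \<in> {q}" by simp
      qed
    qed
    ultimately show ?thesis unfolding openin_subtopology_alt by (metis image_eqI mem_Collect_eq)
  qed
  then show ?thesis unfolding discrete_in_def
    using sub topspace_motion_topology
    by (subst eq_commute, subst discrete_topology_unique) (auto simp: topspace_subtopology)
qed

lemma orthogonal_mats_iff:
  assumes "A \<in> carrier_mat d d"
  shows "A \<in> orthogonal_mats d \<longleftrightarrow>
    (\<forall>i<d. \<forall>j<d. (\<Sum>k<d. A $$ (k, i) * A $$ (k, j)) = (if i = j then 1 else 0))"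
proof -
  have "(transpose_mat A * A) $$ (i, j) = (\<Sum>k<d. A $$ (k, i) * A $$ (k, j))" if "i < d" "j < d" for i j
    using assms that by (simp add: scalar_prod_def lessThan_atLeast0)
  then show ?thesis
    using assms unfolding orthogonal_mats_def by (auto simp: mat_eq_iff)
qed

lemma orthogonal_mats_entry_le:
  assumes A: "A \<in> orthogonal_mats d" and "k < d" "l < d"
  shows "\<bar>A $$ (k, l)\<bar> \<le> 1"
proof -
  have "(\<Sum>m<d. A $$ (m, l) * A $$ (m, l)) = 1"
    using A orthogonal_mats_iff[OF orthogonal_matsD(1)[OF A]] assms by simp
  moreover have "A $$ (k, l) * A $$ (k, l) \<le> (\<Sum>m<d. A $$ (m, l) * A $$ (m, l))"
    by (rule member_le_sum) (use assms in auto)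
  ultimately have "(A $$ (k, l))\<^sup>2 \<le> 1" by (simp add: power2_eq_square)
  then show ?thesis by (simp add: abs_square_le_1)
qed

text \<open>Orthogonal matrices have entries of modulus at most one and are cut out by closed
  conditions.\<close>

lemma compactin_bounded_motions:
  "compactin (motion_topology d)
     {p \<in> carrier (euclidean_motions d). \<forall>k<d. \<bar>vec_index (fst p) k\<bar> \<le> r}"
proof -
  define Box where "Box = PiE {..<d} (\<lambda>_. {-r..r}) \<times> PiE ({..<d} \<times> {..<d}) (\<lambda>_. {-1..1::real})"
  define Orth where "Orth = {x \<in> topspace (coord_topology d). \<forall>i\<in>{..<d}. \<forall>j\<in>{..<d}.
      (\<Sum>k<d. snd x (k, i) * snd x (k, j)) = (if i = j then 1 else 0)}"
  have "compactin (coord_topology d) Box"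
    unfolding Box_def compactin_Times by (simp add: compactin_PiE)
  moreover have "closedin (coord_topology d) Orth"
  proof -
    have closed_Ball: "closedin T {x \<in> topspace T. \<forall>i\<in>I. Q i x}"
      if "\<And>i. i \<in> I \<Longrightarrow> closedin T {x \<in> topspace T. Q i x}"
      for T :: "((nat \<Rightarrow> real) \<times> (nat \<times> nat \<Rightarrow> real)) topology" and I :: "nat set" and Q
    proof (cases "I = {}")
      case False
      have "{x \<in> topspace T. \<forall>i\<in>I. Q i x} = (\<Inter>i\<in>I. {x \<in> topspace T. Q i x})"
        using False by blast
      then show ?thesis using closedin_INT[OF False, of T "\<lambda>i. {x \<in> topspace T. Q i x}"] that by simp
    qed simp
    have "closedin (coord_topology d) {x \<in> topspace (coord_topology d).
        (\<Sum>k<d. snd x (k, i) * snd x (k, j)) \<in> {if i = j then 1 else 0}}" if "i < d" "j < d" for i j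
    proof (rule closedin_continuous_map_preimage)
      have "continuous_map (coord_topology d) euclideanreal (\<lambda>x. snd x p)" if "p \<in> {..<d} \<times> {..<d}" for p
        using continuous_map_compose[OF continuous_map_snd continuous_map_product_projection[OF that]]
        by (simp add: o_def)
      then show "continuous_map (coord_topology d) euclideanreal (\<lambda>x. \<Sum>k<d. snd x (k, i) * snd x (k, j))"
        using that by (intro continuous_map_sum continuous_map_real_mult) auto
    qed simp
    then have "closedin (coord_topology d) {x \<in> topspace (coord_topology d). \<forall>j\<in>{..<d}.
        (\<Sum>k<d. snd x (k, i) * snd x (k, j)) = (if i = j then 1 else 0)}" if "i < d" for i
      using that by (intro closed_Ball) (simp only: singleton_iff lessThan_iff)
    then show ?thesis unfolding Orth_def by (rule closed_Ball) (simp only: lessThan_iff)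
  qed
  ultimately have comp: "compactin (coord_topology d) (Orth \<inter> Box)"
    by (rule closed_Int_compactin[rotated])
  define g where "g = (\<lambda>x. (Matrix.vec d (fst x), Matrix.mat d d (snd x)) :: real Matrix.vec \<times> real mat)"
  have coords_g: "motion_coords d (g x) = x" if "x \<in> topspace (coord_topology d)" for x
    using that by (cases x) (auto simp: motion_coords_def g_def PiE_iff extensional_def fun_eq_iff)
  have g_carrier: "g x \<in> carrier (euclidean_motions d)" if "x \<in> Orth" for x
    using that orthogonal_mats_iff[of "snd (g x)" d]
    by (auto simp: g_def euclidean_motions_def Orth_def)
  let ?S = "subtopology (coord_topology d) (Orth \<inter> Box)"
  have "continuous_map ?S (coord_topology d) (motion_coords d \<circ> g)"
    by (rule continuous_map_eq[OF continuous_map_from_subtopology[OF continuous_map_id]])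
      (use coords_g in auto)
  moreover have "topspace ?S \<subseteq> g -` carrier (euclidean_motions d)"
    using g_carrier by auto
  ultimately have "continuous_map ?S (motion_topology d) g"
    unfolding motion_topology_def by (rule continuous_map_pullback')
  moreover have "compactin ?S (Orth \<inter> Box)" using comp by (simp add: compactin_subtopology)
  ultimately have "compactin (motion_topology d) (g ` (Orth \<inter> Box))"
    by (rule image_compactin[rotated])
  moreover have "g ` (Orth \<inter> Box) = {p \<in> carrier (euclidean_motions d). \<forall>k<d. \<bar>vec_index (fst p) k\<bar> \<le> r}"
  proof (intro equalityI subsetI)
    fix p assume "p \<in> g ` (Orth \<inter> Box)"
    then obtain x where x: "x \<in> Orth" "x \<in> Box" "p = g x" by blast
    have "\<bar>vec_index (fst p) k\<bar> \<le> r" if "k < d" for k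
      using x(2) that unfolding x(3) by (auto simp: g_def Box_def PiE_iff abs_le_iff minus_le_iff)
    then show "p \<in> {p \<in> carrier (euclidean_motions d). \<forall>k<d. \<bar>vec_index (fst p) k\<bar> \<le> r}"
      using g_carrier[OF x(1)] x(3) by simp
  next
    fix p assume "p \<in> {p \<in> carrier (euclidean_motions d). \<forall>k<d. \<bar>vec_index (fst p) k\<bar> \<le> r}"
    then obtain v A where p: "p = (v, A)" "v \<in> carrier_vec d" "A \<in> orthogonal_mats d"
      and b: "\<And>k. k < d \<Longrightarrow> \<bar>vec_index v k\<bar> \<le> r"
      by (cases p) (auto simp: euclidean_motions_def)
    note A = orthogonal_matsD[OF p(3)]
    define x where "x = motion_coords d p"
    have "g x = p" using p(2) A(1) by (auto simp: g_def x_def motion_coords_def p(1))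
    moreover have "x \<in> Orth"
      using p(3) orthogonal_mats_iff[OF A(1)] by (simp add: Orth_def x_def motion_coords_def p(1))
    moreover have "x \<in> Box"
      using b orthogonal_mats_entry_le[OF p(3)]
      by (auto simp: Box_def x_def motion_coords_def p(1) abs_le_iff minus_le_iff)
    ultimately show "p \<in> g ` (Orth \<inter> Box)" by blast
  qed
  ultimately show ?thesis by simp
qed

text \<open>The quotient is the image of a compact set of motions with bounded translation part.\<close>

lemma uniform_subgroup_if_bounded_transversal:
  assumes \<Gamma>: "subgroup \<Gamma> (euclidean_motions d)"
    and bounded: "\<And>p. p \<in> carrier (euclidean_motions d) \<Longrightarrow>
      \<exists>\<gamma>\<in>\<Gamma>. \<forall>k<d. \<bar>vec_index (fst (p \<otimes>\<^bsub>euclidean_motions d\<^esub> \<gamma>)) k\<bar> \<le> r"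
  shows "uniform_subgroup d \<Gamma>"
proof -
  let ?E = "euclidean_motions d"
  interpret E: group ?E by (rule group_euclidean_motions)
  define C where "C = {p \<in> carrier ?E. \<forall>k<d. \<bar>vec_index (fst p) k\<bar> \<le> r}"
  define q where "q = (\<lambda>g. g <#\<^bsub>?E\<^esub> \<Gamma>)"
  let ?Q = "quotient_topology (motion_topology d) q"
  have top: "topspace ?Q = q ` carrier ?E"
  proof
    have "openin ?Q (topspace ?Q)" by simp
    then show "topspace ?Q \<subseteq> q ` carrier ?E"
      unfolding openin_quotient_topology topspace_motion_topology by (rule conjunct1)
    have "{x \<in> topspace (motion_topology d). q x \<in> q ` topspace (motion_topology d)} = topspace (motion_topology d)"
      by blast
    then have "openin ?Q (q ` carrier ?E)"
      unfolding openin_quotient_topology topspace_motion_topology[symmetric] by simp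
    then show "q ` carrier ?E \<subseteq> topspace ?Q" by (rule openin_subset)
  qed
  have "continuous_map (motion_topology d) ?Q q"
    unfolding continuous_map_def top
    by (auto simp: topspace_motion_topology openin_quotient_topology)
  then have "compactin ?Q (q ` C)"
    using compactin_bounded_motions[of d r] unfolding C_def[symmetric] by (rule image_compactin[rotated])
  moreover have "q ` carrier ?E \<subseteq> q ` C"
  proof
    fix A assume "A \<in> q ` carrier ?E"
    then obtain p where p: "p \<in> carrier ?E" "A = q p" by blast
    obtain \<gamma> where \<gamma>: "\<gamma> \<in> \<Gamma>" "\<forall>k<d. \<bar>vec_index (fst (p \<otimes>\<^bsub>?E\<^esub> \<gamma>)) k\<bar> \<le> r"
      using bounded[OF p(1)] by blast
    have \<gamma>c: "\<gamma> \<in> carrier ?E" using \<Gamma> \<gamma>(1) subgroup.mem_carrier by metis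
    have "p \<otimes>\<^bsub>?E\<^esub> \<gamma> \<in> C" using \<gamma> \<gamma>c p by (simp add: C_def)
    moreover have "q (p \<otimes>\<^bsub>?E\<^esub> \<gamma>) = q p"
      unfolding q_def E.lcos_m_assoc[OF subgroup.subset[OF \<Gamma>] p(1) \<gamma>c, symmetric]
        E.coset_join3[OF \<gamma>c \<Gamma> \<gamma>(1)] ..
    ultimately show "A \<in> q ` C" using p(2) by (metis imageI)
  qed
  moreover have "q ` C \<subseteq> q ` carrier ?E" by (auto simp: C_def)
  ultimately have "compactin ?Q (topspace ?Q)" unfolding top by (metis subset_antisym)
  then show ?thesis unfolding uniform_subgroup_def q_def compact_space_def .
qed

section \<open>Orthonormal bases of spaces of functions on a finite set\<close>

definition ip :: "'x set \<Rightarrow> ('x \<Rightarrow> real) \<Rightarrow> ('x \<Rightarrow> real) \<Rightarrow> real" where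
  "ip X f g = (\<Sum>x\<in>X. f x * g x)"

lemma ip_commute: "ip X f g = ip X g f"
  by (simp add: ip_def mult.commute)

lemma ip_cong: "(\<And>x. x \<in> X \<Longrightarrow> f x = f' x) \<Longrightarrow> (\<And>x. x \<in> X \<Longrightarrow> g x = g' x) \<Longrightarrow> ip X f g = ip X f' g'"
  by (simp add: ip_def)

lemma ip_add_right: "ip X f (\<lambda>x. g x + h x) = ip X f g + ip X f h"
  by (simp add: ip_def distrib_left sum.distrib)

lemma ip_diff_right: "ip X f (\<lambda>x. g x - h x) = ip X f g - ip X f h"
  by (simp add: ip_def right_diff_distrib sum_subtractf)

lemma ip_scale_right: "ip X f (\<lambda>x. c * g x) = c * ip X f g"
  by (simp add: ip_def sum_distrib_left mult.left_commute)

lemma ip_sum_right: "ip X f (\<lambda>x. \<Sum>k\<in>K. c k * g k x) = (\<Sum>k\<in>K. c k * ip X f (g k))"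
  unfolding ip_def by (simp add: sum_distrib_left mult.left_commute) (rule sum.swap)

lemma ip_self_eq_0: "finite X \<Longrightarrow> ip X f f = 0 \<longleftrightarrow> (\<forall>x\<in>X. f x = 0)"
  unfolding ip_def by (subst sum_nonneg_eq_0_iff) auto

lemma ip_self_nonneg: "ip X f f \<ge> 0"
  unfolding ip_def by (rule sum_nonneg) simp

definition orthonormal_on :: "'x set \<Rightarrow> nat \<Rightarrow> (nat \<Rightarrow> 'x \<Rightarrow> real) \<Rightarrow> bool" where
  "orthonormal_on X d u \<longleftrightarrow> (\<forall>k<d. \<forall>l<d. ip X (u k) (u l) = (if k = l then 1 else 0))"

definition span_on :: "'x set \<Rightarrow> nat \<Rightarrow> (nat \<Rightarrow> 'x \<Rightarrow> real) \<Rightarrow> ('x \<Rightarrow> real) set" where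
  "span_on X d u = {f. \<exists>c. \<forall>x\<in>X. f x = (\<Sum>k<d. c k * u k x)}"

lemma span_onI: "(\<And>x. x \<in> X \<Longrightarrow> f x = (\<Sum>k<d. c k * u k x)) \<Longrightarrow> f \<in> span_on X d u"
  by (auto simp: span_on_def)

lemma span_on_cong: "f \<in> span_on X d u \<Longrightarrow> (\<And>x. x \<in> X \<Longrightarrow> g x = f x) \<Longrightarrow> g \<in> span_on X d u"
  by (auto simp: span_on_def)

lemma span_on_sum:
  assumes "\<And>i. i \<in> I \<Longrightarrow> f i \<in> span_on X d u"
  shows "(\<lambda>x. \<Sum>i\<in>I. a i * f i x) \<in> span_on X d u"
proof -
  have "\<forall>i\<in>I. \<exists>c. \<forall>x\<in>X. f i x = (\<Sum>k<d. c k * u k x)"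
    using assms by (simp add: span_on_def)
  then obtain c where c: "\<forall>i\<in>I. \<forall>x\<in>X. f i x = (\<Sum>k<d. c i k * u k x)" by metis
  show ?thesis
  proof (rule span_onI)
    fix x assume x: "x \<in> X"
    have "(\<Sum>i\<in>I. a i * f i x) = (\<Sum>i\<in>I. \<Sum>k<d. a i * c i k * u k x)"
      using c x by (simp add: sum_distrib_left mult.assoc)
    also have "\<dots> = (\<Sum>k<d. \<Sum>i\<in>I. a i * c i k * u k x)" by (rule sum.swap)
    also have "\<dots> = (\<Sum>k<d. (\<Sum>i\<in>I. a i * c i k) * u k x)" by (simp add: sum_distrib_right)
    finally show "(\<Sum>i\<in>I. a i * f i x) = (\<Sum>k<d. (\<Sum>i\<in>I. a i * c i k) * u k x)" .
  qed
qed

lemma sum_mult_delta: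
  fixes c :: "nat \<Rightarrow> real"
  assumes "k < d"
  shows "(\<Sum>l<d. c l * (if k = l then 1 else 0)) = c k"
proof -
  have "(\<Sum>l<d. c l * (if k = l then 1 else 0)) = (\<Sum>l<d. if k = l then c l else 0)"
    by (rule sum.cong) auto
  then show ?thesis using assms by simp
qed

lemma span_on_generator:
  assumes "k < d"
  shows "u k \<in> span_on X d u"
proof (rule span_onI[where c = "\<lambda>i. if k = i then 1 else 0"])
  fix x
  show "u k x = (\<Sum>i<d. (if k = i then 1 else 0) * u i x)"
    using sum_mult_delta[OF assms, of "\<lambda>i. u i x"] by (simp add: mult.commute)
qed

lemma span_on_trans:
  assumes "f \<in> span_on X d u" "\<And>k. k < d \<Longrightarrow> u k \<in> span_on X e w"
  shows "f \<in> span_on X e w"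
proof -
  obtain c where c: "\<forall>x\<in>X. f x = (\<Sum>k<d. c k * u k x)" using assms(1) by (auto simp: span_on_def)
  have "(\<lambda>x. \<Sum>k<d. c k * u k x) \<in> span_on X e w"
    by (rule span_on_sum) (use assms(2) in auto)
  then show ?thesis by (rule span_on_cong) (use c in auto)
qed

lemma span_on_mono: "d \<le> e \<Longrightarrow> f \<in> span_on X d u \<Longrightarrow> f \<in> span_on X e u"
  by (rule span_on_trans) (auto intro: span_on_generator)

lemma orthonormal_expand:
  assumes u: "orthonormal_on X d u" and f: "f \<in> span_on X d u" and x: "x \<in> X"
  shows "f x = (\<Sum>k<d. ip X (u k) f * u k x)"
proof -
  obtain c where c: "\<forall>x\<in>X. f x = (\<Sum>k<d. c k * u k x)" using f by (auto simp: span_on_def)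
  have "ip X (u k) f = c k" if "k < d" for k
  proof -
    have "ip X (u k) f = ip X (u k) (\<lambda>x. \<Sum>l<d. c l * u l x)"
      using c by (intro ip_cong) auto
    also have "\<dots> = (\<Sum>l<d. c l * (if k = l then 1 else 0))"
      unfolding ip_sum_right using u that by (intro sum.cong) (auto simp: orthonormal_on_def)
    also have "\<dots> = c k" by (rule sum_mult_delta[OF that])
    finally show ?thesis .
  qed
  then show ?thesis using c x by simp
qed

lemma orthonormal_parseval:
  assumes u: "orthonormal_on X d u" and f: "f \<in> span_on X d u"
  shows "ip X g f = (\<Sum>k<d. ip X (u k) f * ip X g (u k))"
proof -
  have "ip X g f = ip X g (\<lambda>x. \<Sum>k<d. ip X (u k) f * u k x)"
    using orthonormal_expand[OF u f] by (intro ip_cong) auto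
  then show ?thesis by (simp add: ip_sum_right)
qed

text \<open>The Gram-Schmidt process: each step subtracts from the new vector its projection; the remainder \<open>r\<close>
  is nonzero by independence and can be normalized.\<close>

lemma orthonormal_basis_exists:
  assumes X: "finite X"
    and indep: "\<forall>c. (\<forall>x\<in>X. (\<Sum>j<d. c j * b j x) = 0) \<longrightarrow> (\<forall>j<d. c j = 0)"
  shows "\<exists>u. orthonormal_on X d u \<and> (\<forall>k<d. u k \<in> span_on X d b) \<and> (\<forall>j<d. b j \<in> span_on X d u)"
  using indep
proof (induction d)
  case 0
  show ?case by (auto simp: orthonormal_on_def)
next
  case (Suc d)
  have indep_d: "\<forall>c. (\<forall>x\<in>X. (\<Sum>j<d. c j * b j x) = 0) \<longrightarrow> (\<forall>j<d. c j = 0)"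
  proof (intro allI impI)
    fix c :: "nat \<Rightarrow> real" and j assume "\<forall>x\<in>X. (\<Sum>j<d. c j * b j x) = 0" "j < d"
    then show "c j = 0"
      using Suc.prems[rule_format, of "\<lambda>j. if j < d then c j else 0" j] by simp
  qed
  obtain u where u: "orthonormal_on X d u" "\<forall>k<d. u k \<in> span_on X d b" "\<forall>j<d. b j \<in> span_on X d u"
    using Suc.IH[OF indep_d] by blast
  define r where "r = (\<lambda>x. b d x - (\<Sum>k<d. ip X (u k) (b d) * u k x))"
  have proj: "(\<lambda>x. \<Sum>k<d. ip X (u k) (b d) * u k x) \<in> span_on X d b"
    by (rule span_on_sum) (use u(2) in auto)
  have r_orth: "ip X (u l) r = 0" if "l < d" for l
  proof -
    have "(\<Sum>k<d. ip X (u k) (b d) * ip X (u l) (u k)) = (\<Sum>k<d. ip X (u k) (b d) * (if l = k then 1 else 0))"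
      using u(1) that by (intro sum.cong) (auto simp: orthonormal_on_def)
    also have "\<dots> = ip X (u l) (b d)" by (rule sum_mult_delta[OF that])
    finally show ?thesis unfolding r_def ip_diff_right ip_sum_right by simp
  qed
  have "ip X r r \<noteq> 0"
  proof
    assume "ip X r r = 0"
    then have r0: "\<And>x. x \<in> X \<Longrightarrow> r x = 0" using ip_self_eq_0[OF X] by blast
    obtain c where c: "\<forall>x\<in>X. (\<Sum>k<d. ip X (u k) (b d) * u k x) = (\<Sum>k<d. c k * b k x)"
      using proj by (auto simp: span_on_def)
    have "(\<Sum>j<Suc d. (if j = d then -1 else c j) * b j x) = 0" if "x \<in> X" for x
      using r0[OF that] c that by (simp add: r_def)
    then show False using Suc.prems[rule_format, of "\<lambda>j. if j = d then -1 else c j" d] by simp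
  qed
  then have pos: "ip X r r > 0" using ip_self_nonneg[of X r] by simp
  define s where "s = sqrt (ip X r r)"
  have s: "s > 0" "s * s = ip X r r" using pos by (simp_all add: s_def)
  define w where "w = u(d := (\<lambda>x. (1 / s) * r x))"
  have w_less: "w k = u k" if "k < d" for k using that by (simp add: w_def)
  have w_d: "w d = (\<lambda>x. (1 / s) * r x)" by (simp add: w_def)
  have "ip X (w d) (w d) = 1"
    unfolding w_d ip_scale_right ip_commute[of X "\<lambda>x. (1 / s) * r x"] using s pos by (simp add: divide_simps)
  moreover have "ip X (w l) (w d) = 0" if "l < d" for l
    unfolding w_less[OF that] w_d ip_scale_right using r_orth[OF that] by simp
  moreover have "ip X (w d) (w l) = 0" if "l < d" for l
    using calculation(2)[OF that] ip_commute by metis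
  ultimately have ortho: "orthonormal_on X (Suc d) w"
    using u(1) unfolding orthonormal_on_def by (auto simp: less_Suc_eq w_less)
  have b_b: "b d \<in> span_on X (Suc d) b" by (rule span_on_generator) simp
  have "w k \<in> span_on X (Suc d) b" if "k < Suc d" for k
  proof (cases "k = d")
    case True
    obtain c where c: "\<forall>x\<in>X. (\<Sum>k<d. ip X (u k) (b d) * u k x) = (\<Sum>k<d. c k * b k x)"
      using proj by (auto simp: span_on_def)
    show ?thesis unfolding True w_d
      by (rule span_onI[where c = "\<lambda>j. if j = d then 1 / s else - (1 / s) * c j"])
        (use c in \<open>simp add: r_def right_diff_distrib sum_distrib_left sum_negf\<close>)
  next
    case False
    then have "k < d" using that by simp
    then have "u k \<in> span_on X d b" using u(2) by blast
    then have "u k \<in> span_on X (Suc d) b" by (rule span_on_mono[rotated]) simp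
    then show ?thesis by (simp add: w_less \<open>k < d\<close>)
  qed
  moreover have "b j \<in> span_on X (Suc d) w" if "j < Suc d" for j
  proof (cases "j = d")
    case True
    show ?thesis unfolding True
      by (rule span_onI[where c = "\<lambda>k. if k = d then s else ip X (u k) (b d)"])
        (use s in \<open>simp add: w_less w_d r_def\<close>)
  next
    case False
    then have "b j \<in> span_on X d u" using that u(3) by simp
    then have "b j \<in> span_on X d w" by (rule span_on_trans) (use span_on_generator[of _ d w] w_less in metis)
    then show ?thesis by (rule span_on_mono[rotated]) simp
  qed
  ultimately show ?case using ortho by blast
qed

section \<open>Crystallographic groups from integral cocycles\<close>

lemma finite_set_separated:
  fixes S :: "real set"
  assumes "finite S"
  obtains e where "e > 0" "\<And>a b. a \<in> S \<Longrightarrow> b \<in> S \<Longrightarrow> \<bar>a - b\<bar> < e \<Longrightarrow> a = b"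
proof -
  define D where "D = insert 1 ((\<lambda>(a, b). \<bar>a - b\<bar>) ` {(a, b) \<in> S \<times> S. a \<noteq> b})"
  have fin: "finite D" using assms by (simp add: D_def finite_subset[of _ "S \<times> S"] Collect_case_prod_Sigma)
  have "Min D > 0" using fin by (subst Min_gr_iff) (auto simp: D_def)
  moreover have "a = b" if "a \<in> S" "b \<in> S" "\<bar>a - b\<bar> < Min D" for a b
  proof (rule ccontr)
    assume "a \<noteq> b"
    then have "\<bar>a - b\<bar> \<in> D" using that by (force simp: D_def)
    then have "Min D \<le> \<bar>a - b\<bar>" using fin by simp
    then show False using that by simp
  qed
  ultimately show ?thesis by (rule that)
qed

text \<open>A group acts on a finite set of coordinates and carries an integral cocycle \<open>v\<close>, that is, it maps to the
  semidirect product of the integer vectors with the permutations of the coordinates.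
  The elements \<open>T\<close> that fix all coordinates are mapped onto a lattice with basis \<open>b\<close>, whose rank \<open>d\<close>
  may be smaller than the number of coordinates. Projecting the cocycle orthogonally to the
  span of the lattice then gives an affine isometric action on \<open>\<real>\<^sup>d\<close>; the
  permutations of coordinates are orthogonal and preserve the span of the lattice, because \<open>T\<close> is
  normal, so they commute with the projection.\<close>

locale lattice_action = group G for G (structure) +
  fixes X :: "'x set" and act :: "'a \<Rightarrow> 'x \<Rightarrow> 'x" and v :: "'a \<Rightarrow> 'x \<Rightarrow> int"
    and d :: nat and b :: "nat \<Rightarrow> 'x \<Rightarrow> int" and T :: "'a set"
  assumes finite_X: "finite X"
    and act_bij: "g \<in> carrier G \<Longrightarrow> bij_betw (act g) X X"
    and act_mult: "g \<in> carrier G \<Longrightarrow> h \<in> carrier G \<Longrightarrow> x \<in> X \<Longrightarrow> act (g \<otimes> h) x = act g (act h x)"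
    and cocycle: "g \<in> carrier G \<Longrightarrow> h \<in> carrier G \<Longrightarrow> x \<in> X \<Longrightarrow>
      v (g \<otimes> h) x = v g x + v h (act (inv g) x)"
    and T_def: "T = {g \<in> carrier G. \<forall>x\<in>X. act g x = x}"
    and v_T: "t \<in> T \<Longrightarrow> \<exists>c. \<forall>x\<in>X. v t x = (\<Sum>j<d. c j * b j x)"
    and b_T: "j < d \<Longrightarrow> \<exists>t\<in>T. \<forall>x\<in>X. v t x = b j x"
    and b_indep: "\<forall>c. (\<forall>x\<in>X. (\<Sum>j<d. c j * real_of_int (b j x)) = 0) \<longrightarrow> (\<forall>j<d. c j = 0)"
    and faithful: "g \<in> carrier G \<Longrightarrow> (\<And>j x. j < d \<Longrightarrow> x \<in> X \<Longrightarrow> b j (act g x) = b j x) \<Longrightarrow> g \<in> T"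
begin

abbreviation trans :: "'a \<Rightarrow> ('x \<Rightarrow> real) \<Rightarrow> 'x \<Rightarrow> real" where
  "trans g f \<equiv> \<lambda>x. f (act (inv g) x)"

abbreviation "bR j \<equiv> \<lambda>x. real_of_int (b j x)"
abbreviation "vR g \<equiv> \<lambda>x. real_of_int (v g x)"

lemma act_closed: "g \<in> carrier G \<Longrightarrow> x \<in> X \<Longrightarrow> act g x \<in> X"
  using act_bij bij_betwE by blast

lemma act_one: assumes "x \<in> X" shows "act \<one> x = x"
proof -
  have "act \<one> (act \<one> x) = act \<one> x" using act_mult[of \<one> \<one> x] assms by simp
  moreover have "inj_on (act \<one>) X" using act_bij[of \<one>] by (simp add: bij_betw_def)
  ultimately show ?thesis using act_closed[of \<one> x] assms by (meson inj_onD one_closed)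
qed

lemma act_inv_act: "g \<in> carrier G \<Longrightarrow> x \<in> X \<Longrightarrow> act (inv g) (act g x) = x"
  using act_mult[of "inv g" g x] act_one by simp

lemma act_act_inv: "g \<in> carrier G \<Longrightarrow> x \<in> X \<Longrightarrow> act g (act (inv g) x) = x"
  using act_mult[of g "inv g" x] act_one by simp

lemma T_carrier: "t \<in> T \<Longrightarrow> t \<in> carrier G" by (simp add: T_def)

lemma T_mult: "s \<in> T \<Longrightarrow> t \<in> T \<Longrightarrow> s \<otimes> t \<in> T"
  by (simp add: T_def act_mult)

lemma T_inv: "t \<in> T \<Longrightarrow> inv t \<in> T"
  using act_inv_act[of t] by (simp add: T_def)

lemma T_one: "\<one> \<in> T" by (simp add: T_def act_one)

lemma T_act: "t \<in> T \<Longrightarrow> x \<in> X \<Longrightarrow> act t x = x" by (simp add: T_def)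

lemma T_conj: "g \<in> carrier G \<Longrightarrow> t \<in> T \<Longrightarrow> g \<otimes> t \<otimes> inv g \<in> T"
  by (simp add: T_def act_mult act_closed act_act_inv)

lemma v_one: "x \<in> X \<Longrightarrow> v \<one> x = 0"
  using cocycle[of \<one> \<one> x] act_one by simp

lemma v_inv: "g \<in> carrier G \<Longrightarrow> x \<in> X \<Longrightarrow> v (inv g) (act (inv g) x) = - v g x"
  using cocycle[of g "inv g" x] v_one[of x] by simp

lemma v_T_mult: "s \<in> T \<Longrightarrow> h \<in> carrier G \<Longrightarrow> x \<in> X \<Longrightarrow> v (s \<otimes> h) x = v s x + v h x"
  using cocycle[of s h x] T_act[OF T_inv] T_carrier by simp

lemma v_T_inv: "t \<in> T \<Longrightarrow> x \<in> X \<Longrightarrow> v (inv t) x = - v t x"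
  using v_inv[of t x] T_act[OF T_inv] T_carrier by simp

lemma v_conj:
  assumes g: "g \<in> carrier G" and t: "t \<in> T" and x: "x \<in> X"
  shows "v (g \<otimes> t \<otimes> inv g) x = v t (act (inv g) x)"
proof -
  have tc: "t \<in> carrier G" using T_carrier[OF t] .
  have y: "act (inv g) x \<in> X" using act_closed g x by simp
  have "v (g \<otimes> t \<otimes> inv g) x = v g x + v t (act (inv g) x) + v (inv g) (act (inv (g \<otimes> t)) x)"
    using cocycle[of "g \<otimes> t" "inv g" x] cocycle[of g t x] g tc x by simp
  also have "act (inv (g \<otimes> t)) x = act (inv g) x"
    using g tc x y T_act[OF T_inv[OF t]] by (simp add: inv_mult_group act_mult)
  finally show ?thesis using v_inv[OF g x] by simp
qed

text \<open>The cocycle is additive on \<open>T\<close>, so its values there are closed under integral combinations.\<close>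

lemma lattice_surj: "\<exists>t\<in>T. \<forall>x\<in>X. v t x = (\<Sum>j<m. c j * b j x)" if "m \<le> d" for m and c :: "nat \<Rightarrow> int"
  using that
proof (induction m)
  case 0
  then show ?case using T_one v_one by auto
next
  case (Suc m)
  obtain t where t: "t \<in> T" "\<forall>x\<in>X. v t x = (\<Sum>j<m. c j * b j x)" using Suc by auto
  obtain e where e: "e \<in> T" "\<forall>x\<in>X. v e x = b m x" using b_T[of m] Suc.prems by auto
  have nat_mult: "\<exists>s\<in>T. \<forall>x\<in>X. v s x = int k * b m x" for k
  proof (induction k)
    case 0
    then show ?case using T_one v_one by auto
  next
    case (Suc k)
    then obtain s where "s \<in> T" "\<forall>x\<in>X. v s x = int k * b m x" by blast
    then have "s \<otimes> e \<in> T \<and> (\<forall>x\<in>X. v (s \<otimes> e) x = int (Suc k) * b m x)"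
      using e T_mult v_T_mult T_carrier by (simp add: algebra_simps)
    then show ?case by blast
  qed
  have "\<exists>s\<in>T. \<forall>x\<in>X. v s x = c m * b m x"
  proof (cases "c m \<ge> 0")
    case True
    then show ?thesis using nat_mult[of "nat (c m)"] by simp
  next
    case False
    obtain s where s: "s \<in> T" "\<forall>x\<in>X. v s x = int (nat (- c m)) * b m x" using nat_mult by blast
    have "inv s \<in> T \<and> (\<forall>x\<in>X. v (inv s) x = c m * b m x)"
      using s T_inv v_T_inv False by simp
    then show ?thesis by blast
  qed
  then obtain s where s: "s \<in> T" "\<forall>x\<in>X. v s x = c m * b m x" by blast
  have "t \<otimes> s \<in> T \<and> (\<forall>x\<in>X. v (t \<otimes> s) x = (\<Sum>j<Suc m. c j * b j x))"
    using s t T_mult v_T_mult T_carrier by simp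
  then show ?case by blast
qed

definition translation_kernel :: "'a set" where
  "translation_kernel = {t \<in> T. \<forall>x\<in>X. v t x = 0}"

lemma ip_trans: "g \<in> carrier G \<Longrightarrow> ip X (trans g f) (trans g h) = ip X f h"
  unfolding ip_def
  using sum.reindex_bij_betw[OF act_bij[of "inv g"], of "\<lambda>x. f x * h x"] by simp

lemma ip_trans_left:
  assumes "g \<in> carrier G"
  shows "ip X (trans g f) h = ip X f (trans (inv g) h)"
proof -
  have "ip X (trans g f) h = ip X (trans g f) (trans g (trans (inv g) h))"
    using assms by (intro ip_cong) (simp_all add: act_act_inv)
  also have "\<dots> = ip X f (trans (inv g) h)" by (rule ip_trans[OF assms])
  finally show ?thesis .
qed

context
  fixes u :: "nat \<Rightarrow> 'x \<Rightarrow> real"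
  assumes u_orth: "orthonormal_on X d u"
    and u_span: "\<And>k. k < d \<Longrightarrow> u k \<in> span_on X d bR"
    and b_span: "\<And>j. j < d \<Longrightarrow> bR j \<in> span_on X d u"
begin

lemma span_b_u: "f \<in> span_on X d bR \<Longrightarrow> f \<in> span_on X d u"
  by (rule span_on_trans[OF _ b_span])

lemma vR_T_span: assumes "t \<in> T" shows "vR t \<in> span_on X d u"
proof (rule span_b_u)
  obtain c where c: "\<forall>x\<in>X. v t x = (\<Sum>j<d. c j * b j x)" using v_T[OF assms] by blast
  show "vR t \<in> span_on X d bR"
    by (rule span_onI[where c = "\<lambda>j. real_of_int (c j)"]) (use c in simp)
qed

text \<open>The span of the lattice is invariant under the action, because the translations form a
  normal subgroup.\<close>

lemma trans_b_span:
  assumes g: "g \<in> carrier G" and j: "j < d"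
  shows "trans g (bR j) \<in> span_on X d u"
proof -
  obtain t where t: "t \<in> T" "\<forall>x\<in>X. v t x = b j x" using b_T[OF j] by blast
  have "vR (g \<otimes> t \<otimes> inv g) \<in> span_on X d u" by (rule vR_T_span[OF T_conj[OF g t(1)]])
  then show ?thesis
    by (rule span_on_cong) (use v_conj[OF g t(1)] t(2) act_closed g in simp)
qed

lemma trans_u_span:
  assumes g: "g \<in> carrier G" and l: "l < d"
  shows "trans g (u l) \<in> span_on X d u"
proof -
  obtain c where c: "\<forall>x\<in>X. u l x = (\<Sum>j<d. c j * bR j x)" using u_span[OF l] by (auto simp: span_on_def)
  have "(\<lambda>x. \<Sum>j<d. c j * trans g (bR j) x) \<in> span_on X d u"
    by (rule span_on_sum) (use trans_b_span[OF g] in auto)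
  then show ?thesis by (rule span_on_cong) (use c act_closed g in simp)
qed

text \<open>The linear part and the translation part of the action, in the coordinates given by the
  orthonormal basis \<open>u\<close>; taking the inner products of \<open>vR g\<close> with \<open>u\<close> is the orthogonal projection.\<close>

definition rot :: "'a \<Rightarrow> real mat" where
  "rot g = Matrix.mat d d (\<lambda>(k, l). ip X (u k) (trans g (u l)))"

definition shift :: "'a \<Rightarrow> real Matrix.vec" where
  "shift g = Matrix.vec d (\<lambda>k. ip X (u k) (vR g))"

definition motion :: "'a \<Rightarrow> real Matrix.vec \<times> real mat" where
  "motion g = (shift g, rot g)"

lemma rot_carrier [simp]: "rot g \<in> carrier_mat d d" by (simp add: rot_def)
lemma shift_carrier [simp]: "shift g \<in> carrier_vec d" by (simp add: shift_def)

lemma rot_mult: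
  assumes g: "g \<in> carrier G" and h: "h \<in> carrier G"
  shows "rot (g \<otimes> h) = rot g * rot h"
proof (rule eq_matI)
  fix k l assume "k < dim_row (rot g * rot h)" "l < dim_col (rot g * rot h)"
  then have k: "k < d" and l: "l < d" by (simp_all add: rot_def)
  have "ip X (u k) (trans (g \<otimes> h) (u l)) = ip X (u k) (trans g (trans h (u l)))"
    using g h act_closed by (intro ip_cong) (simp_all add: inv_mult_group act_mult)
  also have "\<dots> = ip X (trans (inv g) (u k)) (trans h (u l))"
    using ip_trans_left[of "inv g" "u k" "trans h (u l)"] g by simp
  also have "\<dots> = (\<Sum>m<d. ip X (u m) (trans h (u l)) * ip X (trans (inv g) (u k)) (u m))"
    by (rule orthonormal_parseval[OF u_orth trans_u_span[OF h l]])
  also have "\<dots> = (\<Sum>m<d. ip X (u k) (trans g (u m)) * ip X (u m) (trans h (u l)))"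
    using ip_trans_left[of "inv g" "u k"] g by (simp add: mult.commute)
  finally show "rot (g \<otimes> h) $$ (k, l) = (rot g * rot h) $$ (k, l)"
    using k l by (simp add: rot_def scalar_prod_def lessThan_atLeast0)
qed (simp_all add: rot_def)

lemma rot_transpose:
  assumes g: "g \<in> carrier G"
  shows "transpose_mat (rot g) = rot (inv g)"
proof (rule eq_matI)
  fix k l assume "k < dim_row (rot (inv g))" "l < dim_col (rot (inv g))"
  then have kl: "k < d" "l < d" by (simp_all add: rot_def)
  have "ip X (u l) (trans g (u k)) = ip X (u k) (trans (inv g) (u l))"
    unfolding ip_commute[of X "u l"] by (rule ip_trans_left[OF g])
  then show "transpose_mat (rot g) $$ (k, l) = rot (inv g) $$ (k, l)"
    using kl by (simp add: rot_def)
qed (simp_all add: rot_def)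

lemma rot_T: assumes "t \<in> T" shows "rot t = 1\<^sub>m d"
proof (rule eq_matI)
  fix k l assume kl: "k < dim_row (1\<^sub>m d :: real mat)" "l < dim_col (1\<^sub>m d :: real mat)"
  have "ip X (u k) (trans t (u l)) = ip X (u k) (u l)"
    using T_act[OF T_inv[OF assms]] by (intro ip_cong) simp_all
  then show "rot t $$ (k, l) = 1\<^sub>m d $$ (k, l)"
    using kl u_orth by (simp add: rot_def orthonormal_on_def)
qed (simp_all add: rot_def)

lemma rot_orthogonal: assumes "g \<in> carrier G" shows "rot g \<in> orthogonal_mats d"
  unfolding orthogonal_mats_def using assms rot_mult[of "inv g" g] rot_T[OF T_one]
  by (simp add: rot_transpose)

text \<open>Here \<open>vR h\<close> need not lie in the span of \<open>u\<close>; the expansion is applied to the translate of \<open>u k\<close> instead,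
  which is moved to the other side of the inner product.\<close>

lemma shift_mult:
  assumes g: "g \<in> carrier G" and h: "h \<in> carrier G"
  shows "shift (g \<otimes> h) = shift g + rot g *\<^sub>v shift h"
proof (rule eq_vecI)
  fix k assume "k < dim_vec (shift g + rot g *\<^sub>v shift h)"
  then have k: "k < d" by (simp add: rot_def)
  have "ip X (u k) (vR (g \<otimes> h)) = ip X (u k) (\<lambda>x. vR g x + trans g (vR h) x)"
    using cocycle[OF g h] by (intro ip_cong) simp_all
  also have "\<dots> = ip X (u k) (vR g) + ip X (u k) (trans g (vR h))"
    by (rule ip_add_right)
  also have "ip X (u k) (trans g (vR h)) = ip X (vR h) (trans (inv g) (u k))"
    using ip_trans_left[of "inv g" "u k" "vR h"] g by (simp add: ip_commute)
  also have "\<dots> = (\<Sum>m<d. ip X (u m) (trans (inv g) (u k)) * ip X (vR h) (u m))"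
    by (rule orthonormal_parseval[OF u_orth trans_u_span[OF _ k]]) (use g in simp)
  also have "\<dots> = (\<Sum>m<d. ip X (u k) (trans g (u m)) * ip X (u m) (vR h))"
    using ip_trans_left[of g "u _" "u k"] g by (simp add: ip_commute)
  finally show "vec_index (shift (g \<otimes> h)) k = vec_index (shift g + rot g *\<^sub>v shift h) k"
    using k by (simp add: rot_def shift_def scalar_prod_def lessThan_atLeast0)
qed (simp_all add: rot_def shift_def)

lemma motion_hom: "motion \<in> hom G (euclidean_motions d)"
  by (rule homI) (simp_all add: motion_def euclidean_motions_def rot_orthogonal rot_mult shift_mult)

lemma rot_eq_one_imp_T:
  assumes g: "g \<in> carrier G" and R: "rot g = 1\<^sub>m d"
  shows "g \<in> T"
proof -
  have "trans g (u l) x = u l x" if l: "l < d" and x: "x \<in> X" for l x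
  proof -
    have "ip X (u k) (trans g (u l)) = (if k = l then 1 else 0)" if "k < d" for k
      using arg_cong[OF R, of "\<lambda>A. A $$ (k, l)"] that l by (simp add: rot_def)
    then have "trans g (u l) x = (\<Sum>k<d. (if k = l then 1 else 0) * u k x)"
      using orthonormal_expand[OF u_orth trans_u_span[OF g l] x] by simp
    also have "\<dots> = u l x" using sum_mult_delta[OF l, of "\<lambda>k. u k x"] by (simp add: mult.commute eq_commute)
    finally show ?thesis .
  qed
  then have fix_u: "u l (act (inv g) x) = u l x" if "l < d" "x \<in> X" for l x using that by simp
  have "b j (act (inv g) x) = b j x" if j: "j < d" and x: "x \<in> X" for j x
  proof -
    have gx: "act (inv g) x \<in> X" using act_closed g x by simp
    have "bR j (act (inv g) x) = (\<Sum>k<d. ip X (u k) (bR j) * u k (act (inv g) x))"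
      by (rule orthonormal_expand[OF u_orth b_span[OF j] gx])
    also have "\<dots> = (\<Sum>k<d. ip X (u k) (bR j) * u k x)" using fix_u x by simp
    also have "\<dots> = bR j x" by (rule orthonormal_expand[OF u_orth b_span[OF j] x, symmetric])
    finally show ?thesis by simp
  qed
  then have "inv g \<in> T" using g by (intro faithful) simp_all
  then show ?thesis using T_inv[of "inv g"] g by simp
qed

text \<open>The squared length of a translation vector is the sum of the squares of its integral coordinates, hence
  an integer.\<close>

lemma shift_eq_zero_imp:
  assumes t: "t \<in> T" and small: "(\<Sum>k<d. (vec_index (shift t) k)\<^sup>2) < 1"
  shows "t \<in> translation_kernel"
proof -
  have "ip X (vR t) (vR t) = (\<Sum>k<d. (vec_index (shift t) k)\<^sup>2)"
    using orthonormal_parseval[OF u_orth vR_T_span[OF t], of "vR t"]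
    by (simp add: shift_def power2_eq_square ip_commute)
  moreover have "ip X (vR t) (vR t) = real_of_int (\<Sum>x\<in>X. v t x * v t x)" by (simp add: ip_def)
  ultimately have "(\<Sum>x\<in>X. v t x * v t x) < 1" using small by linarith
  moreover have "(\<Sum>x\<in>X. v t x * v t x) \<ge> 0" by (intro sum_nonneg) simp
  ultimately have "(\<Sum>x\<in>X. v t x * v t x) = 0" by simp
  then have "\<forall>x\<in>X. v t x * v t x = 0" using finite_X by (subst (asm) sum_nonneg_eq_0_iff) auto
  then show ?thesis using t by (simp add: translation_kernel_def)
qed

lemma motion_kernel: "kernel G (euclidean_motions d) motion = translation_kernel"
proof (intro equalityI subsetI)
  fix g assume "g \<in> kernel G (euclidean_motions d) motion"
  then have g: "g \<in> carrier G" "shift g = 0\<^sub>v d" "rot g = 1\<^sub>m d"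
    by (auto simp: kernel_def motion_def euclidean_motions_def)
  show "g \<in> translation_kernel"
    by (rule shift_eq_zero_imp[OF rot_eq_one_imp_T[OF g(1,3)]]) (simp add: g(2))
next
  fix t assume t: "t \<in> translation_kernel"
  then have T: "t \<in> T" and v0: "\<forall>x\<in>X. v t x = 0" by (simp_all add: translation_kernel_def)
  have "ip X (u k) (vR t) = 0" for k using v0 by (simp add: ip_def)
  then have "shift t = 0\<^sub>v d" by (auto simp: shift_def)
  then show "t \<in> kernel G (euclidean_motions d) motion"
    using T T_carrier rot_T[OF T] by (simp add: kernel_def motion_def euclidean_motions_def)
qed

lemma group_hom_motion: "group_hom G (euclidean_motions d) motion"
  using motion_hom group_euclidean_motions is_group by (simp add: group_hom_def group_hom_axioms_def)

lemma finite_rotations: "finite (rot ` carrier G)"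
proof -
  have "rot ` carrier G \<subseteq> (\<lambda>\<phi>. Matrix.mat d d (\<lambda>(k, l). ip X (u k) (\<lambda>x. u l (\<phi> x)))) ` (X \<rightarrow>\<^sub>E X)"
  proof
    fix R assume "R \<in> rot ` carrier G"
    then obtain g where g: "g \<in> carrier G" "R = rot g" by blast
    have "R = Matrix.mat d d (\<lambda>(k, l). ip X (u k) (\<lambda>x. u l (restrict (act (inv g)) X x)))"
      unfolding g(2) rot_def by (simp add: ip_def cong: sum.cong)
    moreover have "restrict (act (inv g)) X \<in> X \<rightarrow>\<^sub>E X" using act_closed g by simp
    ultimately show "R \<in> (\<lambda>\<phi>. Matrix.mat d d (\<lambda>(k, l). ip X (u k) (\<lambda>x. u l (\<phi> x)))) ` (X \<rightarrow>\<^sub>E X)"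
      by (rule image_eqI)
  qed
  moreover have "finite (X \<rightarrow>\<^sub>E X)" using finite_X by (simp add: finite_PiE)
  ultimately show ?thesis by (rule finite_subset[OF _ finite_imageI])
qed

text \<open>Two motions whose coordinates are close have the same rotation part, since there are
  finitely many rotation parts; then they differ by a translation of norm less than one,
  which must be trivial because translations are integral vectors.\<close>

lemma discrete_image: "discrete_in (motion_topology d) (motion ` carrier G)"
proof -
  define S where "S = (\<lambda>(A, p). A $$ p) ` (rot ` carrier G \<times> ({..<d} \<times> {..<d}))"
  have "finite S" unfolding S_def by (rule finite_imageI[OF finite_cartesian_product[OF finite_rotations]]) simp
  then obtain e where e: "e > 0" "\<And>a b. a \<in> S \<Longrightarrow> b \<in> S \<Longrightarrow> \<bar>a - b\<bar> < e \<Longrightarrow> a = b"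
    using finite_set_separated by blast
  \<comment> \<open>The second bound makes the squared length of a difference of shifts smaller than one.\<close>
  define \<delta> where "\<delta> = min e (1 / (real d + 1))"
  show ?thesis
  proof (rule discrete_in_motion_topology)
    show "motion ` carrier G \<subseteq> carrier (euclidean_motions d)"
      by (rule hom_carrier[OF motion_hom])
    show "\<delta> > 0" using e by (simp add: \<delta>_def)
    fix p q assume "p \<in> motion ` carrier G" "q \<in> motion ` carrier G"
    then obtain g h where g: "g \<in> carrier G" "p = motion g" and h: "h \<in> carrier G" "q = motion h" by blast
    assume shift_close: "\<And>k. k < d \<Longrightarrow> \<bar>vec_index (fst p) k - vec_index (fst q) k\<bar> < \<delta>"
      and rot_close: "\<And>k l. k < d \<Longrightarrow> l < d \<Longrightarrow> \<bar>snd p $$ (k, l) - snd q $$ (k, l)\<bar> < \<delta>"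
    have rot_eq: "rot g = rot h"
    proof (rule eq_matI)
      fix k l assume "k < dim_row (rot h)" "l < dim_col (rot h)"
      then have kl: "k < d" "l < d" by (simp_all add: rot_def)
      have in_S: "rot f $$ (k, l) \<in> S" if "f \<in> carrier G" for f
        unfolding S_def using that kl by (intro image_eqI[of _ _ "(rot f, (k, l))"]) simp_all
      have "\<bar>rot g $$ (k, l) - rot h $$ (k, l)\<bar> < e"
        using rot_close[OF kl] by (simp add: g h motion_def \<delta>_def)
      then show "rot g $$ (k, l) = rot h $$ (k, l)" by (rule e(2)[OF in_S[OF g(1)] in_S[OF h(1)]])
    qed (simp_all add: rot_def)
    define t where "t = g \<otimes> inv h"
    have t: "t \<in> carrier G" and gt: "g = t \<otimes> h" using g h by (simp_all add: t_def m_assoc)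
    have "rot t = rot h * rot (inv h)" using rot_mult g h rot_eq by (simp add: t_def)
    also have "\<dots> = rot \<one>" using rot_mult[of h "inv h"] h by simp
    finally have tT: "t \<in> T" using rot_eq_one_imp_T[OF t] rot_T[OF T_one] by simp
    have "shift g = shift t + shift h"
      unfolding gt using shift_mult[OF t h(1)] rot_T[OF tT] by simp
    then have small: "\<bar>vec_index (shift t) k\<bar> < \<delta>" if "k < d" for k
      using shift_close[OF that] that by (simp add: g h motion_def shift_def)
    have "(vec_index (shift t) k)\<^sup>2 \<le> 1 / (real d + 1)" if "k < d" for k
    proof -
      have le: "\<bar>vec_index (shift t) k\<bar> \<le> 1 / (real d + 1)" using small[OF that] by (simp add: \<delta>_def)
      have "(vec_index (shift t) k)\<^sup>2 = \<bar>vec_index (shift t) k\<bar> * \<bar>vec_index (shift t) k\<bar>"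
        by (simp add: power2_eq_square)
      also have "\<dots> \<le> 1 / (real d + 1) * 1"
        by (rule mult_mono) (use le in \<open>auto intro: order_trans[OF le]\<close>)
      finally show ?thesis by simp
    qed
    then have "(\<Sum>k<d. (vec_index (shift t) k)\<^sup>2) \<le> (\<Sum>k<d. 1 / (real d + 1))" by (intro sum_mono) simp
    also have "\<dots> < 1" by simp
    finally have "t \<in> kernel G (euclidean_motions d) motion"
      unfolding motion_kernel by (rule shift_eq_zero_imp[OF tT])
    then have "motion t = \<one>\<^bsub>euclidean_motions d\<^esub>" by (simp add: kernel_def)
    then have "motion g = motion h"
      unfolding gt hom_mult[OF motion_hom t h(1)]
      using hom_in_carrier[OF motion_hom h(1)] group.is_monoid[OF group_euclidean_motions] by (simp add: monoid.l_one)
    then show "p = q" by (simp add: g h)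
  qed
qed

text \<open>Every translation of \<open>\<real>\<^sup>d\<close> is, up to the fundamental parallelepiped of the lattice, a
  translation in the group.\<close>

lemma uniform_image: "uniform_subgroup d (motion ` carrier G)"
proof (rule uniform_subgroup_if_bounded_transversal)
  interpret motion: group_hom G "euclidean_motions d" motion by (rule group_hom_motion)
  show "subgroup (motion ` carrier G) (euclidean_motions d)" by (rule motion.img_is_subgroup)
  fix p assume "p \<in> carrier (euclidean_motions d)"
  then obtain w A where p: "p = (w, A)" "w \<in> carrier_vec d" and AO: "A \<in> orthogonal_mats d"
    by (auto simp: euclidean_motions_def)
  note A = orthogonal_matsD[OF AO]
  \<comment> \<open>Right multiplication by a translation \<open>z\<close> adds \<open>A z\<close> to \<open>w\<close>, so the vector to be reduced modulo the
    lattice is \<open>y\<close>; the integral parts of its lattice coordinates \<open>c\<close> are removed.\<close>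
  define y where "y = transpose_mat A *\<^sub>v w"
  have y: "y \<in> carrier_vec d" using A p by (simp add: y_def)
  have Ay: "A *\<^sub>v y = w" unfolding y_def using A p by (simp add: assoc_mult_mat_vec[of _ d d _ d, symmetric])
  define F where "F = (\<lambda>x. \<Sum>l<d. vec_index y l * u l x)"
  have "F \<in> span_on X d bR" unfolding F_def by (rule span_on_sum) (use u_span in auto)
  then obtain c where c: "\<forall>x\<in>X. F x = (\<Sum>j<d. c j * bR j x)" by (auto simp: span_on_def)
  obtain t where t: "t \<in> T" "\<forall>x\<in>X. v t x = (\<Sum>j<d. (- \<lfloor>c j\<rfloor>) * b j x)"
    using lattice_surj[of d "\<lambda>j. - \<lfloor>c j\<rfloor>"] by auto
  have coord: "\<bar>vec_index (y + shift t) l\<bar> \<le> (\<Sum>j<d. \<bar>ip X (u l) (bR j)\<bar>)" if l: "l < d" for l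
  proof -
    have "ip X (u l) F = (\<Sum>k<d. vec_index y k * ip X (u l) (u k))" unfolding F_def by (rule ip_sum_right)
    also have "\<dots> = (\<Sum>k<d. vec_index y k * (if l = k then 1 else 0))"
      using u_orth l by (intro sum.cong) (auto simp: orthonormal_on_def)
    also have "\<dots> = vec_index y l" by (rule sum_mult_delta[OF l])
    finally have "vec_index (y + shift t) l = ip X (u l) F + ip X (u l) (vR t)"
      using l by (simp add: shift_def)
    also have "\<dots> = ip X (u l) (\<lambda>x. F x + vR t x)" by (rule ip_add_right[symmetric])
    also have "\<dots> = ip X (u l) (\<lambda>x. \<Sum>j<d. frac (c j) * bR j x)"
      using c t(2) by (intro ip_cong) (simp_all add: frac_def left_diff_distrib sum_subtractf sum_negf)
    also have "\<dots> = (\<Sum>j<d. frac (c j) * ip X (u l) (bR j))" by (rule ip_sum_right)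
    also have "\<bar>\<dots>\<bar> \<le> (\<Sum>j<d. \<bar>frac (c j) * ip X (u l) (bR j)\<bar>)" by (rule sum_abs)
    also have "\<dots> \<le> (\<Sum>j<d. \<bar>ip X (u l) (bR j)\<bar>)"
    proof (rule sum_mono)
      fix j
      have "0 \<le> frac (c j)" "frac (c j) \<le> 1" using frac_lt_1[of "c j"] by simp_all
      then show "\<bar>frac (c j) * ip X (u l) (bR j)\<bar> \<le> \<bar>ip X (u l) (bR j)\<bar>"
        by (simp add: abs_mult mult_left_le_one_le)
    qed
    finally show ?thesis .
  qed
  have fst_eq: "fst (p \<otimes>\<^bsub>euclidean_motions d\<^esub> motion t) = A *\<^sub>v (y + shift t)"
    using A y Ay by (simp add: p(1) motion_def euclidean_motions_def mult_add_distrib_mat_vec[of _ d d])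
  have "\<bar>vec_index (A *\<^sub>v (y + shift t)) k\<bar> \<le> (\<Sum>l<d. \<Sum>j<d. \<bar>ip X (u l) (bR j)\<bar>)" if k: "k < d" for k
  proof -
    have "vec_index (A *\<^sub>v (y + shift t)) k = (\<Sum>l<d. A $$ (k, l) * vec_index (y + shift t) l)"
      using A k by (simp add: scalar_prod_def lessThan_atLeast0 shift_def)
    also have "\<bar>\<dots>\<bar> \<le> (\<Sum>l<d. \<bar>A $$ (k, l) * vec_index (y + shift t) l\<bar>)" by (rule sum_abs)
    also have "\<dots> \<le> (\<Sum>l<d. \<Sum>j<d. \<bar>ip X (u l) (bR j)\<bar>)"
    proof (rule sum_mono)
      fix l assume "l \<in> {..<d}"
      then have l: "l < d" by simp
      have "\<bar>A $$ (k, l) * vec_index (y + shift t) l\<bar> \<le> 1 * \<bar>vec_index (y + shift t) l\<bar>"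
        unfolding abs_mult by (rule mult_right_mono[OF orthogonal_mats_entry_le[OF AO k l]]) simp
      then show "\<bar>A $$ (k, l) * vec_index (y + shift t) l\<bar> \<le> (\<Sum>j<d. \<bar>ip X (u l) (bR j)\<bar>)"
        using coord[OF l] by linarith
    qed
    finally show ?thesis .
  qed
  then show "\<exists>\<gamma>\<in>motion ` carrier G. \<forall>k<d.
      \<bar>vec_index (fst (p \<otimes>\<^bsub>euclidean_motions d\<^esub> \<gamma>)) k\<bar> \<le> (\<Sum>l<d. \<Sum>j<d. \<bar>ip X (u l) (bR j)\<bar>)"
    using t(1) T_carrier by (intro bexI[of _ "motion t"]) (simp_all add: fst_eq)
qed

lemma crystallographic_aux: "crystallographic_group d (G Mod translation_kernel)"
proof -
  interpret motion: group_hom G "euclidean_motions d" motion by (rule group_hom_motion)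
  let ?\<Gamma> = "motion ` carrier G"
  let ?E\<Gamma> = "(euclidean_motions d)\<lparr>carrier := ?\<Gamma>\<rparr>"
  have sub: "subgroup ?\<Gamma> (euclidean_motions d)" by (rule motion.img_is_subgroup)
  have "group ?E\<Gamma>" by (rule group.subgroup_imp_group[OF group_euclidean_motions sub])
  moreover have "motion \<in> hom G ?E\<Gamma>" using motion_hom by (simp add: hom_def)
  ultimately interpret onto: group_hom G ?E\<Gamma> motion
    using is_group by (simp add: group_hom_def group_hom_axioms_def)
  have ker: "kernel G ?E\<Gamma> motion = translation_kernel"
    using motion_kernel by (simp add: kernel_def)
  have "(G Mod kernel G ?E\<Gamma> motion) \<cong> ?E\<Gamma>" by (rule onto.FactGroup_iso) simp
  moreover have "group (G Mod kernel G ?E\<Gamma> motion)" by (rule normal.factorgroup_is_group[OF onto.normal_kernel])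
  ultimately show ?thesis
    unfolding crystallographic_group_def ker using sub discrete_image uniform_image by blast
qed

end

theorem crystallographic: "crystallographic_group d (G Mod translation_kernel)"
proof -
  obtain u where u: "orthonormal_on X d u" "\<forall>k<d. u k \<in> span_on X d bR" "\<forall>j<d. bR j \<in> span_on X d u"
    using orthonormal_basis_exists[OF finite_X b_indep] by blast
  show ?thesis by (rule crystallographic_aux[of u]) (use u in auto)
qed

end

section \<open>The abelianized kernel\<close>

text \<open>The cocycle \<open>cross\<close> counts the crossings made along an element that starts from the arrangement
  \<open>1, \<dots>, n\<close>; in a product, the crossings of the second factor are relabelled by the permutation of
  the first.\<close>

locale crossing_lift = adjacent_lift +
  fixes cross :: "'a \<Rightarrow> nat \<times> nat \<times> nat set \<Rightarrow> int"
  assumes cross_mult: "g \<in> carrier G \<Longrightarrow> h \<in> carrier G \<Longrightarrow>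
      cross (g \<otimes> h) x = cross g x + cross h (relabel (inv' (perm g)) x)"
    and cross_s: "i \<in> {1..<n} \<Longrightarrow> cross (s i) = crossing i (Suc i) {1..<i}"
begin

lemma cross_one: "cross \<one> x = 0"
  using cross_mult[of \<one> \<one> x] perm_one by simp

lemma cross_hexagon_word:
  assumes i: "1 \<le> i" "i + 2 \<le> n"
  shows "cross (sword [Suc i, i, Suc i, i, Suc i, i]) x = hexvec i (Suc i) (Suc (Suc i)) {1..<i} x"
proof -
  define \<tau> \<sigma> where "\<tau> = Transposition.transpose i (Suc i)"
    and "\<sigma> = Transposition.transpose (Suc i) (Suc (Suc i))"
  define B where "B = {1..<i}"
  have \<tau>: "\<tau> permutes {1..n}" and \<sigma>: "\<sigma> permutes {1..n}"
    unfolding \<tau>_def \<sigma>_def by (rule permutes_swap_id; use i in simp)+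
  have ii: "i \<in> {1..<n}" "Suc i \<in> {1..<n}" using i by auto
  have B: "{1..<Suc i} = insert i B" using i by (auto simp: B_def)
  have img: "\<tau> ` B = B" "\<sigma> ` B = B"
    by (auto simp: \<tau>_def \<sigma>_def B_def Transposition.transpose_def image_iff)
  have val: "\<tau> i = Suc i" "\<tau> (Suc i) = i" "\<tau> (Suc (Suc i)) = Suc (Suc i)"
    "\<sigma> i = i" "\<sigma> (Suc i) = Suc (Suc i)" "\<sigma> (Suc (Suc i)) = Suc i"
    by (simp_all add: \<tau>_def \<sigma>_def Transposition.transpose_def)
  have step1: "cross (s i \<otimes> w) x = crossing i (Suc i) B x + cross w (relabel (inv' \<tau>) x)"
    if "w \<in> carrier G" for w x
    using cross_mult[OF s_closed[OF ii(1)] that, of x] cross_s[OF ii(1)] perm_s[OF ii(1)]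
    by (simp add: \<tau>_def B_def)
  have step2: "cross (s (Suc i) \<otimes> w) x = crossing (Suc i) (Suc (Suc i)) (insert i B) x + cross w (relabel (inv' \<sigma>) x)"
    if "w \<in> carrier G" for w x
    using cross_mult[OF s_closed[OF ii(2)] that, of x] cross_s[OF ii(2)] perm_s[OF ii(2)]
    unfolding B by (simp add: \<sigma>_def)
  have cl: "sword xs \<in> carrier G" if "set xs \<subseteq> {i, Suc i}" for xs
    using that ii by (intro sword_closed) auto
  show ?thesis
    unfolding sword_Cons B_def[symmetric] using cl[of "[]"] s_closed ii
    by (simp add: step1 step2 cross_s[OF ii(1), folded B_def] crossing_relabel[OF \<tau>] crossing_relabel[OF \<sigma>] img val hexvec_def
        crossing_swap[of "Suc (Suc i)" "Suc i"] crossing_swap[of "Suc (Suc i)" i] crossing_swap[of "Suc i" i])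
qed

lemma cross_conj:
  assumes g: "g \<in> carrier G" and k: "k \<in> pure"
  shows "cross (g \<otimes> k \<otimes> inv g) x = cross k (relabel (inv' (perm g)) x)"
proof -
  have kc: "k \<in> carrier G" and pk: "perm k = id" using k by (simp_all add: pure_iff)
  have "perm (g \<otimes> k) = perm g" using perm_mult[OF g kc] pk by simp
  then have "cross (g \<otimes> k \<otimes> inv g) x = cross g x + cross k (relabel (inv' (perm g)) x)
      + cross (inv g) (relabel (inv' (perm g)) x)"
    using cross_mult[of "g \<otimes> k" "inv g" x] cross_mult[OF g kc, of x] g kc by simp
  moreover have "cross g x + cross (inv g) (relabel (inv' (perm g)) x) = 0"
    using cross_mult[OF g inv_closed[OF g], of x] cross_one g by simp
  ultimately show ?thesis by simp
qed

lemma cross_hexagon: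
  assumes i: "1 \<le> i" "i + 2 \<le> n" and g: "g \<in> carrier G"
  shows "cross (hexagon g i) = hexvec (perm g i) (perm g (i + 1)) (perm g (i + 2)) (perm g ` {1..<i})"
  unfolding hexagon_def
  by (rule ext) (simp add: cross_conj[OF g hexagon_word_closed[OF i]] cross_hexagon_word[OF i]
      hexvec_relabel[OF perm_permutes[OF g]])

lemma cross_pure_mult: "a \<in> pure \<Longrightarrow> h \<in> carrier G \<Longrightarrow> cross (a \<otimes> h) x = cross a x + cross h x"
  using cross_mult[of a h x] by (simp add: pure_iff)

lemma cross_pure_inv:
  assumes "a \<in> pure" shows "cross (inv a) x = - cross a x"
proof -
  have "a \<in> carrier G" using assms by (simp add: pure_iff)
  then show ?thesis using cross_pure_mult[OF assms, of "inv a" x] cross_one by simp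
qed

lemma cross_derived:
  assumes "k \<in> derived G pure" shows "cross k x = 0"
proof -
  let ?Z = "{k \<in> pure. \<forall>x. cross k x = 0}"
  note P = subgroup_pure
  have "subgroup ?Z G"
  proof (rule subgroupI)
    show "?Z \<subseteq> carrier G" by (auto simp: pure_iff)
    show "?Z \<noteq> {}" using cross_one subgroup.one_closed[OF P] by auto
    fix a assume a: "a \<in> ?Z"
    then show "inv a \<in> ?Z" using cross_pure_inv subgroup.m_inv_closed[OF P] by simp
    fix b assume "b \<in> ?Z"
    then have b: "b \<in> pure" "\<forall>x. cross b x = 0" by simp_all
    have a': "a \<in> pure" "\<forall>x. cross a x = 0" using a by simp_all
    have "b \<in> carrier G" using b(1) pure_iff by blast
    then have "cross (a \<otimes> b) x = 0" for x using cross_pure_mult[OF a'(1), of b x] a' b by simp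
    then show "a \<otimes> b \<in> ?Z" using subgroup.m_closed[OF P a'(1) b(1)] by simp
  qed
  moreover have "derived_set G pure \<subseteq> ?Z"
  proof
    fix k assume "k \<in> derived_set G pure"
    then obtain a b where ab: "a \<in> pure" "b \<in> pure" "k = a \<otimes> b \<otimes> inv a \<otimes> inv b" by auto
    have inv: "inv a \<in> pure" "inv b \<in> pure" by (rule subgroup.m_inv_closed[OF P]; fact ab)+
    note ab1 = subgroup.m_closed[OF P ab(1,2)]
    note ab2 = subgroup.m_closed[OF P ab1 inv(1)]
    have mul: "k \<in> pure" unfolding ab(3) by (rule subgroup.m_closed[OF P ab2 inv(2)])
    have car: "b \<in> carrier G" "inv a \<in> carrier G" "inv b \<in> carrier G"
      by (rule subgroup.mem_carrier[OF P]; fact)+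
    have "cross k x = 0" for x
      unfolding ab(3) cross_pure_mult[OF ab2 car(3)] cross_pure_mult[OF ab1 car(2)]
        cross_pure_mult[OF ab(1) car(1)] cross_pure_inv[OF ab(1)] cross_pure_inv[OF ab(2)] by simp
    then show "k \<in> ?Z" using mul by simp
  qed
  ultimately have "derived G pure \<subseteq> ?Z" unfolding derived_def by (rule generate_subgroup_incl[rotated])
  then show ?thesis using assms by blast
qed

lemma hexagon_exists:
  assumes "distinct [x, y, z]" "{x, y, z} \<subseteq> {1..n}" "A \<subseteq> {1..n}" "A \<inter> {x, y, z} = {}"
  shows "\<exists>g i. g \<in> carrier G \<and> 1 \<le> i \<and> i + 2 \<le> n \<and> perm g ` {1..<i} = A \<and>
    perm g i = x \<and> perm g (i + 1) = y \<and> perm g (i + 2) = z"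
proof -
  define la where "la = sorted_list_of_set A"
  define lr where "lr = sorted_list_of_set ({1..n} - A - {x, y, z})"
  have finA: "finite A" using assms(3) finite_subset by blast
  have la: "set la = A" "distinct la" using finA by (simp_all add: la_def)
  have lr: "set lr = {1..n} - A - {x, y, z}" "distinct lr" by (simp_all add: lr_def)
  define xs where "xs = la @ [x, y, z] @ lr"
  have xs: "set xs = {1..n}" using la lr assms by (auto simp: xs_def)
  have dxs: "distinct xs" using la lr assms by (auto simp: xs_def)
  have len: "length xs = n" using distinct_card[OF dxs] xs by simp
  obtain p where p: "p permutes {1..n}" "\<And>k. k < n \<Longrightarrow> p (Suc k) = xs ! k"
    using permutes_of_list[OF dxs xs] by blast
  obtain g where g: "g \<in> carrier G" "perm g = p" using perm_surj[OF p(1)] by blast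
  define i where "i = Suc (length la)"
  have i: "i + 2 \<le> n" using len by (simp add: i_def xs_def)
  have "p ` {1..<i} = (\<lambda>k. xs ! k) ` {..<length la}"
  proof -
    have "{1..<i} = Suc ` {..<length la}" 
      unfolding i_def image_Suc_lessThan atLeastLessThanSuc_atLeastAtMost ..
    then show ?thesis using p(2) i by (simp add: image_image i_def)
  qed
  also have "\<dots> = (\<lambda>k. la ! k) ` {..<length la}" by (rule image_cong) (simp_all add: xs_def nth_append)
  also have "\<dots> = A" unfolding la(1)[symmetric] set_conv_nth by auto
  finally have "p ` {1..<i} = A" .
  moreover have "p i = x" "p (i + 1) = y" "p (i + 2) = z"
    using p(2)[of "length la"] p(2)[of "length la + 1"] p(2)[of "length la + 2"] i
    by (simp_all add: i_def xs_def nth_append)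
  ultimately show ?thesis using g i by (intro exI[of _ g] exI[of _ i]) (simp add: i_def)
qed

text \<open>Both the crossing vector and the class modulo commutators of a pure element are given by one
  and the same integral combination of the basic hexagons. So an element whose crossing vector
  vanishes is a product of commutators as soon as the hexagon vectors are independent.\<close>

lemma pure_combination:
  assumes h: "\<And>j. j < d \<Longrightarrow> h j \<in> pure"
    and hex: "\<And>A T. (A, T) \<in> hex_labels n \<Longrightarrow> \<exists>g i. g \<in> carrier G \<and> 1 \<le> i \<and> i + 2 \<le> n \<and>
      perm g ` {1..<i} = A \<and> perm g ` {i..i + 2} = T \<and> (\<exists>j<d. hexagon g i = h j)"
    and k: "k \<in> pure"
  shows "\<exists>c :: nat \<Rightarrow> int. (\<forall>x. cross k x = (\<Sum>j<d. c j * cross (h j) x)) \<and>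
    ((\<forall>j<d. c j = 0) \<longrightarrow> k \<in> derived G pure)"
proof -
  let ?P = "G\<lparr>carrier := pure\<rparr>"
  define D where "D = derived G pure"
  define Q where "Q = ?P Mod D"
  note P = subgroup_pure
  interpret P: group ?P by (rule subgroup_imp_group[OF P])
  have D_eq: "derived ?P (carrier ?P) = D"
    using derived_consistent[OF subset_refl P] by (simp add: D_def)
  interpret Q: comm_group Q
    using P.derived_quot_is_comm_group unfolding D_eq Q_def .
  have D_normal: "D \<lhd> ?P" using P.derived_self_is_normal unfolding D_eq .
  define cls where "cls = (\<lambda>a. D #>\<^bsub>?P\<^esub> a)"
  have cls_hom: "cls \<in> hom ?P Q" unfolding cls_def Q_def by (rule normal.r_coset_hom_Mod[OF D_normal])
  interpret cls: group_hom ?P Q cls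
    using cls_hom P.is_group Q.is_group by (simp add: group_hom_def group_hom_axioms_def)
  have cls_one_iff: "a \<in> D" if "a \<in> pure" "cls a = \<one>\<^bsub>Q\<^esub>" for a
  proof -
    have "a \<in> D #>\<^bsub>?P\<^esub> a" using P.rcos_self[of a D] that(1) normal_imp_subgroup[OF D_normal] by simp
    then show ?thesis using that(2) by (simp add: cls_def Q_def FactGroup_def)
  qed
  have cls_D: "cls a = \<one>\<^bsub>Q\<^esub>" if "a \<in> D" for a
  proof -
    have D: "subgroup D ?P" by (rule normal_imp_subgroup[OF D_normal])
    have "cls a = D"
      unfolding cls_def by (rule P.coset_join2[OF subgroup.mem_carrier[OF D that] D that])
    then show ?thesis by (simp add: Q_def FactGroup_def)
  qed
  have cls_closed: "cls a \<in> carrier Q" if "a \<in> pure" for a using cls.hom_closed[of a] that by simp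
  have cls_mult: "cls (a \<otimes> b) = cls a \<otimes>\<^bsub>Q\<^esub> cls b" if "a \<in> pure" "b \<in> pure" for a b
    using cls.hom_mult[of a b] that by simp
  have cls_h: "cls (h j) \<in> carrier Q" if "j < d" for j using cls_closed[OF h[OF that]] .
  define F where "F = (\<lambda>c :: nat \<Rightarrow> int. finprod Q (\<lambda>j. cls (h j) [^]\<^bsub>Q\<^esub> c j) {..<d})"
  have pow: "(\<lambda>j. cls (h j) [^]\<^bsub>Q\<^esub> c j) \<in> {..<d} \<rightarrow> carrier Q" for c :: "nat \<Rightarrow> int"
    by (simp add: Pi_iff cls_h)
  have F_closed: "F c \<in> carrier Q" for c unfolding F_def by (rule Q.finprod_closed[OF pow])
  have F_add: "F (\<lambda>j. a j + b j) = F a \<otimes>\<^bsub>Q\<^esub> F b" for a b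
    unfolding F_def Q.finprod_multf[OF pow pow, symmetric]
    by (rule Q.finprod_cong'[OF HOL.refl]) (simp_all add: Q.int_pow_mult cls_h Pi_iff)
  have F_zero: "F c = \<one>\<^bsub>Q\<^esub>" if "\<forall>j<d. c j = 0" for c
    unfolding F_def by (rule Q.finprod_one_eqI) (use that in simp)
  have F_unit: "F (\<lambda>m. if j = m then 1 else 0) = cls (h j)" if j: "j < d" for j
  proof -
    have "F (\<lambda>m. if j = m then 1 else 0) = finprod Q (\<lambda>m. if j = m then cls (h m) else \<one>\<^bsub>Q\<^esub>) {..<d}"
      unfolding F_def by (rule Q.finprod_cong'[OF HOL.refl]) (simp_all add: Pi_iff cls_h)
    also have "\<dots> = cls (h j)" by (rule Q.finprod_singleton) (simp_all add: Pi_iff cls_h j)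
    finally show ?thesis .
  qed
  \<comment> \<open>These elements form a subgroup that contains the commutators and the basic hexagons, so it is
    everything.\<close>
  define K where "K = {k \<in> pure. \<exists>c. cls k = F c \<and> (\<forall>x. cross k x = (\<Sum>j<d. c j * cross (h j) x))}"
  have "subgroup K G"
  proof (rule subgroupI)
    show "K \<subseteq> carrier G" by (auto simp: K_def pure_iff)
    have "\<one> \<in> K"
      unfolding K_def using subgroup.one_closed[OF P] cross_one cls.hom_one F_zero[of "\<lambda>_. 0"]
      by (auto intro!: exI[of _ "\<lambda>_. 0"])
    then show "K \<noteq> {}" by blast
    fix a assume "a \<in> K"
    then obtain ca where a: "a \<in> pure" "cls a = F ca" "\<forall>x. cross a x = (\<Sum>j<d. ca j * cross (h j) x)"
      by (auto simp: K_def)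
    have ia: "inv a \<in> pure" using subgroup.m_inv_closed[OF P a(1)] .
    have ac: "a \<in> carrier G" using a(1) pure_iff by simp
    have "F (\<lambda>j. - ca j) \<otimes>\<^bsub>Q\<^esub> F ca = \<one>\<^bsub>Q\<^esub>"
      unfolding F_add[symmetric] by (rule F_zero) simp
    then have 1: "inv\<^bsub>Q\<^esub> F ca = F (\<lambda>j. - ca j)" using F_closed by (intro Q.inv_equality) auto
    have "cls (inv a) \<otimes>\<^bsub>Q\<^esub> cls a = \<one>\<^bsub>Q\<^esub>"
      using cls_mult[OF ia a(1)] cls.hom_one ac by simp
    then have "inv\<^bsub>Q\<^esub> cls a = cls (inv a)" using cls_closed a(1) ia by (intro Q.inv_equality) auto
    then have "cls (inv a) = F (\<lambda>j. - ca j)" using 1 a(2) by simp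
    then show "inv a \<in> K"
      unfolding K_def using ia a(3) cross_pure_inv[OF a(1)]
      by (auto intro!: exI[of _ "\<lambda>j. - ca j"] simp: sum_negf)
    fix b assume "b \<in> K"
    then obtain cb where b: "b \<in> pure" "cls b = F cb" "\<forall>x. cross b x = (\<Sum>j<d. cb j * cross (h j) x)"
      by (auto simp: K_def)
    have bc: "b \<in> carrier G" using b(1) pure_iff by simp
    have "cls (a \<otimes> b) = F (\<lambda>j. ca j + cb j)" using cls_mult[OF a(1) b(1)] a(2) b(2) F_add by simp
    then show "a \<otimes> b \<in> K"
      unfolding K_def using subgroup.m_closed[OF P a(1) b(1)] a(3) b(3) cross_pure_mult[OF a(1) bc]
      by (auto intro!: exI[of _ "\<lambda>j. ca j + cb j"] simp: sum.distrib distrib_right)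
  qed
  moreover have "derived G pure \<subseteq> K"
  proof
    fix a assume a: "a \<in> derived G pure"
    have "a \<in> pure" using derived_incl[OF subset_refl P] a by blast
    moreover have "cls a = F (\<lambda>_. 0)" using cls_D[of a] a F_zero[of "\<lambda>_. 0"] by (simp add: D_def)
    ultimately show "a \<in> K"
      unfolding K_def using cross_derived[OF a] by (auto intro!: exI[of _ "\<lambda>_. 0"])
  qed
  moreover have "K \<subseteq> pure" by (auto simp: K_def)
  moreover have hK: "h j \<in> K" if j: "j < d" for j
  proof -
    have "cross (h j) x = (\<Sum>m<d. (if j = m then 1 else 0) * cross (h m) x)" for x
    proof -
      have "(\<Sum>m<d. (if j = m then 1 else 0) * cross (h m) x) = (\<Sum>m<d. if j = m then cross (h m) x else 0)"
        by (rule sum.cong) auto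
      then show ?thesis using j by simp
    qed
    then show ?thesis unfolding K_def using h[OF j] F_unit[OF j, symmetric] by blast
  qed
  have "\<exists>g i. g \<in> carrier G \<and> 1 \<le> i \<and> i + 2 \<le> n \<and> perm g ` {1..<i} = A \<and>
      perm g ` {i..i + 2} = T \<and> hexagon g i \<in> K" if "(A, T) \<in> hex_labels n" for A T
    using hex[OF that] hK by metis
  ultimately have "pure \<subseteq> K" by (rule pure_subset_if_hexagons)
  then obtain c where c: "cls k = F c" "\<forall>x. cross k x = (\<Sum>j<d. c j * cross (h j) x)"
    using k by (auto simp: K_def)
  have "k \<in> derived G pure" if "\<forall>j<d. c j = 0"
    using cls_one_iff[OF k] c(1) F_zero[OF that] by (simp add: D_def)
  then show ?thesis using c(2) by blast
qed

text \<open>A permutation that fixes every crossing vector fixes in particular the hexagons with a single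
  label on their left, and the crossings of such a hexagon reveal that label.\<close>

lemma perm_fixing_crossings:
  assumes n: "n \<ge> 4" and g: "g \<in> carrier G"
    and fix_cross: "\<And>k x. k \<in> pure \<Longrightarrow> x \<in> crossing_coords n \<Longrightarrow> cross k (relabel (perm g) x) = cross k x"
  shows "perm g = id"
proof
  fix w
  show "perm g w = id w"
  proof (cases "w \<in> {1..n}")
    case False
    then show ?thesis using permutes_not_in[OF perm_permutes[OF g]] by simp
  next
    case True
    have "card ({1..n} - {w}) \<ge> 3" using True n by simp
    then obtain U where U: "U \<subseteq> {1..n} - {w}" "card U = 3" by (meson obtain_subset_with_card_n)
    then obtain x y z where xyz: "U = {x, y, z}" "x \<noteq> y" "y \<noteq> z" "x \<noteq> z" by (auto simp: card_3_iff)
    have "\<exists>g' i. g' \<in> carrier G \<and> 1 \<le> i \<and> i + 2 \<le> n \<and> perm g' ` {1..<i} = {w} \<and>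
      perm g' i = x \<and> perm g' (i + 1) = y \<and> perm g' (i + 2) = z"
      by (rule hexagon_exists) (use xyz U True in auto)
    then obtain g' i where g': "g' \<in> carrier G" "1 \<le> i" "i + 2 \<le> n" "perm g' ` {1..<i} = {w}"
      "perm g' i = x" "perm g' (i + 1) = y" "perm g' (i + 2) = z" by blast
    have cross_h: "cross (hexagon g' i) = hexvec x y z {w}"
      using cross_hexagon[OF g'(2,3,1)] g'(4-7) by simp
    \<comment> \<open>The only crossings of this hexagon with a single label on the left have \<open>w\<close> on the left.\<close>
    let ?c = "(x, y, {w})"
    have c: "?c \<in> crossing_coords n" using xyz U True by (auto simp: crossing_coords_def)
    have "hexvec x y z {w} ?c = -1"
      using xyz U by (auto simp: hexvec_def crossing_def)
    then have "hexvec x y z {w} (perm g x, perm g y, {perm g w}) \<noteq> 0"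
      using fix_cross[OF hexagon_pure[OF g'(2,3,1)] c] by (simp add: cross_h relabel_def)
    from hexvec_nonzeroD[OF this]
    have "{perm g w} = {w} \<or> (\<exists>r. {x, y, z} = {perm g x, perm g y, r} \<and> {perm g w} = {r, w})" by simp
    then show ?thesis by auto
  qed
qed

text \<open>The crossing vectors of the basic hexagons are independent and the basic hexagons generate the kernel modulo
  commutators. So they are a basis of the abelianized kernel, on which \<open>cross\<close> is injective, and the
  criterion for integral cocycles applies with the pure elements as translations.\<close>

theorem crystallographic_mod_derived_pure:
  assumes n: "n \<ge> 4"
  shows "crystallographic_group (card (hex_labels n)) (G Mod derived G pure)"
proof -
  define d where "d = card (hex_labels n)"
  have "\<forall>\<iota>\<in>hex_labels n. \<exists>g i. g \<in> carrier G \<and> 1 \<le> i \<and> i + 2 \<le> n \<and> perm g ` {1..<i} = fst \<iota> \<and>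
      perm g ` {i..i + 2} = snd \<iota>"
  proof
    fix \<iota> assume \<iota>: "\<iota> \<in> hex_labels n"
    obtain A T where e: "\<iota> = (A, T)" by (cases \<iota>)
    have AT: "A \<subseteq> {1..n}" "T \<subseteq> {1..n}" "A \<inter> T = {}" "card T = 3" using \<iota> by (auto simp: e hex_labels_def)
    obtain x y z where xyz: "T = {x, y, z}" "x \<noteq> y" "y \<noteq> z" "x \<noteq> z" using AT(4) by (auto simp: card_3_iff)
    have "\<exists>g i. g \<in> carrier G \<and> 1 \<le> i \<and> i + 2 \<le> n \<and> perm g ` {1..<i} = A \<and>
      perm g i = x \<and> perm g (i + 1) = y \<and> perm g (i + 2) = z"
      by (rule hexagon_exists) (use xyz AT in auto)
    then obtain g i where g: "g \<in> carrier G" "1 \<le> i" "i + 2 \<le> n" "perm g ` {1..<i} = A"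
      "perm g i = x" "perm g (i + 1) = y" "perm g (i + 2) = z" by blast
    have "{i..i + 2} = {i, i + 1, i + 2}" by auto
    then have "perm g ` {i..i + 2} = T" using g(5-7) xyz(1) by simp
    then show "\<exists>g i. g \<in> carrier G \<and> 1 \<le> i \<and> i + 2 \<le> n \<and> perm g ` {1..<i} = fst \<iota> \<and>
      perm g ` {i..i + 2} = snd \<iota>" using g e by auto
  qed
  then obtain gg ii where gi: "\<And>\<iota>. \<iota> \<in> hex_labels n \<Longrightarrow> gg \<iota> \<in> carrier G \<and> 1 \<le> ii \<iota> \<and> ii \<iota> + 2 \<le> n \<and>
      perm (gg \<iota>) ` {1..<ii \<iota>} = fst \<iota> \<and> perm (gg \<iota>) ` {ii \<iota>..ii \<iota> + 2} = snd \<iota>"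
    by metis
  define H where "H = (\<lambda>\<iota>. hexagon (gg \<iota>) (ii \<iota>))"
  have H_pure: "H \<iota> \<in> pure" if "\<iota> \<in> hex_labels n" for \<iota>
    unfolding H_def using gi[OF that] by (intro hexagon_pure) auto
  obtain e where e: "bij_betw e {..<d} (hex_labels n)"
    using ex_bij_betw_nat_finite[OF finite_hex_labels[of n]] by (auto simp: d_def lessThan_atLeast0)
  have e_mem: "e j \<in> hex_labels n" if "j < d" for j using e that by (auto simp: bij_betw_def)
  define b where "b = (\<lambda>j. cross (H (e j)))"
  have combo: "\<exists>c :: nat \<Rightarrow> int. (\<forall>x. cross k x = (\<Sum>j<d. c j * b j x)) \<and>
      ((\<forall>j<d. c j = 0) \<longrightarrow> k \<in> derived G pure)" if "k \<in> pure" for k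
    unfolding b_def
  proof (rule pure_combination[OF _ _ that])
    fix A T assume AT: "(A, T) \<in> hex_labels n"
    have "(A, T) \<in> e ` {..<d}" using AT bij_betw_imp_surj_on[OF e] by simp
    then obtain j where "j < d" "e j = (A, T)" by auto
    then show "\<exists>g i. g \<in> carrier G \<and> 1 \<le> i \<and> i + 2 \<le> n \<and> perm g ` {1..<i} = A \<and>
        perm g ` {i..i + 2} = T \<and> (\<exists>j<d. hexagon g i = H (e j))"
      using gi[OF AT] unfolding H_def fst_conv snd_conv by metis
  qed (use H_pure e_mem in auto)
  have indep: "\<forall>j<d. c j = 0" if zero: "\<forall>x\<in>crossing_coords n. (\<Sum>j<d. c j * real_of_int (b j x)) = 0" for c
  proof (intro allI impI)
    fix j assume j: "j < d"
    define c' where "c' = (\<lambda>\<iota>. c (inv_into {..<d} e \<iota>))"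
    have c': "c' (e m) = c m" if "m < d" for m
      unfolding c'_def using bij_betw_inv_into_left[OF e] that by simp
    obtain A T where AT: "e j = (A, T)" by (cases "e j")
    have "c' (A, T) = 0"
    proof (rule hexvec_independent[where hx = "\<lambda>\<iota>. cross (H \<iota>)"])
      show "(A, T) \<in> hex_labels n" using e_mem[OF j] AT by simp
    next
      fix x assume x: "x \<in> crossing_coords n"
      have "(\<Sum>\<iota>\<in>hex_labels n. c' \<iota> * real_of_int (cross (H \<iota>) x)) = (\<Sum>j<d. c' (e j) * real_of_int (b j x))"
        unfolding b_def by (rule sum.reindex_bij_betw[OF e, symmetric])
      also have "\<dots> = (\<Sum>j<d. c j * real_of_int (b j x))" by (rule sum.cong) (simp_all add: c')
      finally show "(\<Sum>\<iota>\<in>hex_labels n. c' \<iota> * real_of_int (cross (H \<iota>) x)) = 0" using zero x by simp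
    next
      fix A T assume AT: "(A, T) \<in> hex_labels n"
      let ?g = "gg (A, T)" and ?i = "ii (A, T)"
      have g: "?g \<in> carrier G" "1 \<le> ?i" "?i + 2 \<le> n" "perm ?g ` {1..<?i} = A" "perm ?g ` {?i..?i + 2} = T"
        using gi[OF AT] by auto
      have "{?i..?i + 2} = {?i, ?i + 1, ?i + 2}" by auto
      then have "T = {perm ?g ?i, perm ?g (?i + 1), perm ?g (?i + 2)}" using g(5) by auto
      then show "\<exists>x y z. T = {x, y, z} \<and> cross (H (A, T)) = hexvec x y z A"
        unfolding H_def using cross_hexagon[OF g(2,3,1)] g(4) by metis
    qed
    then show "c j = 0" using c'[OF j] AT by simp
  qed
  have pure_char: "pure = {g \<in> carrier G. \<forall>x\<in>crossing_coords n. relabel (perm g) x = x}"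
  proof (intro equalityI subsetI)
    fix g assume "g \<in> {g \<in> carrier G. \<forall>x\<in>crossing_coords n. relabel (perm g) x = x}"
    then have g: "g \<in> carrier G" and f: "\<And>x. x \<in> crossing_coords n \<Longrightarrow> relabel (perm g) x = x" by auto
    have "perm g w = w" for w
    proof (cases "w \<in> {1..n}")
      case True
      then show ?thesis using f[of "(w, w, {})"] by (simp add: crossing_coords_def relabel_def)
    next
      case False
      then show ?thesis using permutes_not_in[OF perm_permutes[OF g]] by blast
    qed
    then show "g \<in> pure" using g by (simp add: pure_iff fun_eq_iff)
  qed (simp add: pure_iff)
  interpret L: lattice_action G "crossing_coords n" "\<lambda>g. relabel (perm g)" cross d b pure
  proof
    show "finite (crossing_coords n)" by (rule finite_crossing_coords)
    show "bij_betw (relabel (perm g)) (crossing_coords n) (crossing_coords n)" if "g \<in> carrier G" for g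
      by (rule bij_betw_relabel[OF perm_permutes[OF that]])
    show "relabel (perm (g \<otimes> h)) x = relabel (perm g) (relabel (perm h) x)"
      if "g \<in> carrier G" "h \<in> carrier G" for g h x
      using perm_mult[OF that] relabel_comp by simp
    show "cross (g \<otimes> h) x = cross g x + cross h (relabel (perm (inv g)) x)"
      if g: "g \<in> carrier G" and h: "h \<in> carrier G" for g h x
    proof -
      have "perm (inv g) = inv' (perm g)"
        using perm.hom_inv[OF g] sym_group_inv_equality[of "perm g" n] perm.hom_closed[OF g] by simp
      then show ?thesis using cross_mult[OF g h] by simp
    qed
    show "pure = {g \<in> carrier G. \<forall>x\<in>crossing_coords n. relabel (perm g) x = x}" by (rule pure_char)
    show "\<exists>c. \<forall>x\<in>crossing_coords n. cross t x = (\<Sum>j<d. c j * b j x)" if "t \<in> pure" for t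
      using combo[OF that] by blast
    show "\<exists>t\<in>pure. \<forall>x\<in>crossing_coords n. cross t x = b j x" if "j < d" for j
      using H_pure[OF e_mem[OF that]] by (auto simp: b_def)
    show "\<forall>c. (\<forall>x\<in>crossing_coords n. (\<Sum>j<d. c j * real_of_int (b j x)) = 0) \<longrightarrow> (\<forall>j<d. c j = 0)"
      using indep by blast
    show "g \<in> pure" if g: "g \<in> carrier G"
      and inv: "\<And>j x. j < d \<Longrightarrow> x \<in> crossing_coords n \<Longrightarrow> b j (relabel (perm g) x) = b j x" for g
    proof -
      have "cross k (relabel (perm g) x) = cross k x" if k: "k \<in> pure" and x: "x \<in> crossing_coords n" for k x
      proof -
        obtain c where c: "\<forall>x. cross k x = (\<Sum>j<d. c j * b j x)" using combo[OF k] by blast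
        have "cross k (relabel (perm g) x) = (\<Sum>j<d. c j * b j (relabel (perm g) x))" using c by blast
        also have "\<dots> = (\<Sum>j<d. c j * b j x)" by (rule sum.cong) (simp_all add: inv x)
        also have "\<dots> = cross k x" by (rule c[rule_format, symmetric])
        finally show ?thesis .
      qed
      then have "perm g = id" by (rule perm_fixing_crossings[OF n g])
      then show ?thesis using g by (simp add: pure_iff)
    qed
  qed
  have "L.translation_kernel = derived G pure"
  proof (intro equalityI subsetI)
    fix t assume "t \<in> L.translation_kernel"
    then have t: "t \<in> pure" and z: "\<forall>x\<in>crossing_coords n. cross t x = 0"
      by (auto simp: L.translation_kernel_def)
    obtain c where c: "\<forall>x. cross t x = (\<Sum>j<d. c j * b j x)" "(\<forall>j<d. c j = 0) \<longrightarrow> t \<in> derived G pure"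
      using combo[OF t] by blast
    have "\<forall>x\<in>crossing_coords n. (\<Sum>j<d. real_of_int (c j) * real_of_int (b j x)) = 0"
    proof
      fix x assume "x \<in> crossing_coords n"
      then have "cross t x = 0" using z by blast
      then have "real_of_int (\<Sum>j<d. c j * b j x) = 0" using c(1)[rule_format, of x] by simp
      then show "(\<Sum>j<d. real_of_int (c j) * real_of_int (b j x)) = 0" by simp
    qed
    from indep[OF this] have "\<forall>j<d. c j = 0" by simp
    then show "t \<in> derived G pure" using c(2) by blast
  next
    fix t assume t: "t \<in> derived G pure"
    then have "t \<in> pure" using derived_incl[OF subset_refl subgroup_pure] by blast
    then show "t \<in> L.translation_kernel" using cross_derived[OF t] by (simp add: L.translation_kernel_def)
  qed
  then show ?thesis using L.crystallographic by (simp add: d_def)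
qed

end

section \<open>The twin group\<close>

text \<open>The semidirect product of integer functions on the crossing coordinates with the symmetric
  group, which permutes the labels.\<close>

definition crossing_group :: "nat \<Rightarrow> ((nat \<times> nat \<times> nat set \<Rightarrow> int) \<times> (nat \<Rightarrow> nat)) monoid" where
  "crossing_group n =
     \<lparr>carrier = UNIV \<times> {p. p permutes {1..n}},
      mult = (\<lambda>(f, p) (g, q). (\<lambda>x. f x + g (relabel (inv' p) x), p \<circ> q)),
      one = (\<lambda>_. 0, id)\<rparr>"

lemma group_crossing_group: "group (crossing_group n)"
proof (rule groupI)
  let ?C = "crossing_group n"
  show "\<one>\<^bsub>?C\<^esub> \<in> carrier ?C" by (simp add: crossing_group_def permutes_id)
  fix a assume a: "a \<in> carrier ?C"
  obtain f p where ae: "a = (f, p)" by (cases a)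
  have p: "p permutes {1..n}" using a by (simp add: ae crossing_group_def)
  show "\<one>\<^bsub>?C\<^esub> \<otimes>\<^bsub>?C\<^esub> a = a" by (simp add: ae crossing_group_def)
  show "\<exists>b\<in>carrier ?C. b \<otimes>\<^bsub>?C\<^esub> a = \<one>\<^bsub>?C\<^esub>"
  proof
    show "(\<lambda>x. - f (relabel p x), inv' p) \<in> carrier ?C"
      using permutes_inv[OF p] by (simp add: crossing_group_def)
    show "(\<lambda>x. - f (relabel p x), inv' p) \<otimes>\<^bsub>?C\<^esub> a = \<one>\<^bsub>?C\<^esub>"
      using permutes_inv_inv[OF p] permutes_inv_o[OF p] by (simp add: ae crossing_group_def)
  qed
  fix b assume b: "b \<in> carrier ?C"
  obtain g q where be: "b = (g, q)" by (cases b)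
  have q: "q permutes {1..n}" using b by (simp add: be crossing_group_def)
  show "a \<otimes>\<^bsub>?C\<^esub> b \<in> carrier ?C"
    using permutes_compose[OF q p] by (simp add: ae be crossing_group_def)
  fix c assume c: "c \<in> carrier ?C"
  obtain h r where ce: "c = (h, r)" by (cases c)
  have "inv' (p \<circ> q) = inv' q \<circ> inv' p" using p q by (intro o_inv_distrib permutes_bij)
  then show "a \<otimes>\<^bsub>?C\<^esub> b \<otimes>\<^bsub>?C\<^esub> c = a \<otimes>\<^bsub>?C\<^esub> (b \<otimes>\<^bsub>?C\<^esub> c)"
    by (simp add: ae be ce crossing_group_def relabel_comp comp_assoc add.assoc)
qed

definition twin_gen :: "nat \<Rightarrow> nat \<Rightarrow> nat gword set" where
  "twin_gen n i = word_class {1..n - 1} (twin_relations n) [(i, True)]"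

definition crossing_gen :: "nat \<Rightarrow> (nat \<times> nat \<times> nat set \<Rightarrow> int) \<times> (nat \<Rightarrow> nat)" where
  "crossing_gen i = (crossing i (Suc i) {1..<i}, Transposition.transpose i (Suc i))"

definition twin_crossing :: "nat \<Rightarrow> nat gword set \<Rightarrow> nat \<times> nat \<times> nat set \<Rightarrow> int" where
  "twin_crossing n g = fst (presented_hom (crossing_group n) crossing_gen g)"

text \<open>Crossing twice cancels, and crossings at positions with a gap between them do not see each
  other, because only the set of labels on the left is recorded.\<close>

lemma crossing_gen_square:
  "crossing_gen i \<otimes>\<^bsub>crossing_group n\<^esub> crossing_gen i = \<one>\<^bsub>crossing_group n\<^esub>"
proof -
  let ?t = "Transposition.transpose i (Suc i)"
  have t: "?t permutes {i, Suc i}" by (rule permutes_swap_id) auto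
  have img: "?t ` {1..<i} = {1..<i}" by (auto simp: Transposition.transpose_def image_iff)
  have "crossing i (Suc i) {1..<i} (relabel (inv' ?t) x) = - crossing i (Suc i) {1..<i} x" for x
    using crossing_relabel[OF t, of i "Suc i" "{1..<i}" x] img crossing_swap[of "Suc i" i "{1..<i}" x] by simp
  then show ?thesis by (simp add: crossing_gen_def crossing_group_def)
qed

lemma crossing_gen_commute:
  assumes "1 \<le> i" "i + 2 \<le> j"
  shows "crossing_gen i \<otimes>\<^bsub>crossing_group n\<^esub> crossing_gen j = crossing_gen j \<otimes>\<^bsub>crossing_group n\<^esub> crossing_gen i"
proof -
  let ?t = "Transposition.transpose i (Suc i)" and ?u = "Transposition.transpose j (Suc j)"
  have t: "?t permutes {1..<j}" by (rule permutes_swap_id) (use assms in auto)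
  have u: "?u permutes {j, Suc j}" by (rule permutes_swap_id) auto
  have val: "?t j = j" "?t (Suc j) = Suc j" "?u i = i" "?u (Suc i) = Suc i"
    using assms by (simp_all add: Transposition.transpose_def)
  have img: "?u ` {1..<i} = {1..<i}" using assms by (auto simp: Transposition.transpose_def image_iff)
  have 1: "crossing j (Suc j) {1..<j} (relabel (inv' ?t) x) = crossing j (Suc j) {1..<j} x" for x
    unfolding crossing_relabel[OF t] permutes_image[OF t] val ..
  have 2: "crossing i (Suc i) {1..<i} (relabel (inv' ?u) x) = crossing i (Suc i) {1..<i} x" for x
    unfolding crossing_relabel[OF u] img val ..
  have "?t \<circ> ?u = ?u \<circ> ?t" using assms by (auto simp: fun_eq_iff Transposition.transpose_def)
  then show ?thesis unfolding crossing_gen_def crossing_group_def by (simp only: monoid.select_convs prod.case 1 2 add.commute)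
qed

lemma twin_range: "{1..n - 1} = {1..<n}" for n :: nat
  by auto

lemma (in group) twin_relations_respected:
  assumes f: "f \<in> {1..<n} \<rightarrow> carrier G"
    and square: "\<And>i. i \<in> {1..<n} \<Longrightarrow> f i \<otimes> f i = \<one>"
    and commute: "\<And>i j. i \<in> {1..<n} \<Longrightarrow> j \<in> {1..<n} \<Longrightarrow> i + 2 \<le> j \<Longrightarrow> f i \<otimes> f j = f j \<otimes> f i"
  shows "\<forall>(u, v) \<in> twin_relations n. word_eval G f u = word_eval G f v"
proof -
  have closed: "f i \<in> carrier G" if "i \<in> {1..<n}" for i using f that by blast
  have "f i \<otimes> f j = f j \<otimes> f i" if "i \<in> {1..<n}" "j \<in> {1..<n}" "\<bar>int i - int j\<bar> \<ge> 2" for i j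
  proof (cases "i \<le> j")
    case True
    then show ?thesis using commute[OF that(1,2)] that(3) by simp
  next
    case False
    then show ?thesis using commute[OF that(2,1)] that(3) by simp
  qed
  then show ?thesis
    unfolding twin_relations_def twin_range using closed square by (auto simp: word_eval_def)
qed

lemma twin_gen_relation:
  assumes "(u, v) \<in> twin_relations n"
  shows "word_class {1..n - 1} (twin_relations n) u = word_class {1..n - 1} (twin_relations n) v"
proof (rule equiv_class_eq[OF equiv_pres_rel pres_rel.relation[OF assms]])
  show "u \<in> gwords {1..n - 1}" "v \<in> gwords {1..n - 1}"
    using assms by (auto simp: twin_relations_def gwords_def)
qed

lemma twin_gen_mult:
  assumes "i \<in> {1..<n}" "j \<in> {1..<n}"
  shows "twin_gen n i \<otimes>\<^bsub>twin_group n\<^esub> twin_gen n j =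
    word_class {1..n - 1} (twin_relations n) [(i, True), (j, True)]"
  unfolding twin_gen_def twin_group_def using assms
  by (subst mult_word_class) (auto simp: gwords_def)

lemma twin_perm_hom: "twin_perm n \<in> hom (twin_group n) (sym_group n)"
  and twin_perm_gen: "i \<in> {1..<n} \<Longrightarrow> twin_perm n (twin_gen n i) = Transposition.transpose i (Suc i)"
proof -
  interpret S: group "sym_group n" by (rule sym_group_is_group)
  let ?f = "\<lambda>i. Transposition.transpose i (i + 1)"
  have f: "?f \<in> {1..<n} \<rightarrow> carrier (sym_group n)"
  proof
    fix i assume "i \<in> {1..<n}"
    then have "?f i permutes {1..n}" by (intro permutes_swap_id) auto
    then show "?f i \<in> carrier (sym_group n)" by (simp add: sym_group_carrier)
  qed
  have R: "\<forall>(u, v) \<in> twin_relations n. word_eval (sym_group n) ?f u = word_eval (sym_group n) ?f v"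
    by (rule S.twin_relations_respected[OF f])
      (auto simp: sym_group_mult sym_group_one fun_eq_iff Transposition.transpose_def)
  show "twin_perm n \<in> hom (twin_group n) (sym_group n)"
    unfolding twin_perm_def twin_group_def twin_range by (rule S.presented_hom_hom[OF f R])
  show "twin_perm n (twin_gen n i) = Transposition.transpose i (Suc i)" if "i \<in> {1..<n}"
    unfolding twin_perm_def twin_gen_def twin_range using S.presented_hom_gen[OF f R that] by simp
qed

lemma twin_gen_closed: "i \<in> {1..<n} \<Longrightarrow> twin_gen n i \<in> carrier (twin_group n)"
  unfolding twin_gen_def twin_group_def by (rule word_class_in_carrier) (auto simp: gwords_def)

lemma twin_gen_square:
  assumes "i \<in> {1..<n}"
  shows "twin_gen n i \<otimes>\<^bsub>twin_group n\<^esub> twin_gen n i = \<one>\<^bsub>twin_group n\<^esub>"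
proof -
  have "([(i, True), (i, True)], []) \<in> twin_relations n"
    unfolding twin_relations_def twin_range using assms by blast
  then have "word_class {1..n - 1} (twin_relations n) [(i, True), (i, True)]
      = word_class {1..n - 1} (twin_relations n) []" by (rule twin_gen_relation)
  then show ?thesis
    unfolding twin_gen_mult[OF assms assms] by (simp add: twin_group_def presented_group_def)
qed

lemma adjacent_lift_twin_group: "adjacent_lift (twin_group n) n (twin_gen n) (twin_perm n)"
proof -
  let ?T = "twin_group n"
  interpret T: group ?T unfolding twin_group_def by (rule group_presented_group)
  show ?thesis
  proof
    show "twin_gen n i \<in> carrier ?T" if "i \<in> {1..<n}" for i using that by (rule twin_gen_closed)
    show "twin_gen n i \<otimes>\<^bsub>?T\<^esub> twin_gen n i = \<one>\<^bsub>?T\<^esub>" if "i \<in> {1..<n}" for i using that by (rule twin_gen_square)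
    show "twin_gen n i \<otimes>\<^bsub>?T\<^esub> twin_gen n j = twin_gen n j \<otimes>\<^bsub>?T\<^esub> twin_gen n i"
      if ij: "i \<in> {1..<n}" "j \<in> {1..<n}" "i + 2 \<le> j" for i j
    proof -
      have "([(i, True), (j, True)], [(j, True), (i, True)]) \<in> twin_relations n"
        unfolding twin_relations_def twin_range using ij by auto
      then show ?thesis
        unfolding twin_gen_mult[OF ij(1,2)] twin_gen_mult[OF ij(2,1)] by (rule twin_gen_relation)
    qed
    show "twin_perm n \<in> hom ?T (sym_group n)" by (rule twin_perm_hom)
    show "twin_perm n (twin_gen n i) = Transposition.transpose i (Suc i)" if "i \<in> {1..<n}" for i
      using that by (rule twin_perm_gen)
    show "\<exists>xs. set xs \<subseteq> {1..<n} \<and> g = foldr (\<lambda>i y. twin_gen n i \<otimes>\<^bsub>?T\<^esub> y) xs \<one>\<^bsub>?T\<^esub>"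
      if "g \<in> carrier ?T" for g
      using that unfolding twin_group_def
    proof (induction g rule: presented_group_induct)
      case one
      show ?case by (rule exI[of _ "[]"]) simp
    next
      case (gen i g)
      then obtain xs where "set xs \<subseteq> {1..<n}"
        "g = foldr (\<lambda>i y. twin_gen n i \<otimes>\<^bsub>twin_group n\<^esub> y) xs \<one>\<^bsub>twin_group n\<^esub>"
        by (auto simp: twin_group_def)
      then show ?case using gen(1)
        by (intro exI[of _ "i # xs"]) (auto simp: twin_gen_def twin_group_def)
    next
      case (inv i g)
      have i: "i \<in> {1..<n}" using inv(1) twin_range by blast
      then have "inv\<^bsub>?T\<^esub> (twin_gen n i) = twin_gen n i"
        using twin_gen_square[OF i] twin_gen_closed[OF i] by (intro T.inv_equality)
      moreover obtain xs where "set xs \<subseteq> {1..<n}"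
        "g = foldr (\<lambda>i y. twin_gen n i \<otimes>\<^bsub>twin_group n\<^esub> y) xs \<one>\<^bsub>twin_group n\<^esub>"
        using inv by (auto simp: twin_group_def)
      ultimately show ?case using i
        by (intro exI[of _ "i # xs"]) (auto simp: twin_gen_def twin_group_def)
    qed
  qed
qed

text \<open>The crossing cocycle comes from a homomorphism to the semidirect product, whose second component
  agrees with the permutation because both are determined on the generators.\<close>

lemma crossing_lift_twin_group:
  "crossing_lift (twin_group n) n (twin_gen n) (twin_perm n) (twin_crossing n)"
proof -
  let ?T = "twin_group n" and ?C = "crossing_group n"
  define \<phi> where "\<phi> = presented_hom ?C crossing_gen"
  interpret T: adjacent_lift ?T n "twin_gen n" "twin_perm n" by (rule adjacent_lift_twin_group)
  interpret C: group ?C by (rule group_crossing_group)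
  have f: "crossing_gen \<in> {1..<n} \<rightarrow> carrier ?C"
  proof
    fix i assume "i \<in> {1..<n}"
    then have "Transposition.transpose i (Suc i) permutes {1..n}" by (intro permutes_swap_id) auto
    then show "crossing_gen i \<in> carrier ?C" by (simp add: crossing_gen_def crossing_group_def)
  qed
  have R: "\<forall>(u, v) \<in> twin_relations n. word_eval ?C crossing_gen u = word_eval ?C crossing_gen v"
    by (rule C.twin_relations_respected[OF f]) (rule crossing_gen_square, rule crossing_gen_commute, auto)
  have \<phi>_hom: "\<phi> \<in> hom ?T ?C"
    unfolding \<phi>_def twin_group_def twin_range by (rule C.presented_hom_hom[OF f R])
  have \<phi>_gen: "\<phi> (twin_gen n i) = crossing_gen i" if "i \<in> {1..<n}" for i
    unfolding \<phi>_def twin_gen_def twin_range by (rule C.presented_hom_gen[OF f R that])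
  interpret \<phi>: group_hom ?T ?C \<phi>
    using \<phi>_hom T.is_group C.is_group by (simp add: group_hom_def group_hom_axioms_def)
  have snd_mult: "snd (a \<otimes>\<^bsub>?C\<^esub> b) = snd a \<circ> snd b" for a b
    by (cases a; cases b) (simp add: crossing_group_def)
  have fst_mult: "fst (a \<otimes>\<^bsub>?C\<^esub> b) x = fst a x + fst b (relabel (inv' (snd a)) x)" for a b x
    by (cases a; cases b) (simp add: crossing_group_def)
  have snd_\<phi>_word: "snd (\<phi> (T.sword xs)) = twin_perm n (T.sword xs)" if "set xs \<subseteq> {1..<n}" for xs
    using that
  proof (induction xs)
    case Nil
    have "snd (\<phi> \<one>\<^bsub>?T\<^esub>) = id" using \<phi>.hom_one by (simp add: crossing_group_def)
    then show ?case using T.perm_one by simp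
  next
    case (Cons i xs)
    have i: "i \<in> {1..<n}" and xs: "set xs \<subseteq> {1..<n}" using Cons.prems by auto
    have "\<phi> (T.sword (i # xs)) = crossing_gen i \<otimes>\<^bsub>?C\<^esub> \<phi> (T.sword xs)"
      unfolding T.sword_Cons \<phi>.hom_mult[OF twin_gen_closed[OF i] T.sword_closed[OF xs]] \<phi>_gen[OF i] ..
    then have "snd (\<phi> (T.sword (i # xs))) = Transposition.transpose i (Suc i) \<circ> twin_perm n (T.sword xs)"
      using Cons.IH[OF xs] by (simp only: snd_mult) (simp add: crossing_gen_def)
    also have "\<dots> = twin_perm n (T.sword (i # xs))"
      unfolding T.sword_Cons T.perm_mult[OF twin_gen_closed[OF i] T.sword_closed[OF xs]] twin_perm_gen[OF i] ..
    finally show ?case .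
  qed
  have snd_\<phi>: "snd (\<phi> g) = twin_perm n g" if "g \<in> carrier ?T" for g
    using T.sword_surj[OF that] snd_\<phi>_word by blast
  show ?thesis
  proof
    show "twin_crossing n (g \<otimes>\<^bsub>?T\<^esub> h) x = twin_crossing n g x + twin_crossing n h (relabel (inv' (twin_perm n g)) x)"
      if "g \<in> carrier ?T" "h \<in> carrier ?T" for g h x
      unfolding twin_crossing_def \<phi>_def[symmetric] \<phi>.hom_mult[OF that] fst_mult snd_\<phi>[OF that(1)] ..
    show "twin_crossing n (twin_gen n i) = crossing i (Suc i) {1..<i}" if "i \<in> {1..<n}" for i
      unfolding twin_crossing_def \<phi>_def[symmetric] \<phi>_gen[OF that] by (simp add: crossing_gen_def)
  qed
qed

section \<open>The quotient by the commutator subgroup of the kernel\<close>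

context adjacent_lift
begin

lemma derived_pure_normal: "derived G pure \<lhd> G"
  by (rule derived_is_normal[OF normal_pure])

lemma derived_pure_subset: "derived G pure \<subseteq> pure"
  by (rule derived_incl[OF subset_refl subgroup_pure])

lemma perm_coset:
  assumes "x \<in> carrier G"
  shows "the_elem (perm ` (derived G pure #> x)) = perm x"
proof -
  have "perm (a \<otimes> x) = perm x" if "a \<in> derived G pure" for a
    using that derived_pure_subset perm_mult[of a x] assms by (auto simp: pure_iff)
  moreover have "x \<in> derived G pure #> x"
    by (rule rcos_self[OF assms normal_imp_subgroup[OF derived_pure_normal]])
  ultimately have "perm ` (derived G pure #> x) = {perm x}" by (auto simp: r_coset_def)
  then show ?thesis by simp
qed

lemma short_exact_mod_derived_pure:
  "short_exact (G\<lparr>carrier := pure\<rparr> Mod derived G pure) (\<lambda>A. A)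
     (G Mod derived G pure) (\<lambda>A. the_elem (perm ` A)) (sym_group n)"
proof -
  define D where "D = derived G pure"
  let ?P = "G\<lparr>carrier := pure\<rparr>"
  let ?A = "?P Mod D" and ?B = "G Mod D" and ?g = "\<lambda>A. the_elem (perm ` A)"
  interpret P: group ?P by (rule subgroup_imp_group[OF subgroup_pure])
  have D: "D \<lhd> G" unfolding D_def by (rule derived_pure_normal)
  interpret D: normal D G by (rule D)
  have DP: "D \<lhd> ?P"
    using P.derived_self_is_normal derived_consistent[OF subset_refl subgroup_pure] by (simp add: D_def)
  have carA: "carrier ?A = {D #> x | x. x \<in> pure}"
    unfolding FactGroup_def RCOSETS_def r_coset_def by auto
  have carB: "carrier ?B = {D #> x | x. x \<in> carrier G}"
    unfolding FactGroup_def RCOSETS_def by auto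
  have oneA: "\<one>\<^bsub>?A\<^esub> = D" and oneB: "\<one>\<^bsub>?B\<^esub> = D" by (simp_all add: FactGroup_def)
  have mult_eq: "X \<otimes>\<^bsub>?A\<^esub> Y = X \<otimes>\<^bsub>?B\<^esub> Y" for X Y by (simp add: FactGroup_def set_mult_def)
  have g: "?g (D #> x) = perm x" if "x \<in> carrier G" for x
    unfolding D_def by (rule perm_coset[OF that])
  have f_hom: "(\<lambda>A. A) \<in> hom ?A ?B"
    by (rule homI) (auto simp: carA carB mult_eq pure_iff)
  have g_hom: "?g \<in> hom ?B (sym_group n)"
  proof (rule homI)
    fix X assume "X \<in> carrier ?B"
    then obtain x where x: "x \<in> carrier G" "X = D #> x" by (auto simp: carB)
    show "?g X \<in> carrier (sym_group n)" unfolding x(2) g[OF x(1)] using perm.hom_closed[OF x(1)] .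
  next
    fix X Y assume "X \<in> carrier ?B" "Y \<in> carrier ?B"
    then obtain x y where x: "x \<in> carrier G" "X = D #> x" and y: "y \<in> carrier G" "Y = D #> y"
      by (auto simp: carB)
    have XY: "X \<otimes>\<^bsub>?B\<^esub> Y = D #> (x \<otimes> y)"
      unfolding x(2) y(2) using D.rcos_sum[OF x(1) y(1)] by (simp add: FactGroup_def)
    show "?g (X \<otimes>\<^bsub>?B\<^esub> Y) = ?g X \<otimes>\<^bsub>sym_group n\<^esub> ?g Y"
      unfolding XY unfolding x(2) y(2) g[OF x(1)] g[OF y(1)] g[OF m_closed[OF x(1) y(1)]]
      by (rule perm.hom_mult[OF x(1) y(1)])
  qed
  have D_mem: "D \<in> carrier ?A"
    using group.is_monoid[OF normal.factorgroup_is_group[OF DP]] monoid.one_closed oneA by metis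
  have ker_f: "kernel ?A ?B (\<lambda>A. A) = {\<one>\<^bsub>?A\<^esub>}"
    using D_mem by (auto simp: kernel_def oneA oneB)
  have im_f: "(\<lambda>A. A) ` carrier ?A = kernel ?B (sym_group n) ?g"
  proof (intro equalityI subsetI)
    fix X assume "X \<in> (\<lambda>A. A) ` carrier ?A"
    then obtain x where x: "x \<in> pure" "X = D #> x" by (auto simp: carA)
    then have xc: "x \<in> carrier G" "perm x = id" by (simp_all add: pure_iff)
    then show "X \<in> kernel ?B (sym_group n) ?g"
      using g[OF xc(1)] x(2) by (auto simp: kernel_def carB sym_group_one)
  next
    fix X assume X: "X \<in> kernel ?B (sym_group n) ?g"
    then obtain x where x: "x \<in> carrier G" "X = D #> x" by (auto simp: kernel_def carB)
    have "perm x = id" using X g[OF x(1)] x(2) by (simp add: kernel_def sym_group_one)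
    then have "x \<in> pure" using x(1) by (simp add: pure_iff)
    then show "X \<in> (\<lambda>A. A) ` carrier ?A" using x(2) by (auto simp: carA)
  qed
  have surj: "?g ` carrier ?B = carrier (sym_group n)"
  proof (intro equalityI subsetI)
    fix p assume "p \<in> ?g ` carrier ?B"
    then show "p \<in> carrier (sym_group n)" using hom_carrier[OF g_hom] by blast
  next
    fix p assume "p \<in> carrier (sym_group n)"
    then obtain x where x: "x \<in> carrier G" "perm x = p" using perm_surj by (auto simp: sym_group_carrier)
    have "D #> x \<in> carrier ?B" using x(1) by (auto simp: carB)
    moreover have "p = ?g (D #> x)" using g[OF x(1)] x(2) by simp
    ultimately show "p \<in> ?g ` carrier ?B" by (rule image_eqI[rotated])
  qed
  show ?thesis
    unfolding short_exact_def D_def[symmetric]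
    using normal.factorgroup_is_group[OF DP] normal.factorgroup_is_group[OF D] sym_group_is_group
      f_hom g_hom ker_f im_f surj by blast
qed

text \<open>A generator has order two, and its class is nontrivial because it permutes labels.\<close>

lemma not_torsion_free_mod_derived_pure:
  assumes "n \<ge> 2"
  shows "\<not> torsion_free_group (G Mod derived G pure)"
proof
  let ?D = "derived G pure"
  let ?B = "G Mod ?D"
  assume tf: "torsion_free_group ?B"
  interpret D: normal ?D G by (rule derived_pure_normal)
  have 1: "1 \<in> {1..<n}" using assms by simp
  have s: "s 1 \<in> carrier G" using s_closed[OF 1] .
  let ?x = "?D #> s 1"
  have x: "?x \<in> carrier ?B" using s by (auto simp: FactGroup_def RCOSETS_def)
  interpret B: group ?B by (rule normal.factorgroup_is_group[OF derived_pure_normal])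
  have "?x [^]\<^bsub>?B\<^esub> (2::nat) = ?x \<otimes>\<^bsub>?B\<^esub> ?x"
    unfolding numeral_2_eq_2 B.nat_pow_Suc B.nat_pow_0 B.l_one[OF x] ..
  also have "\<dots> = ?D #> (s 1 \<otimes> s 1)" using D.rcos_sum[OF s s] by (simp add: FactGroup_def)
  also have "\<dots> = \<one>\<^bsub>?B\<^esub>"
    using s_square[OF 1] coset_mult_one[OF D.subset] by (simp add: FactGroup_def)
  finally have "?x = \<one>\<^bsub>?B\<^esub>" using tf[unfolded torsion_free_group_def, rule_format, of ?x 2] x by simp
  then have "s 1 \<in> ?D" using rcos_self[OF s D.is_subgroup] by (simp add: FactGroup_def)
  then have "perm (s 1) = id" using derived_pure_subset by (auto simp: pure_iff)
  then have "Transposition.transpose 1 (Suc 1) (1::nat) = 1" using perm_s[OF 1] by simp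
  then show False by simp
qed

end

theorem theorem4p6:
  fixes n :: nat
  assumes "n \<ge> 4"
  shows "short_exact
           (pure_twin_group n Mod pure_twin_commutator n) (\<lambda>A. A)
           (twin_group n Mod pure_twin_commutator n) (twin_quotient_perm n)
           (sym_group n)
         \<and> crystallographic_group
             (nat (2 ^ (n - 3) * ((int n)\<^sup>2 - 5 * int n + 8) - 1))
             (twin_group n Mod pure_twin_commutator n)
         \<and> \<not> bieberbach_group (twin_group n Mod pure_twin_commutator n)"
proof -
  interpret T: crossing_lift "twin_group n" n "twin_gen n" "twin_perm n" "twin_crossing n"
    by (rule crossing_lift_twin_group)
  have pure: "pure_twin n = T.pure" by (simp add: pure_twin_def)
  have comm: "pure_twin_commutator n = derived (twin_group n) T.pure"
    unfolding pure_twin_commutator_def pure_twin_group_def pure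
    using T.derived_consistent[OF subset_refl T.subgroup_pure] by simp
  have quot: "twin_quotient_perm n = (\<lambda>A. the_elem (twin_perm n ` A))"
    by (rule ext) (simp add: twin_quotient_perm_def)
  have dim: "nat (2 ^ (n - 3) * ((int n)\<^sup>2 - 5 * int n + 8) - 1) = card (hex_labels n)"
    using card_hex_labels[of n] assms by simp
  show ?thesis
    unfolding comm pure_twin_group_def pure quot dim bieberbach_group_def
    using T.short_exact_mod_derived_pure T.crystallographic_mod_derived_pure[OF assms]
      T.not_torsion_free_mod_derived_pure assms by simp
qed

end
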